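(* Let $a,b,c,d\in\mathbb{Z}$ satisfy $ad-bc=1$ with $a,d$ odd, $b,c$ even, $0\le b<d$ and $c>0$. For odd $n\ge1$ put $q_n=a+bn$ and $p_n=c+dn$. Then for any $g\ge2$: 1. the signature $\sigma_g\!\left(\frac{q_n}{p_n}\right)$ is a polynomial in $n$ ($n$ odd); 2. if the polynomial $H_1$ has no multiple roots and no common root with $H_3$ (polynomials $H_1,H_2,H_3$ defined in the context), then, with $W=\mathbb{Q}[x]/(H_1)$ (a semi-simple algebra of dimension $d$) and $\Omega_W=-H_1'H_2H_3^{-2}\in W$, one has $$\sigma_g\!\left(\frac{q_n}{p_n}\right)\underset{n\to\infty}{\sim}2\left(\frac{n^3}{2\pi^2}\right)^{g-1}\zeta(2g-2)\,\mathrm{Tr}_{W/\mathbb{Q}}\!\left(\Omega_W^{g-1}\right),$$ where $\zeta$ is the Riemann zeta function.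
   Context: **Signatures.** For coprime odd integers $0<q<p$, $\sigma_g(q/p)$ is the signature of the Hermitian vector space $\mathcal{V}_\zeta(S_g)$ attached to the closed genus $g$ surface by the $\mathrm{SU}_2$-TQFT with defining root $\zeta=\exp(i\pi q/p)$. It is given by the following formula. Put $\epsilon_k=(-1)^{\lfloor kq/p\rfloor}$, define $P_k\in\mathbb{Z}[X]$ by $P_{-1}=0$, $P_0=1$, $P_k=\epsilon_kXP_{k-1}+P_{k-2}$, let $V=\mathbb{Q}[X]/(P_{p-1})$ (semi-simple) with $\mathcal{P}_k$ the image of $P_k$, and $\Omega=\sum_{k=0}^{p-2}(-1)^k\epsilon_{k+1}\mathcal{P}_k^2\in V$. Then $\sigma_g(q/p)=\mathrm{Tr}_{V/\mathbb{Q}}(\Omega^{g-1})$. (Under the hypotheses, $p_n,q_n$ are coprime odd integers with $0<q_n<p_n$.) **The polynomials $H_1,H_2,H_3$.** Set $$\alpha_r=\left\lfloor\tfrac{rc}{d}\right\rfloor-\left\lfloor\tfrac{(r-1)c}{d}\right\rfloor\ (0<r<d),\qquad \alpha_d=c-\left\lfloor\tfrac{(d-1)c}{d}\right\rfloor-1,$$ $$N(\alpha)=i^{\alpha}\begin{pmatrix}\alpha+1+x&i^{-1}(\alpha+x)\\ i^{-1}(\alpha+x)&-\alpha+1-x\end{pmatrix}\in \mathrm{GL}_2(\mathbb{Z}[i][x]),$$ and let $\overline{N(\alpha)}$ be obtained by replacing $i$ by $-i$. Define $H_1,H_2,H_3\in\mathbb{Z}[x]$ by $$\begin{pmatrix}iH_1\\H_2\end{pmatrix}=N(\alpha_1)\overline{N(\alpha_2)}N(\alpha_3)\cdots\overline{N(\alpha_{d-1})}N(\alpha_d)\begin{pmatrix}1\\0\end{pmatrix},\qquad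 \begin{pmatrix}H_3\\ *\end{pmatrix}=N(\alpha_1)\overline{N(\alpha_2)}\cdots\overline{N(\alpha_b)}\begin{pmatrix}1\\0\end{pmatrix}$$ (alternating products with $d$, respectively $b$, factors; the empty product is the identity). Here $H_1,H_2$ have degree $d$ and $H_3$ has degree $b$. $H_1'$ is the derivative of $H_1$. *)

theory Defs
  imports
    "HOL-Analysis.Analysis"
    "HOL-Library.Landau_Symbols"
    "HOL-Computational_Algebra.Computational_Algebra"
    "HOL-Computational_Algebra.Field_as_Ring"
    "HOL-Number_Theory.Modular_Inverse"
begin

no_notation fps_nth (infixl \<open>$\<close> 75)

text \<open>
  For \<open>m \<noteq> 0\<close> an element of \<open>K[X]/(m)\<close> is given by a representing polynomial; the classes of
  \<open>1, X, \<dots>, X^(degree m - 1)\<close> form a basis.  The trace of \<open>f\<close> is the trace of the matrix, in this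
  basis, of multiplication by \<open>f\<close>; it depends only on the class of \<open>f\<close>.
\<close>

definition quot_trace :: "'a::field poly \<Rightarrow> 'a poly \<Rightarrow> 'a" where
  "quot_trace m f = (\<Sum>j<degree m. coeff ((f * monom 1 j) mod m) j)"

text \<open>The reduced polynomials are a linear system of representatives of \<open>K[X]/(m)\<close>.\<close>

definition quot_dim :: "'a::field poly \<Rightarrow> nat" where
  "quot_dim m = vector_space.dim smult (range (\<lambda>f. f mod m))"

text \<open>
  Semi-simplicity: every ideal has a complementary ideal.  The ideals of \<open>K[X]/(m)\<close> correspond to
  the ideals of \<open>K[X]\<close> (subspaces of \<open>K[X]\<close> as a module over itself) that contain \<open>m\<close>, and the zero
  ideal corresponds to \<open>(m)\<close>.
\<close>

definition quot_semisimple :: "'a::field poly \<Rightarrow> bool" where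
  "quot_semisimple m \<longleftrightarrow>
     (\<forall>I. module.subspace (*) I \<and> m \<in> I \<longrightarrow>
       (\<exists>J. module.subspace (*) J \<and> m \<in> J \<and> I \<inter> J = {f. m dvd f} \<and> (\<forall>f. \<exists>u\<in>I. \<exists>v\<in>J. f = u + v)))"

definition sgn_eps :: "int \<Rightarrow> int \<Rightarrow> nat \<Rightarrow> int" where
  "sgn_eps q p k = (-1) ^ nat \<lfloor>real k * of_int q / of_int p\<rfloor>"

text \<open>The second equation incorporates the convention that the polynomial of index \<open>-1\<close> is zero.\<close>

fun sgn_P :: "int \<Rightarrow> int \<Rightarrow> nat \<Rightarrow> int poly" where
  "sgn_P q p 0 = 1"
| "sgn_P q p (Suc 0) = [:0, sgn_eps q p 1:]"
| "sgn_P q p (Suc (Suc k)) = [:0, sgn_eps q p (Suc (Suc k)):] * sgn_P q p (Suc k) + sgn_P q p k"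

definition sgn_Omega :: "int \<Rightarrow> int \<Rightarrow> int poly" where
  "sgn_Omega q p = (\<Sum>k = 0..nat p - 2. smult ((-1) ^ k * sgn_eps q p (Suc k)) (sgn_P q p k ^ 2))"

text \<open>
  The signature \<open>\<sigma>_g(q/p)\<close> for coprime odd \<open>0 < q < p\<close> and \<open>g \<ge> 1\<close>, through its trace formula
  over \<open>\<rat>[X]/(P_{p-1})\<close>.
\<close>

definition signature :: "nat \<Rightarrow> int \<Rightarrow> int \<Rightarrow> rat" where
  "signature g q p =
     quot_trace (map_poly of_int (sgn_P q p (nat p - 1))) (map_poly of_int (sgn_Omega q p) ^ (g - 1))"

definition alpha :: "int \<Rightarrow> int \<Rightarrow> nat \<Rightarrow> int" where
  "alpha c d r =
     (if int r < d
      then \<lfloor>of_int (int r * c) / of_int d :: real\<rfloor> - \<lfloor>of_int ((int r - 1) * c) / of_int d :: real\<rfloor>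
      else c - \<lfloor>of_int ((d - 1) * c) / of_int d :: real\<rfloor> - 1)"

text \<open>Matrices over \<open>\<int>[\<i>][x]\<close>, viewed inside \<open>\<complex>[x]\<close>.\<close>

definition N_mat :: "int \<Rightarrow> complex poly ^ 2 ^ 2" where
  "N_mat \<alpha> = vector
     [vector [smult (\<i> powi \<alpha>) [:of_int \<alpha> + 1, 1:], smult (\<i> powi \<alpha> * inverse \<i>) [:of_int \<alpha>, 1:]],
      vector [smult (\<i> powi \<alpha> * inverse \<i>) [:of_int \<alpha>, 1:], smult (\<i> powi \<alpha>) [:- of_int \<alpha> + 1, -1:]]]"

definition cnj_mat :: "complex poly ^ 2 ^ 2 \<Rightarrow> complex poly ^ 2 ^ 2" where
  "cnj_mat A = (\<chi> i j. map_poly cnj (A $ i $ j))"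

primrec N_prod :: "int \<Rightarrow> int \<Rightarrow> nat \<Rightarrow> complex poly ^ 2 ^ 2" where
  "N_prod c d 0 = mat 1"
| "N_prod c d (Suc r) =
     N_prod c d r **
       (if odd (Suc r) then N_mat (alpha c d (Suc r)) else cnj_mat (N_mat (alpha c d (Suc r))))"

definition H1 :: "int \<Rightarrow> int \<Rightarrow> int poly" where
  "H1 c d = (THE h. smult \<i> (map_poly of_int h) = (N_prod c d (nat d) *v vector [1, 0]) $ 1)"

definition H2 :: "int \<Rightarrow> int \<Rightarrow> int poly" where
  "H2 c d = (THE h. map_poly of_int h = (N_prod c d (nat d) *v vector [1, 0]) $ 2)"

definition H3 :: "int \<Rightarrow> int \<Rightarrow> int \<Rightarrow> int poly" where
  "H3 b c d = (THE h. map_poly of_int h = (N_prod c d (nat b) *v vector [1, 0]) $ 1)"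

text \<open>
  A representative in \<open>\<rat>[x]\<close>; meaningful when \<open>H1\<close> and \<open>H3\<close> are coprime, since \<open>modular_inverse\<close> is
  zero otherwise.
\<close>

definition Omega_W :: "int \<Rightarrow> int \<Rightarrow> int \<Rightarrow> rat poly" where
  "Omega_W b c d =
     - map_poly of_int (pderiv (H1 c d)) * map_poly of_int (H2 c d) *
       modular_inverse (map_poly of_int (H1 c d)) (map_poly of_int (H3 b c d)) ^ 2"

definition zeta_nat :: "nat \<Rightarrow> real" where
  "zeta_nat s = (\<Sum>n. 1 / real (Suc n) ^ s)"

text \<open>
  The descriptions in the definitions of \<open>H1\<close>, \<open>H2\<close>, \<open>H3\<close> are satisfied: lemmas \<open>H1_H2_eq\<close> and \<open>H3_eq\<close>.
\<close>

abbreviation (input) cpoly :: "int poly \<Rightarrow> complex poly" where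
  "cpoly \<equiv> map_poly of_int"

lemma cpoly_mult: "cpoly (p * q) = cpoly p * cpoly q"
  by (rule poly_eqI) (simp add: coeff_map_poly coeff_mult)

lemma cpoly_add: "cpoly (p + q) = cpoly p + cpoly q"
  by (rule poly_eqI) (simp add: coeff_map_poly)

lemma cpoly_diff: "cpoly (p - q) = cpoly p - cpoly q"
  by (rule poly_eqI) (simp add: coeff_map_poly)

lemma cpoly_uminus: "cpoly (- p) = - cpoly p"
  by (rule poly_eqI) (simp add: coeff_map_poly)

lemma cpoly_inj: "cpoly p = cpoly q \<longleftrightarrow> p = q"
  by (auto simp: poly_eq_iff coeff_map_poly)

lemma smult_i_cpoly_inj: "smult \<i> (cpoly p) = smult \<i> (cpoly q) \<Longrightarrow> p = q"
  by (auto simp: poly_eq_iff coeff_map_poly)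

definition gauss_form ::
    "complex poly ^ 2 ^ 2 \<Rightarrow> int \<Rightarrow> int poly \<Rightarrow> int poly \<Rightarrow> int poly \<Rightarrow> int poly \<Rightarrow> bool" where
  "gauss_form M s A B C D \<longleftrightarrow>
     M $ 1 $ 1 = smult (\<i> powi s) (cpoly A) \<and> M $ 1 $ 2 = smult (\<i> powi s * - \<i>) (cpoly B) \<and>
     M $ 2 $ 1 = smult (\<i> powi s * - \<i>) (cpoly C) \<and> M $ 2 $ 2 = smult (\<i> powi s) (cpoly D)"

lemma gauss_form_N_mat:
  "gauss_form (N_mat k) k [:k + 1, 1:] [:k, 1:] [:k, 1:] [:1 - k, -1:]"
  by (simp add: gauss_form_def N_mat_def map_poly_pCons)

lemma cnj_powi_i: "cnj (\<i> powi k) = \<i> powi (- k)"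
proof -
  have "cnj (\<i> powi k) = inverse \<i> powi k" by simp
  also have "\<dots> = \<i> powi (- k)" by (simp only: power_int_inverse power_int_minus)
  finally show ?thesis .
qed

lemma gauss_form_cnj:
  assumes "gauss_form M s A B C D"
  shows "gauss_form (cnj_mat M) (- s) A (- B) (- C) D"
proof -
  have *: "map_poly cnj (smult z (cpoly p)) = smult (cnj z) (cpoly p)" for z p
    by (rule poly_eqI) (simp add: coeff_map_poly)
  show ?thesis
    using assms
    by (simp only: gauss_form_def cnj_mat_def vec_lambda_beta * complex_cnj_mult cnj_powi_i
        complex_cnj_minus complex_cnj_i cpoly_uminus)
      simp
qed

lemma gauss_form_mult:
  assumes "gauss_form M s A B C D" "gauss_form M' s' A' B' C' D'"
  shows "gauss_form (M ** M') (s + s')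
     (A * A' - B * C') (A * B' + B * D') (C * A' + D * C') (D * D' - C * B')"
proof -
  have *: "smult (x * - \<i>) p * smult (y * - \<i>) q = - smult (x * y) (p * q)"
    "smult x p * smult (y * - \<i>) q = smult (x * y * - \<i>) (p * q)"
    "smult (x * - \<i>) p * smult y q = smult (x * y * - \<i>) (p * q)"
    "smult x p * smult y q = smult (x * y) (p * q)" for x y p q
    by (simp_all add: mult_ac)
  have **: "\<i> powi (s + s') = \<i> powi s * \<i> powi s'"
    by (simp add: power_int_add)
  have "(M ** M') $ i $ j = M $ i $ 1 * M' $ 1 $ j + M $ i $ 2 * M' $ 2 $ j" for i j
    by (simp add: matrix_matrix_mult_def sum_2)
  then show ?thesis
    using assms unfolding gauss_form_def
    by (simp only: * ** cpoly_mult cpoly_add cpoly_diff smult_add_right smult_diff_right)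
       (simp add: algebra_simps)
qed

lemma sum_alpha:
  assumes "0 < d"
  shows "int r \<le> d \<Longrightarrow> (\<Sum>k = 1..r. alpha c d k) = (if int r < d then (int r * c) div d else c - 1)"
proof (induction r)
  case 0
  then show ?case using assms by simp
next
  case (Suc r)
  then have "(\<Sum>k = 1..r. alpha c d k) = (int r * c) div d" by simp
  moreover have "d - 1 = int r" if "\<not> int (Suc r) < d" using Suc.prems that by simp
  ultimately show ?case
    by (auto simp: alpha_def floor_divide_of_int_eq simp del: of_int_mult)
qed

lemma gauss_form_N_prod:
  "\<exists>s A B C D. gauss_form (N_prod c d r) s A B C D \<and> even (s - (\<Sum>k = 1..r. alpha c d k))"
proof (induction r)
  case 0
  have "gauss_form (N_prod c d 0) 0 1 0 0 1"
    by (simp add: gauss_form_def mat_def)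
  moreover have "even (0 - (\<Sum>k = 1..0. alpha c d k))" by simp
  ultimately show ?case by blast
next
  case (Suc r)
  then obtain s A B C D where
    *: "gauss_form (N_prod c d r) s A B C D" "even (s - (\<Sum>k = 1..r. alpha c d k))" by blast
  let ?k = "alpha c d (Suc r)"
  let ?M = "if odd (Suc r) then N_mat ?k else cnj_mat (N_mat ?k)"
  have "\<exists>s' A' B' C' D'. gauss_form ?M s' A' B' C' D' \<and> even (s' - ?k)"
  proof (cases "odd (Suc r)")
    case True
    have "even (?k - ?k)" by simp
    then show ?thesis using gauss_form_N_mat[of ?k] unfolding if_P[OF True] by blast
  next
    case False
    have "even (- ?k - ?k)" by simp
    then show ?thesis
      using gauss_form_cnj[OF gauss_form_N_mat[of ?k]] unfolding if_not_P[OF False] by blast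
  qed
  then obtain s' A' B' C' D' where **: "gauss_form ?M s' A' B' C' D'" "even (s' - ?k)" by blast
  have "(\<Sum>k = 1..Suc r. alpha c d k) = (\<Sum>k = 1..r. alpha c d k) + ?k" by simp
  then have "s + s' - (\<Sum>k = 1..Suc r. alpha c d k) = (s - (\<Sum>k = 1..r. alpha c d k)) + (s' - ?k)"
    by linarith
  then have "even (s + s' - (\<Sum>k = 1..Suc r. alpha c d k))"
    using *(2) **(2) by (metis dvd_add)
  then show ?case
    using gauss_form_mult[OF *(1) **(1)] unfolding N_prod.simps by blast
qed

lemma powi_i_even:
  assumes "even s"
  shows "\<i> powi s = 1 \<or> \<i> powi s = -1"
proof -
  obtain k where "s = 2 * k" using assms by blast
  then have "\<i> powi s = (-1) powi k" by (simp add: power_int_mult)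
  then show ?thesis by (cases "even k") simp_all
qed

lemma powi_i_odd:
  assumes "odd s"
  shows "\<i> powi s = \<i> \<or> \<i> powi s = - \<i>"
proof -
  have "\<i> powi s = \<i> * \<i> powi (s - 1)" by (simp add: power_int_diff)
  then show ?thesis using powi_i_even[of "s - 1"] assms by auto
qed

lemma H1_H2_eq:
  assumes "odd d" "even c" "0 < d"
  shows "vector [smult \<i> (map_poly of_int (H1 c d)), map_poly of_int (H2 c d)] =
    N_prod c d (nat d) *v vector [1, 0]"
proof -
  let ?v = "N_prod c d (nat d) *v vector [1, 0]"
  obtain s A B C D where *: "gauss_form (N_prod c d (nat d)) s A B C D"
    "even (s - (\<Sum>k = 1..nat d. alpha c d k))"
    using gauss_form_N_prod by blast
  have "odd s" using * assms sum_alpha[of d "nat d" c] by auto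
  have v: "?v $ 1 = smult (\<i> powi s) (cpoly A)" "?v $ 2 = smult (\<i> powi s * - \<i>) (cpoly C)"
    using *(1) by (simp_all add: gauss_form_def matrix_vector_mult_def sum_2)
  have "\<exists>h. smult \<i> (cpoly h) = ?v $ 1"
    using powi_i_odd[OF \<open>odd s\<close>]
    by (auto intro: exI[of _ A] exI[of _ "- A"] simp: cpoly_uminus v)
  then have "\<exists>!h. smult \<i> (cpoly h) = ?v $ 1" by (metis smult_i_cpoly_inj)
  then have 1: "smult \<i> (cpoly (H1 c d)) = ?v $ 1" unfolding H1_def by (rule theI')
  have "\<exists>h. cpoly h = ?v $ 2"
    using powi_i_odd[OF \<open>odd s\<close>]
    by (auto intro: exI[of _ C] exI[of _ "- C"] simp: cpoly_uminus v)
  then have "\<exists>!h. cpoly h = ?v $ 2" by (metis cpoly_inj)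
  then have "cpoly (H2 c d) = ?v $ 2" unfolding H2_def by (rule theI')
  with 1 show ?thesis by (simp add: vec_eq_iff forall_2)
qed

lemma H3_eq:
  assumes "a * d - b * c = 1" "odd a" "0 \<le> b" "b < d"
  shows "map_poly of_int (H3 b c d) = (N_prod c d (nat b) *v vector [1, 0]) $ 1"
proof -
  let ?v = "N_prod c d (nat b) *v vector [1, 0]"
  obtain s A B C D where *: "gauss_form (N_prod c d (nat b)) s A B C D"
    "even (s - (\<Sum>k = 1..nat b. alpha c d k))"
    using gauss_form_N_prod by blast
  have "b * c = (d - 1) + d * (a - 1)" using assms(1) by (simp add: algebra_simps)
  then have "(b * c) div d = a - 1" using assms by (simp only: div_mult_self2) simp
  then have "even s" using * assms sum_alpha[of d "nat b" c] by auto
  have v: "?v $ 1 = smult (\<i> powi s) (cpoly A)"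
    using *(1) by (simp add: gauss_form_def matrix_vector_mult_def sum_2)
  have "\<exists>h. cpoly h = ?v $ 1"
    using powi_i_even[OF \<open>even s\<close>]
    by (auto intro: exI[of _ A] exI[of _ "- A"] simp: cpoly_uminus v)
  then have "\<exists>!h. cpoly h = ?v $ 1" by (metis cpoly_inj)
  then show ?thesis unfolding H3_def by (rule theI')
qed

end

theory Submission
  imports Defs "HOL-Complex_Analysis.Complex_Analysis"
begin

text \<open>
  With \<open>b/d\<close> in place of \<open>q\<^sub>n/p\<^sub>n\<close> the signs \<open>\<epsilon>\<^sub>k\<close> become a \<open>d\<close>-periodic pattern that does not
  depend on \<open>n\<close>, so the polynomials \<open>P\<^sub>k\<close> are solutions of one periodic recurrence, whose monodromy over
  \<open>2 d\<close> steps has trace \<open>T\<^sup>2 + 2\<close>.  The trace defining the signature is a sum of residues at the roots of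
  \<open>P\<^bsub>p-1\<^esub>\<close>; by the residue theorem it is minus the sum of the residues at the roots of \<open>T\<^sup>2 + 4\<close>,
  where the monodromy is parabolic.  Near such a root the \<open>n\<close>-th power of the monodromy is governed by
  trigonometric functions of \<open>n\<close> times a local parameter, so that the residue is a polynomial in \<open>n\<close> whose
  coefficient of \<open>n\<^bsup>3(g-1)\<^esup>\<close> comes from the expansion of the cotangent, hence the value of zeta.  An
  explicit duality carries the parabolic points with \<open>T = 2\<i>\<close> to the roots of \<open>H\<^sub>1\<close> and the local
  contribution to \<open>\<Omega>\<^sub>W\<close>.  The leading coefficient does not vanish because, modulo \<open>2\<close>, exactly
  one of the parabolic points contributes.
\<close>

section \<open>Traces as sums over roots\<close>

text \<open>Both \<open>P_(p-1)\<close> and \<open>\<Omega>\<close> change with \<open>n\<close>.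
  The Christoffel-Darboux identity turns \<open>\<Omega>\<close> into a Wronskian, and at every root
  of \<open>P_(p-1)\<close> it takes the value of \<open>(2 n U T' + K) / (T^2 + 4)\<close>, where
  \<open>T\<close>, \<open>U\<close>, \<open>K\<close> are polynomials free of \<open>n\<close>. The
  integrand is the power \<open>m = g - 1\<close> of this fraction times the logarithmic derivative
  of \<open>P_(p-1)\<close>: it weights roots as the trace does, and its other poles do not move
  with \<open>n\<close>. The two sets of poles must be disjoint; this comes from reduction at a
  place over \<open>2\<close>, which erases the signs and leaves Fibonacci polynomials, coprime for
  coprime indices. At a parabolic point the angle of the monodromy is a holomorphic function times a
  square root of \<open>T^2 + 4\<close>, so only the even kernels
  \<open>arcsin (sqrt w) / sqrt w\<close> and \<open>sin (sqrt w) / sqrt w\<close> occur. The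
  argument \<open>w\<close> of the latter carries a factor \<open>T^2 + 4\<close>, hence its
  logarithmic derivative matters only up to order \<open>m\<close>, and the residue is a polynomial
  in \<open>n\<close> of degree at most \<open>3 m\<close>.\<close>

lemma quot_trace_eq_coeff:
  fixes m f :: "'a::field poly"
  assumes "degree m > 0"
  shows "quot_trace m f = coeff ((f * pderiv m) mod m) (degree m - 1) / lead_coeff m"
proof -
  define N where "N = degree m"
  \<comment> \<open>Up to the factor \<open>lead_coeff m\<close> this is the basis dual to the
    powers of \<open>X\<close> for the pairing that takes two classes to the coefficient of degree
    \<open>N - 1\<close> of their product. It consists of the coefficients of \<open>Y^j\<close> in
    \<open>(m(X) - m(Y)) / (X - Y)\<close>.\<close>
  define b where "b j = (\<Sum>i\<in>{Suc j..N}. monom (coeff m i) (i - Suc j))" for j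
  have N: "N > 0" "m \<noteq> 0" using assms by (auto simp: N_def)
  have mred: "coeff ((monom 1 k * b j) mod m) (N - 1) = (if k = j then lead_coeff m else 0)"
    if "k < N" "j < N" for j k
  proof -
    have split: "monom 1 (Suc j) * b j = m - (\<Sum>i\<in>{..j}. monom (coeff m i) i)" 
    proof -
      have "monom 1 (Suc j) * b j = (\<Sum>i\<in>{Suc j..N}. monom (coeff m i) i)"
        unfolding b_def sum_distrib_left by (intro sum.cong) (auto simp: mult_monom)
      moreover have "m = (\<Sum>i\<in>{..N}. monom (coeff m i) i)"
        unfolding N_def by (simp add: poly_as_sum_of_monoms)
      moreover have "{..N} = {..j} \<union> {Suc j..N}" using that by auto
      moreover have "(\<Sum>i\<in>{..j} \<union> {Suc j..N}. monom (coeff m i) i) =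
          (\<Sum>i\<in>{..j}. monom (coeff m i) i) + (\<Sum>i\<in>{Suc j..N}. monom (coeff m i) i)"
        by (intro sum.union_disjoint) auto
      ultimately have "m = (\<Sum>i\<in>{..j}. monom (coeff m i) i) + monom 1 (Suc j) * b j" by (simp only:)
      thus ?thesis by (simp only: eq_diff_eq add.commute)
    qed
    show ?thesis
    proof (cases "k \<le> j")
      case True
      have "degree (b j) \<le> N - Suc j"
        unfolding b_def by (intro degree_sum_le) (auto intro: order.trans[OF degree_monom_le])
      have deg: "degree (monom 1 k * b j) \<le> k + (N - Suc j)"
        by (rule order.trans[OF degree_mult_le] add_mono degree_monom_le \<open>degree (b j) \<le> N - Suc j\<close>)+
      hence "degree (monom 1 k * b j) < degree m" using True that by (simp add: N_def)
      hence "(monom 1 k * b j) mod m = monom 1 k * b j" by (rule mod_poly_less)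
      moreover have "coeff (b j) (N - 1 - k) = (if k = j then lead_coeff m else 0)"
      proof -
        have "coeff (b j) (N - 1 - k) = (\<Sum>i\<in>{Suc j..N}. if i - Suc j = N - 1 - k then coeff m i else 0)"
          unfolding b_def by (simp add: coeff_sum)
        also have "\<dots> = (\<Sum>i\<in>{Suc j..N}. if i = N \<and> k = j then coeff m i else 0)"
          using True that by (intro sum.cong) auto
        also have "\<dots> = (if k = j then lead_coeff m else 0)" using that by (auto simp: N_def)
        finally show ?thesis .
      qed
      ultimately show ?thesis using that by (auto simp: coeff_monom_mult)
    next
      case False
      \<comment> \<open>For \<open>k > j\<close> the identity \<open>split\<close> trades the upper
        part of \<open>m\<close> for its lower part, which leaves degree at most
        \<open>k - 1 < N - 1\<close>.\<close>
      define r where "r = monom 1 (k - Suc j) * (\<Sum>i\<in>{..j}. monom (coeff m i) i)"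
      have "monom 1 k * b j = monom 1 (k - Suc j) * (monom 1 (Suc j) * b j)"
        using False by (simp add: mult.assoc[symmetric] mult_monom)
      also have "\<dots> = - r + monom 1 (k - Suc j) * m" unfolding split r_def by (simp add: algebra_simps)
      finally have "(monom 1 k * b j) mod m = (- r) mod m"
        by (simp only: mod_mult_self1)
      moreover have "degree r \<le> (k - Suc j) + j"
        unfolding r_def
        by (rule order.trans[OF degree_mult_le] add_mono degree_monom_le)+
          (intro degree_sum_le, auto intro: order.trans[OF degree_monom_le])
      hence "degree r < N - 1" using False that by linarith
      moreover have "(- r) mod m = - r"
        by (rule mod_poly_less) (use \<open>degree r < N - 1\<close> in \<open>simp add: N_def\<close>)
      ultimately have "(monom 1 k * b j) mod m = - r" by simp
      thus ?thesis using False \<open>degree r < N - 1\<close> by (simp add: coeff_eq_0)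
    qed
  qed
  have red: "coeff ((g * b j) mod m) (N - 1) = lead_coeff m * coeff (g mod m) j" if "j < N" for g j
  proof -
    define h where "h = g mod m"
    have dh: "degree h < N" using N degree_mod_less'[of m g] unfolding h_def N_def
      by (metis assms degree_0 degree_mod_less)
    have "(g * b j) mod m = (h * b j) mod m" unfolding h_def by (simp add: mod_mult_left_eq)
    also have "h = (\<Sum>k<N. smult (coeff h k) (monom 1 k))"
      using dh by (intro poly_eqI) (auto simp: coeff_sum coeff_eq_0 if_distrib cong: if_cong)
    also have "coeff ((\<dots> * b j) mod m) (N - 1) = (\<Sum>k<N. coeff h k * coeff ((monom 1 k * b j) mod m) (N - 1))"
    proof -
      have "((\<Sum>k\<in>I. smult (coeff h k) (monom 1 k)) * b j) mod m
          = (\<Sum>k\<in>I. smult (coeff h k) ((monom 1 k * b j) mod m))" if "finite I" for I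
        using that by (induction I rule: finite_induct)
          (simp_all add: distrib_right poly_mod_add_left mod_smult_left)
      thus ?thesis by (simp add: coeff_sum)
    qed
    also have "\<dots> = (\<Sum>k<N. if k = j then coeff h k * lead_coeff m else 0)"
      by (rule sum.cong[OF refl]) (simp only: lessThan_iff mred[OF _ that] if_distrib[of "(*) _"] mult_zero_right cong: if_cong)
    finally show ?thesis using that by (simp add: h_def mult.commute)
  qed
  \<comment> \<open>On the diagonal \<open>X = Y\<close> the difference quotient becomes the
    derivative, so the diagonal entries of the multiplication matrix combine into a single
    coefficient (Euler's trace formula).\<close>
  have der: "(\<Sum>j<N. monom 1 j * b j) = pderiv m"
  proof (rule poly_eqI)
    fix l
    have "(\<Sum>j<N. monom 1 j * b j) = (\<Sum>j<N. \<Sum>i\<in>{Suc j..N}. monom (coeff m i) (i - 1))"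
      unfolding b_def sum_distrib_left by (intro sum.cong) (auto simp: mult_monom)
    hence "coeff (\<Sum>j<N. monom 1 j * b j) l = (\<Sum>j<N. \<Sum>i\<in>{Suc j..N}. if i - 1 = l then coeff m i else 0)"
      by (simp add: coeff_sum)
    also have "\<dots> = (\<Sum>j<N. \<Sum>i\<in>{Suc j..N}. if i = Suc l then coeff m i else 0)"
      by (intro sum.cong refl) auto
    also have "\<dots> = (\<Sum>j<N. if j \<le> l \<and> Suc l \<le> N then coeff m (Suc l) else 0)"
      by (intro sum.cong refl) auto
    also have "\<dots> = of_nat (Suc l) * coeff m (Suc l)"
    proof (cases "Suc l \<le> N")
      case True
      hence "(\<Sum>j<N. if j \<le> l \<and> Suc l \<le> N then coeff m (Suc l) else 0) = (\<Sum>j\<in>{..l}. coeff m (Suc l))"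
        by (intro sum.mono_neutral_cong_right) auto
      thus ?thesis by simp
    next
      case False
      thus ?thesis by (simp add: N_def coeff_eq_0)
    qed
    finally show "coeff (\<Sum>j<N. monom 1 j * b j) l = coeff (pderiv m) l" by (simp add: coeff_pderiv)
  qed
  have "coeff ((f * pderiv m) mod m) (N - 1) = (\<Sum>j<N. coeff ((f * monom 1 j * b j) mod m) (N - 1))"
  proof -
    have "(\<Sum>j\<in>I. f * (monom 1 j * b j)) mod m = (\<Sum>j\<in>I. (f * monom 1 j * b j) mod m)" if "finite I" for I
      using that by (induction I rule: finite_induct) (simp_all add: poly_mod_add_left mult.assoc)
    thus ?thesis unfolding der[symmetric] by (simp add: sum_distrib_left coeff_sum)
  qed
  also have "\<dots> = (\<Sum>j<N. lead_coeff m * coeff ((f * monom 1 j) mod m) j)"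
    by (rule sum.cong[OF refl]) (simp only: lessThan_iff red)
  also have "\<dots> = lead_coeff m * quot_trace m f" by (simp add: quot_trace_def N_def sum_distrib_left)
  finally show ?thesis using N by (simp add: N_def)
qed

text \<open>Modulo \<open>X - z\<close> the polynomial \<open>f\<close> is the constant
  \<open>f(z)\<close>; multiplied by the cofactor \<open>h\<close> this becomes a congruence modulo
  \<open>m\<close>, and \<open>h\<close> is already reduced.\<close>

lemma coeff_mod_linear_cofactor:
  fixes m f h :: "'a::field poly"
  assumes "m = [:-z, 1:] * h" "m \<noteq> 0"
  shows "coeff ((f * h) mod m) (degree m - 1) = poly f z * lead_coeff m"
proof -
  have h: "h \<noteq> 0" using assms by auto
  have deg: "degree m = Suc (degree h)" using h by (simp add: assms(1) degree_mult_eq del: mult_pCons_left)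
  obtain q where q: "f - [:poly f z:] = [:-z, 1:] * q"
    by (metis dvdE diff_self poly_diff poly_pCons poly_0 mult_zero_right add.right_neutral poly_eq_0_iff_dvd)
  have "f * h = smult (poly f z) h + m * q"
    using q by (simp add: assms(1) algebra_simps del: mult_pCons_left mult_pCons_right)
      (metis (no_types, lifting) add_diff_cancel_left' add_diff_eq diff_add_cancel distrib_left mult.assoc mult.commute mult_pCons_left mult_zero_left pCons_0_0 smult_add_right add_0_right)
  hence "(f * h) mod m = smult (poly f z) h mod m" by simp
  also have "\<dots> = smult (poly f z) h"
    by (rule mod_poly_less) (use deg in \<open>simp add: less_Suc_eq_le degree_smult_le\<close>)
  finally have "coeff ((f * h) mod m) (degree m - 1) = poly f z * lead_coeff h" using deg by simp
  also have "lead_coeff h = lead_coeff m" by (simp add: assms(1) lead_coeff_mult del: mult_pCons_left)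
  finally show ?thesis .
qed

lemma poly_of_proots:
  fixes m :: "complex poly"
  shows "m = smult (lead_coeff m) (\<Prod>z\<in>#proots m. [:-z, 1:])"
  using alg_closed_imp_factorization by (metis complex_poly_decompose_multiset)

lemma pderiv_prod_mset_linear:
  "pderiv (\<Prod>z\<in>#A. [:-z, 1:]) = (\<Sum>z\<in>#A. (\<Prod>w\<in>#A - {#z#}. [:-w, 1:] :: 'a::idom poly))"
proof (induction A)
  case (add a A)
  have "pderiv (\<Prod>z\<in>#add_mset a A. [:-z, 1:]) =
      (\<Prod>z\<in>#A. [:-z, 1:]) + [:-a, 1:] * (\<Sum>z\<in>#A. (\<Prod>w\<in>#A - {#z#}. [:-w, 1:]))"
    unfolding image_mset_add_mset prod_mset.add_mset pderiv_mult add.IH by (simp add: pderiv_pCons)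
  also have "[:-a, 1:] * (\<Sum>z\<in>#A. (\<Prod>w\<in>#A - {#z#}. [:-w, 1:])) =
      (\<Sum>z\<in>#A. (\<Prod>w\<in>#add_mset a A - {#z#}. [:-w, 1:]))"
    unfolding sum_mset_distrib_left
    by (intro arg_cong[where f = sum_mset] image_mset_cong) (simp add: multiset_add_sub_el_shuffle)
  finally show ?case by simp
qed simp

text \<open>The derivative of \<open>m\<close> is the sum of the cofactors of its roots, each root
  taken with multiplicity, so Euler's formula evaluates \<open>f\<close> root by root.\<close>

theorem quot_trace_eq_sum_roots:
  fixes m f :: "complex poly"
  assumes "m \<noteq> 0"
  shows "quot_trace m f = (\<Sum>z\<in>#proots m. poly f z)"
proof (cases "degree m = 0")
  case True
  then obtain a where "m = [:a:]" by (metis degree_eq_zeroE)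
  thus ?thesis using assms True by (simp add: quot_trace_def)
next
  case False
  define N where "N = degree m - 1"
  have co: "coeff ((f * (smult (lead_coeff m) (\<Prod>w\<in>#proots m - {#z#}. [:-w, 1:]))) mod m) N = poly f z * lead_coeff m"
    if "z \<in># proots m" for z
  proof -
    have "m = [:-z, 1:] * smult (lead_coeff m) (\<Prod>w\<in>#proots m - {#z#}. [:-w, 1:])"
    proof -
      have "(\<Prod>w\<in>#proots m. [:-w, 1:]) = [:-z, 1:] * (\<Prod>w\<in>#proots m - {#z#}. [:-w, 1:])"
        by (subst insert_DiffM[OF that, symmetric]) (simp only: image_mset_add_mset prod_mset.add_mset)
      thus ?thesis by (subst poly_of_proots[of m]) (simp only: mult_smult_right)
    qed
    from coeff_mod_linear_cofactor[OF this assms] show ?thesis by (simp add: N_def)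
  qed
  have lin: "coeff ((f * (\<Sum>z\<in>#B. g z)) mod m) N = (\<Sum>z\<in>#B. coeff ((f * g z) mod m) N)" for B and g :: "complex \<Rightarrow> complex poly"
    by (induction B) (simp_all add: distrib_left poly_mod_add_left)
  have sm: "smult a (\<Sum>z\<in>#B. g z) = (\<Sum>z\<in>#B. smult a (g z))" for a B and g :: "complex \<Rightarrow> complex poly"
    by (induction B) (simp_all add: smult_add_right)
  have "pderiv m = (\<Sum>z\<in>#proots m. smult (lead_coeff m) (\<Prod>w\<in>#proots m - {#z#}. [:-w, 1:]))"
    by (subst poly_of_proots[of m], subst pderiv_smult, subst pderiv_prod_mset_linear, subst sm) simp
  hence "coeff ((f * pderiv m) mod m) N = (\<Sum>z\<in>#proots m. poly f z * lead_coeff m)"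
    by (simp only: lin) (intro arg_cong[where f = sum_mset] image_mset_cong, simp only: co)
  also have "\<dots> = (\<Sum>z\<in>#proots m. poly f z) * lead_coeff m"
    by (simp only: sum_mset_distrib_right)
  finally show ?thesis using quot_trace_eq_coeff[of m f] False assms by (simp add: N_def)
qed

section \<open>Base change of the trace from rational to complex coefficients\<close>

lemma map_poly_of_rat_hom:
  "map_poly of_rat (p + q) = (map_poly of_rat p + map_poly of_rat q :: complex poly)"
  "map_poly of_rat (p * q) = (map_poly of_rat p * map_poly of_rat q :: complex poly)"
  "degree (map_poly of_rat p :: complex poly) = degree p"
proof -
  show "map_poly of_rat (p + q) = (map_poly of_rat p + map_poly of_rat q :: complex poly)"
    by (rule poly_eqI) (simp add: coeff_map_poly of_rat_add)
  show "map_poly of_rat (p * q) = (map_poly of_rat p * map_poly of_rat q :: complex poly)"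
    by (rule poly_eqI) (simp add: coeff_map_poly coeff_mult of_rat_sum of_rat_mult)
  show "degree (map_poly of_rat p :: complex poly) = degree p"
    by (intro degree_map_poly) simp
qed

lemma map_poly_of_rat_mod:
  "map_poly of_rat (p mod q) = (map_poly of_rat p mod map_poly of_rat q :: complex poly)"
proof (cases "q = 0")
  case False
  let ?r = "map_poly of_rat :: rat poly \<Rightarrow> complex poly"
  have "?r p = ?r (p div q) * ?r q + ?r (p mod q)"
    by (simp flip: map_poly_of_rat_hom(1,2))
  hence "?r p mod ?r q = ?r (p mod q) mod ?r q" by simp
  also have "\<dots> = ?r (p mod q)"
  proof (cases "p mod q = 0")
    case False
    have "degree (p mod q) < degree q" using degree_mod_less'[OF \<open>q \<noteq> 0\<close> False] .
    thus ?thesis by (intro mod_poly_less) (simp add: map_poly_of_rat_hom)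
  qed simp
  finally show ?thesis ..
qed simp

lemma of_rat_quot_trace:
  "of_rat (quot_trace m f) = (quot_trace (map_poly of_rat m) (map_poly of_rat f) :: complex)"
proof -
  have "map_poly of_rat ((f * monom 1 j) mod m) = (map_poly of_rat f * monom 1 j) mod (map_poly of_rat m :: complex poly)" for j
    by (simp add: map_poly_of_rat_mod map_poly_of_rat_hom map_poly_monom)
  hence "of_rat (coeff ((f * monom 1 j) mod m) j) = (coeff ((map_poly of_rat f * monom 1 j) mod map_poly of_rat m) j :: complex)" for j
    by (metis coeff_map_poly of_rat_0)
  thus ?thesis by (simp add: quot_trace_def map_poly_of_rat_hom of_rat_sum)
qed

lemma map_poly_of_rat_of_int: "map_poly of_rat (map_poly of_int p) = (map_poly of_int p :: complex poly)"
  by (rule poly_eqI) (simp add: coeff_map_poly)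

section \<open>Three-term recurrences with signs\<close>

definition sol :: "(nat \<Rightarrow> int) \<Rightarrow> 'a::comm_ring_1 \<Rightarrow> (nat \<Rightarrow> 'a) \<Rightarrow> bool" where
  "sol e x f \<longleftrightarrow> (\<forall>k. f (Suc (Suc k)) = of_int (e (Suc k)) * x * f (Suc k) + f k)"

text \<open>The polynomial \<open>P_k\<close> is the term of index \<open>k + 1\<close>; the
  convention for index \<open>-1\<close> becomes the initial value \<open>0\<close>.\<close>

fun fund :: "(nat \<Rightarrow> int) \<Rightarrow> 'a::comm_ring_1 \<Rightarrow> nat \<Rightarrow> 'a" where
  "fund e x 0 = 0"
| "fund e x (Suc 0) = 1"
| "fund e x (Suc (Suc k)) = of_int (e (Suc k)) * x * fund e x (Suc k) + fund e x k"

fun cofund :: "(nat \<Rightarrow> int) \<Rightarrow> 'a::comm_ring_1 \<Rightarrow> nat \<Rightarrow> 'a" where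
  "cofund e x 0 = 1"
| "cofund e x (Suc 0) = 0"
| "cofund e x (Suc (Suc k)) = of_int (e (Suc k)) * x * cofund e x (Suc k) + cofund e x k"

text \<open>Fibonacci polynomials: a two-by-two matrix \<open>S\<close> of trace \<open>t\<close>
  and determinant \<open>-1\<close> satisfies
  \<open>S^(n+1) = fibo t (n+1) S + fibo t n\<close>.\<close>

fun fibo :: "'a::comm_ring_1 \<Rightarrow> nat \<Rightarrow> 'a" where
  "fibo t 0 = 0"
| "fibo t (Suc 0) = 1"
| "fibo t (Suc (Suc k)) = t * fibo t (Suc k) + fibo t k"

lemma sol_fund: "sol e x (fund e x)" and sol_cofund: "sol e x (cofund e x)"
  by (simp_all add: sol_def)

lemma solD: "sol e x f \<Longrightarrow> f (Suc (Suc k)) = of_int (e (Suc k)) * x * f (Suc k) + f k"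
  by (simp add: sol_def)

lemma sol_lincomb: "sol e x f \<Longrightarrow> sol e x h \<Longrightarrow> sol e x (\<lambda>k. a * f k + b * h k)"
  by (simp add: sol_def algebra_simps)

lemma sol_eqI:
  assumes "sol e x f" "sol e x h" "f 0 = h 0" "f 1 = h 1"
  shows "f k = h k"
proof -
  have "f k = h k \<and> f (Suc k) = h (Suc k)"
    using assms by (induction k) (simp_all add: sol_def)
  thus ?thesis ..
qed

text \<open>Each one-step transfer matrix has determinant \<open>-1\<close>, whatever its sign and
  \<open>x\<close>.\<close>

lemma sol_wronskian:
  assumes "sol e x f" "sol e x h"
  shows "f (Suc k) * h k - f k * h (Suc k) = (-1) ^ k * (f 1 * h 0 - f 0 * h 1)"
proof (induction k)
  case (Suc k)
  have "f (Suc (Suc k)) * h (Suc k) - f (Suc k) * h (Suc (Suc k)) = - (f (Suc k) * h k - f k * h (Suc k))"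
    using assms by (simp add: solD algebra_simps)
  thus ?case using Suc by simp
qed simp

text \<open>Pairing \<open>f\<close> read from the left with \<open>h\<close> read from the right
  gives a number that does not depend on where the interval is cut; the two sides are the extreme
  cuts.\<close>

lemma sol_palindrome:
  assumes "sol e x f" "sol e x h" "\<And>k. 0 < k \<Longrightarrow> k < N \<Longrightarrow> e (N - k) = e k" "N > 0"
  shows "f 1 * h N + f 0 * h (N - 1) = h 1 * f N + h 0 * f (N - 1)"
proof -
  have "f (Suc j) * h (N - j) + f j * h (N - Suc j) = f 1 * h N + f 0 * h (N - 1)" if "j < N" for j
    using that
  proof (induction j)
    case (Suc j)
    have e: "e (N - Suc j) = e (Suc j)" using Suc.prems by (intro assms(3)) auto
    obtain l where l: "N - j = Suc (Suc l)" "N - Suc j = Suc l" "N - Suc (Suc j) = l"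
      using Suc.prems by (metis Suc_diff_Suc Suc_lessD)
    have "f (Suc (Suc j)) * h (N - Suc j) + f (Suc j) * h (N - Suc (Suc j))
      = f (Suc j) * h (N - j) + f j * h (N - Suc j)"
      unfolding l solD[OF assms(1), of j] solD[OF assms(2), of l] using e l by (simp add: algebra_simps)
    thus ?case using Suc.IH Suc.prems by simp
  qed simp
  from this[of "N - 1"] show ?thesis using assms(4) by (simp add: mult.commute)
qed

text \<open>As for palindromes, but moving the cut by one place now changes the sign. The
  \<open>N - 1\<close> moves are even in number.\<close>

lemma sol_antipalindrome:
  assumes "sol e x f" "sol e x h" "\<And>k. 0 < k \<Longrightarrow> k < N \<Longrightarrow> e (N - k) = - e k" "odd N"
  shows "f 1 * h N - f 0 * h (N - 1) = h 1 * f N - h 0 * f (N - 1)"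
proof -
  have N: "N > 0" using assms(4) by (cases N) auto
  have "f (Suc j) * h (N - j) - f j * h (N - Suc j) = (-1) ^ j * (f 1 * h N - f 0 * h (N - 1))" if "j < N" for j
    using that
  proof (induction j)
    case (Suc j)
    have e: "e (N - Suc j) = - e (Suc j)" using Suc.prems by (intro assms(3)) auto
    obtain l where l: "N - j = Suc (Suc l)" "N - Suc j = Suc l" "N - Suc (Suc j) = l"
      using Suc.prems by (metis Suc_diff_Suc Suc_lessD)
    have "f (Suc (Suc j)) * h (N - Suc j) - f (Suc j) * h (N - Suc (Suc j))
      = - (f (Suc j) * h (N - j) - f j * h (N - Suc j))"
      unfolding l solD[OF assms(1), of j] solD[OF assms(2), of l] using e l by (simp add: algebra_simps)
    thus ?case using Suc.IH Suc.prems by simp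
  qed simp
  from this[of "N - 1"] show ?thesis using N assms(4) by (simp add: mult.commute)
qed

text \<open>The derivative of a solution in the parameter \<open>x\<close>, abstractly: \<open>h\<close> solves the
  differentiated recurrence.\<close>

lemma sol_deriv_sum:
  assumes "sol e x f"
    "\<And>k. h (Suc (Suc k)) = of_int (e (Suc k)) * (f (Suc k) + x * h (Suc k)) + h k"
    "h 0 = 0" "h 1 = 0"
  shows "(\<Sum>k<N. (-1) ^ k * of_int (e (Suc k)) * f (Suc k) ^ 2)
    = (-1) ^ N * (h N * f (Suc N) - h (Suc N) * f N)"
proof (induction N)
  case (Suc N)
  have "h (Suc (Suc N)) * f (Suc N) - h (Suc N) * f (Suc (Suc N)) =
    of_int (e (Suc N)) * f (Suc N) ^ 2 + (h N * f (Suc N) - h (Suc N) * f N)"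
    unfolding solD[OF assms(1), of N] assms(2)[of N] by (simp add: algebra_simps power2_eq_square)
  hence "of_int (e (Suc N)) * f (Suc N) ^ 2 =
    h (Suc (Suc N)) * f (Suc N) - h (Suc N) * f (Suc (Suc N)) - (h N * f (Suc N) - h (Suc N) * f N)"
    by simp
  thus ?case using Suc by (simp only: sum.lessThan_Suc mult.assoc) (simp add: right_diff_distrib)
qed (use assms in simp)

lemma fibo_shift:
  assumes "\<And>k. h (Suc (Suc k)) = t * h (Suc k) + h k"
  shows "h (Suc n) = fibo t (Suc n) * h 1 + fibo t n * h 0"
proof -
  have "h (Suc n) = fibo t (Suc n) * h 1 + fibo t n * h 0 \<and>
    h (Suc (Suc n)) = fibo t (Suc (Suc n)) * h 1 + fibo t (Suc n) * h 0"
  proof (induction n)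
    case 0 thus ?case using assms[of 0] by simp
  next
    case (Suc n)
    thus ?case using assms[of "Suc n"] by (simp add: algebra_simps)
  qed
  thus ?thesis ..
qed

text \<open>These are the symmetries of \<open>(-1)^floor(k b / d)\<close>: invariance under the
  period, sign reversal under reflection in one period, invariance under reflection in
  \<open>c + n d\<close> for every \<open>n\<close>. The last one carries the relation
  \<open>a d - b c = 1\<close>.\<close>

locale pattern =
  fixes e :: "nat \<Rightarrow> int" and c d :: nat
  assumes odd_d: "odd d" and even_c: "even c" and c_pos: "c > 0"
    and unit: "\<And>k. e k = 1 \<or> e k = -1"
    and periodic: "\<And>k. e (k + d) = e k"
    and anti: "\<And>k. 0 < k \<Longrightarrow> k < d \<Longrightarrow> e (d - k) = - e k"
    and pal: "\<And>k n. 0 < k \<Longrightarrow> k < c + n * d \<Longrightarrow> e (c + n * d - k) = e k"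
    and e_0: "e 0 = 1"
begin

lemma d_pos: "d > 0" using odd_d by (cases d) auto

lemma e_d: "e d = 1" using periodic[of 0] e_0 by simp

lemma e_c: "e c = 1" using pal[of d 1] c_pos d_pos e_d by simp

lemma e_c_add: "0 < k \<Longrightarrow> k < d \<Longrightarrow> e (c + k) = - e k"
  using pal[of "d - k" 1] anti[of k] c_pos by simp

lemma sol_shift:
  assumes "sol e x f"
  shows "sol e x (\<lambda>k. f (k + d))"
  unfolding sol_def
proof
  fix k
  show "f (Suc (Suc k) + d) = of_int (e (Suc k)) * x * f (Suc k + d) + f (k + d)"
    using solD[OF assms, of "k + d"] periodic[of "Suc k"] by simp
qed

lemma antip:
  assumes "sol e x f" "sol e x h"
  shows "f 1 * h d - f 0 * h (d - 1) = h 1 * f d - h 0 * f (d - 1)"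
  by (rule sol_antipalindrome[OF assms]) (use anti odd_d in auto)

lemma palin:
  assumes "sol e x f" "sol e x h"
  shows "f 1 * h (c + n * d) + f 0 * h (c + n * d - 1) = h 1 * f (c + n * d) + h 0 * f (c + n * d - 1)"
  by (rule sol_palindrome[OF assms]) (use pal c_pos in auto)

text \<open>Pairing with \<open>fund\<close> and \<open>cofund\<close> under the sign-reversing
  reflection describes the shift by \<open>d\<close> through three numbers. Its matrix on
  \<open>(f 0, f 1)\<close> has trace \<open>x * fund e x d\<close>, since the two contributions of
  \<open>fund e x (d - 1)\<close> cancel.\<close>

lemma sol_at_d:
  assumes "sol e x f"
  shows "f d = fund e x d * f 1 - fund e x (d - 1) * f 0"
    "f (d - 1) = fund e x (d - 1) * f 1 + cofund e x (d - 1) * f 0"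
    "f (Suc d) = (x * fund e x d + fund e x (d - 1)) * f 1 + (cofund e x (d - 1) - x * fund e x (d - 1)) * f 0"
proof -
  note a = antip
  have 1: "f d = fund e x d * f 1 - fund e x (d - 1) * f 0" if "sol e x f" for f
    using a[OF sol_fund[of e x] that] by (simp add: mult.commute)
  thus "f d = fund e x d * f 1 - fund e x (d - 1) * f 0" using assms .
  show 2: "f (d - 1) = fund e x (d - 1) * f 1 + cofund e x (d - 1) * f 0"
    using a[OF sol_cofund[of e x] assms] 1[OF sol_cofund] by (simp add: algebra_simps)
  have "f (Suc d) = of_int (e d) * x * f d + f (d - 1)"
    using solD[OF assms, of "d - 1"] d_pos by simp
  thus "f (Suc d) = (x * fund e x d + fund e x (d - 1)) * f 1 + (cofund e x (d - 1) - x * fund e x (d - 1)) * f 0"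
    unfolding 1[OF assms] 2 by (simp add: e_d algebra_simps)
qed

text \<open>The shift by \<open>d\<close> is a product of an odd number of matrices of determinant
  \<open>-1\<close>.\<close>

lemma det_half: "fund e x d * cofund e x (d - 1) + fund e x (d - 1) ^ 2 = 1"
proof -
  have "even (d - 1)" using odd_d by simp
  thus ?thesis
    using sol_wronskian[OF sol_fund[of e x] sol_cofund[of e x], of "d - 1"] d_pos
      sol_at_d(1)[OF sol_cofund[of e x]]
    by (simp add: algebra_simps power2_eq_square)
qed

text \<open>Cayley-Hamilton for the shift by \<open>d\<close>, which has trace
  \<open>x * fund e x d\<close> and determinant \<open>-1\<close>. Both sides are solutions, so two
  initial values suffice.\<close>

lemma monodromy:
  assumes "sol e x f"
  shows "f (k + 2 * d) = x * fund e x d * f (k + d) + f k"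
proof -
  let ?u = "fund e x d" and ?v = "fund e x (d - 1)" and ?w = "cofund e x (d - 1)"
  have s: "sol e x (\<lambda>k. f (k + d))" "sol e x (\<lambda>k. f (k + d + d))"
    by (intro sol_shift assms)+
  have w: "?u * ?w = 1 - ?v * ?v" using det_half[of x] by (simp add: algebra_simps power2_eq_square)
  have "(\<lambda>k. f (k + d + d)) k = (\<lambda>k. x * ?u * f (k + d) + 1 * f k) k"
  proof (rule sol_eqI[OF s(2) sol_lincomb[OF s(1) assms]])
    have "f (0 + d + d) = ?u * f (Suc d) - ?v * f d" using sol_at_d(1)[OF s(1)] by simp
    also have "\<dots> = x * ?u * f d + 1 * f 0"
      unfolding sol_at_d(1,3)[OF assms] using w by (simp add: algebra_simps) (metis (no_types) add_diff_eq diff_add_cancel distrib_left mult.assoc mult.commute mult.right_neutral add.commute)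
    finally show "f (0 + d + d) = x * ?u * f (0 + d) + 1 * f 0" by simp
    have "f (1 + d + d) = (x * ?u + ?v) * f (Suc d) + (?w - x * ?v) * f d" using sol_at_d(3)[OF s(1)] by simp
    also have "\<dots> = x * ?u * f (Suc d) + (?v * ?v + ?u * ?w) * f 1"
      unfolding sol_at_d(1,3)[OF assms] by (simp add: algebra_simps)
    finally show "f (1 + d + d) = x * ?u * f (1 + d) + 1 * f 1" unfolding w by simp
  qed
  thus ?thesis by (simp add: mult_2 add.assoc)
qed

lemma monodromy_fibo:
  assumes "sol e x f"
  shows "f (k + Suc n * d) = fibo (x * fund e x d) (Suc n) * f (k + d) + fibo (x * fund e x d) n * f k"
proof -
  have "f (k + Suc (Suc n) * d) = x * fund e x d * f (k + Suc n * d) + f (k + n * d)" for n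
    using monodromy[OF assms, of "k + n * d"] by (simp add: add_ac mult_2)
  from fibo_shift[of "\<lambda>n. f (k + n * d)", OF this] show ?thesis by simp
qed

context
  fixes x :: "'a::idom" and A B A2 B2 u v t :: 'a
  defines "B \<equiv> fund e x c" and "B2 \<equiv> fund e x (c - 1)"
    and "A \<equiv> fund e x (c + d)" and "A2 \<equiv> fund e x (c + d - 1)"
    and "u \<equiv> fund e x d" and "v \<equiv> fund e x (d - 1)" and "t \<equiv> x * u"
begin

lemma fund_Suc_d: "fund e x (Suc d) = t + v"
  using sol_at_d(3)[OF sol_fund[of e x]] by (simp add: t_def u_def v_def)

text \<open>\<open>A_eq\<close>, \<open>B_eq\<close> and \<open>A2_eq\<close> come from pairing a
  fundamental solution with the shift by \<open>d\<close> under reflection in \<open>c\<close> or in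
  \<open>c + d\<close>.\<close>

lemma A_eq: "A = (t + v) * B + u * B2"
  using palin[OF sol_fund[of e x] sol_shift[OF sol_fund[of e x]], of 0] c_pos fund_Suc_d
  by (simp add: A_def B_def B2_def u_def)

lemma B_eq: "B = u * A2 + v * A"
proof -
  have "fund e x (c + d + d) = (t + v) * A + u * A2"
    using palin[OF sol_fund[of e x] sol_shift[OF sol_fund[of e x]], of 1] c_pos fund_Suc_d
    by (simp add: A_def A2_def u_def)
  moreover have "fund e x (c + d + d) = t * A + B"
    using monodromy[OF sol_fund[of e x], of c] by (simp add: A_def B_def t_def u_def mult_2 add.assoc)
  ultimately show ?thesis by (simp add: algebra_simps)
qed

lemma A_B2: "A * B2 - A2 * B = u"
proof -
  obtain k where k: "c = Suc k" using c_pos by (cases c) auto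
  have "odd k" using even_c k by simp
  thus ?thesis
    using sol_wronskian[OF sol_shift[OF sol_fund[of e x]] sol_fund[of e x], of k]
    by (simp add: A_def A2_def B_def B2_def u_def k)
qed

text \<open>Obtained by multiplying \<open>A_B2\<close> with \<open>u\<close> and eliminating
  \<open>A2\<close>, \<open>B2\<close>. The quadratic form on the left changes only its sign under
  \<open>(A, B) \<mapsto> (t A + B, A)\<close>, that is, when \<open>n\<close> grows by one.\<close>

lemma gram: "A ^ 2 - t * A * B - B ^ 2 = u ^ 2"
proof -
  have "u * u = A * (u * B2) - (u * A2) * B" unfolding A_B2[symmetric] by (simp add: algebra_simps)
  also have "u * B2 = A - (t + v) * B" using A_eq by simp
  also have "u * A2 = B - v * A" using B_eq by simp
  finally show ?thesis by (simp add: algebra_simps power2_eq_square)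
qed

lemma A2_eq: "A2 = (t + v) * B2 + u * cofund e x (c - 1)"
proof -
  have "cofund e x c = B2"
    using palin[OF sol_fund[of e x] sol_cofund[of e x], of 0] c_pos
    by (simp add: B2_def)
  thus ?thesis
    using palin[OF sol_shift[OF sol_fund[of e x]] sol_cofund[of e x], of 0] c_pos fund_Suc_d
    by (simp add: A2_def B2_def u_def)
qed

end

text \<open>Reflection identifies the last term of \<open>cofund\<close> with the last but one of
  \<open>fund\<close>, and the Wronskian gives the rest. At a root of \<open>P_(p-1)\<close> it says
  that \<open>P_(p-2)\<close> squares to \<open>-1\<close>.\<close>

lemma fund_square:
  assumes "odd n"
  shows "fund e x (c + n * d) * cofund e x (c + n * d - 1) - fund e x (c + n * d - 1) ^ 2 = 1"
proof -
  obtain k where k: "c + n * d = Suc k" using c_pos by (cases "c + n * d") auto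
  have "even k" using even_c odd_d assms k by (metis even_Suc even_add even_mult_iff)
  moreover have "cofund e x (c + n * d) = fund e x (c + n * d - 1)"
    using palin[OF sol_fund[of e x] sol_cofund[of e x], of n] k
    by simp
  ultimately show ?thesis
    using sol_wronskian[OF sol_fund[of e x] sol_cofund[of e x], of k] k
    by (simp add: power2_eq_square)
qed

end

section \<open>A dyadic place of the complex numbers\<close>

definition subring :: "complex set \<Rightarrow> bool" where
  "subring S \<longleftrightarrow> 1 \<in> S \<and> (\<forall>x\<in>S. \<forall>y\<in>S. x - y \<in> S \<and> x * y \<in> S)"

lemma subringD:
  assumes "subring S"
  shows "1 \<in> S" "0 \<in> S" "x \<in> S \<Longrightarrow> y \<in> S \<Longrightarrow> x - y \<in> S" "x \<in> S \<Longrightarrow> - x \<in> S"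
    "x \<in> S \<Longrightarrow> y \<in> S \<Longrightarrow> x + y \<in> S" "x \<in> S \<Longrightarrow> y \<in> S \<Longrightarrow> x * y \<in> S"
    "x \<in> S \<Longrightarrow> x ^ n \<in> S" "of_int k \<in> S" "numeral w \<in> S"
proof -
  show a: "1 \<in> S" and b: "x \<in> S \<Longrightarrow> y \<in> S \<Longrightarrow> x - y \<in> S" and c: "x \<in> S \<Longrightarrow> y \<in> S \<Longrightarrow> x * y \<in> S" for x y
    using assms by (auto simp: subring_def)
  show z: "0 \<in> S" using b[OF a a] by simp
  show m: "x \<in> S \<Longrightarrow> - x \<in> S" for x using b[OF z, of x] by simp
  show p: "x \<in> S \<Longrightarrow> y \<in> S \<Longrightarrow> x + y \<in> S" for x y using b[OF _ m, of x y] by simp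
  show "x \<in> S \<Longrightarrow> x ^ n \<in> S" by (induction n) (auto intro: a c)
  have n: "of_nat j \<in> S" for j by (induction j) (auto intro: z a p)
  show "of_int k \<in> S" by (cases k) (auto intro!: n m simp del: of_nat_Suc simp: of_nat_Suc[symmetric])
  show "numeral w \<in> S" using n[of "numeral w"] by simp
qed

lemma subring_sum: "subring S \<Longrightarrow> (\<And>i. i \<in> I \<Longrightarrow> f i \<in> S) \<Longrightarrow> sum f I \<in> S"
  by (induction I rule: infinite_finite_induct) (auto intro: subringD)

lemma subring_prod: "subring S \<Longrightarrow> (\<And>i. i \<in> I \<Longrightarrow> f i \<in> S) \<Longrightarrow> prod f I \<in> S"
  by (induction I rule: infinite_finite_induct) (auto intro: subringD)

lemma subring_Ints: "subring \<int>" by (auto simp: subring_def)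

lemma subring_Union_chain:
  assumes "C \<noteq> {}" "\<And>S. S \<in> C \<Longrightarrow> subring S" "\<And>S T. S \<in> C \<Longrightarrow> T \<in> C \<Longrightarrow> S \<subseteq> T \<or> T \<subseteq> S"
  shows "subring (\<Union>C)"
  unfolding subring_def
proof (intro conjI ballI)
  show "1 \<in> \<Union>C" using assms(1,2) subringD(1) by blast
next
  fix x y assume "x \<in> \<Union>C" "y \<in> \<Union>C"
  then obtain S T where "S \<in> C" "x \<in> S" "T \<in> C" "y \<in> T" by blast
  then obtain S where "S \<in> C" "x \<in> S" "y \<in> S" using assms(3)[of S T] by blast
  thus "x - y \<in> \<Union>C" "x * y \<in> \<Union>C" using assms(2) subringD(3,6) by blast+
qed

text \<open>Chevalley's construction of a place over \<open>2\<close>: maximality turns out to force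
  a valuation ring in which \<open>2\<close> is not a unit.\<close>

lemma maximal_subring:
  obtains A where "subring A" "1 / 2 \<notin> A" "\<And>B. subring B \<Longrightarrow> A \<subseteq> B \<Longrightarrow> 1 / 2 \<notin> B \<Longrightarrow> B = A"
proof -
  let ?F = "{A. subring A \<and> (1 / 2 :: complex) \<notin> A}"
  have half: "(1 / 2 :: complex) \<notin> \<int>"
  proof
    assume "(1 / 2 :: complex) \<in> \<int>"
    then obtain k :: int where "(1 / 2 :: complex) = of_int k" by (auto elim: Ints_cases)
    hence "of_int (2 * k) = (of_int 1 :: complex)" by (simp add: field_simps)
    hence "2 * k = 1" by (simp only: of_int_eq_iff)
    thus False by presburger
  qed
  have "\<exists>M\<in>?F. \<forall>X\<in>?F. M \<subseteq> X \<longrightarrow> X = M"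
  proof (rule subset_Zorn_nonempty)
    show "?F \<noteq> {}" using subring_Ints half by blast
    fix C assume C: "C \<noteq> {}" "subset.chain ?F C"
    have "subring (\<Union>C)"
      by (rule subring_Union_chain[OF C(1)]) (use C(2) in \<open>auto simp: subset_chain_def\<close>)
    thus "\<Union>C \<in> ?F" using C(2) by (auto simp: subset_chain_def)
  qed
  thus thesis using that by blast
qed

definition adjoin :: "complex set \<Rightarrow> complex \<Rightarrow> complex set" where
  "adjoin A x = {\<Sum>i\<le>n. a i * x ^ i | (a :: nat \<Rightarrow> complex) n. \<forall>i. a i \<in> A}"

lemma adjoin_eq: "adjoin A x = {poly p x | p. \<forall>i. coeff p i \<in> A}" if "subring A"
proof safe
  fix y assume "y \<in> adjoin A x"
  then obtain a n where a: "y = (\<Sum>i\<le>n. a i * x ^ i)" "\<forall>i. a i \<in> A" by (auto simp: adjoin_def)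
  have "y = poly (\<Sum>i\<le>n. monom (a i) i) x" by (simp add: a poly_sum poly_monom)
  moreover have "coeff (\<Sum>i\<le>n. monom (a i) i) j \<in> A" for j
    using a(2) subringD(2)[OF that] by (auto simp: coeff_sum intro!: subring_sum[OF that])
  ultimately show "\<exists>p. y = poly p x \<and> (\<forall>i. coeff p i \<in> A)" by blast
next
  fix p assume "\<forall>i. coeff p i \<in> A"
  thus "poly p x \<in> adjoin A x" by (auto simp: adjoin_def poly_altdef)
qed

lemma adjoin:
  assumes A: "subring A"
  shows "subring (adjoin A x)" "A \<subseteq> adjoin A x" "x \<in> adjoin A x"
proof -
  note * = adjoin_eq[OF A] and S = subringD[OF A]
  have one: "\<forall>i. coeff (1 :: complex poly) i \<in> A" using S by (auto simp: coeff_1)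
  show "subring (adjoin A x)"
    unfolding subring_def
  proof (intro conjI ballI)
    show "1 \<in> adjoin A x" unfolding * using one by (intro CollectI exI[of _ 1]) simp
    fix y z assume "y \<in> adjoin A x" "z \<in> adjoin A x"
    then obtain p q where pq: "y = poly p x" "z = poly q x" "\<forall>i. coeff p i \<in> A" "\<forall>i. coeff q i \<in> A"
      unfolding * by blast
    have "\<forall>i. coeff (p - q) i \<in> A" using pq S by simp
    thus "y - z \<in> adjoin A x" unfolding * pq(1,2) poly_diff[symmetric] by blast
    have "\<forall>i. coeff (p * q) i \<in> A" using pq S by (auto simp: coeff_mult intro!: subring_sum[OF A])
    thus "y * z \<in> adjoin A x" unfolding * pq(1,2) poly_mult[symmetric] by blast
  qed
  show "A \<subseteq> adjoin A x"
  proof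
    fix a assume "a \<in> A"
    hence "\<forall>i. coeff [:a:] i \<in> A" using S by (auto simp: coeff_pCons split: nat.split)
    thus "a \<in> adjoin A x" unfolding * by (intro CollectI exI[of _ "[:a:]"]) auto
  qed
  have "\<forall>i. coeff [:0, 1:] i \<in> A" using S by (auto simp: coeff_pCons split: nat.split)
  thus "x \<in> adjoin A x" unfolding * by (intro CollectI exI[of _ "[:0, 1:]"]) auto
qed

locale dyadic_place =
  fixes A :: "complex set"
  assumes A: "subring A" and half: "1 / 2 \<notin> A"
    and max: "\<And>B. subring B \<Longrightarrow> A \<subseteq> B \<Longrightarrow> 1 / 2 \<notin> B \<Longrightarrow> B = A"
begin

lemmas A_intros = subringD[OF A] subring_sum[OF A] subring_prod[OF A]

text \<open>If the inverse of \<open>s = 1 - 2 a\<close> were missing, adjoining it would produce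
  \<open>1/2\<close>. Clearing denominators then puts some \<open>s^n\<close> into
  \<open>2 A\<close>, although \<open>s^n\<close> is congruent to \<open>1\<close> modulo
  \<open>2 A\<close>; so \<open>1/2\<close> would lie in \<open>A\<close> itself.\<close>

lemma one_minus_two_unit:
  assumes "a \<in> A" shows "1 - 2 * a \<noteq> 0" "1 / (1 - 2 * a) \<in> A"
proof -
  let ?s = "1 - 2 * a"
  show nz: "?s \<noteq> 0"
  proof
    assume "?s = 0"
    hence "a = 1 / 2" by (simp add: field_simps)
    thus False using assms half by (simp only: simp_thms)
  qed
  show "1 / ?s \<in> A"
  proof (rule ccontr)
    assume n: "1 / ?s \<notin> A"
    have "1 / 2 \<in> adjoin A (1 / ?s)" using max[OF adjoin(1,2)[OF A, of "1 / ?s"]] adjoin(3)[OF A, of "1 / ?s"] n by auto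
    then obtain p where p: "1 / 2 = poly p (1 / ?s)" "\<forall>i. coeff p i \<in> A" unfolding adjoin_eq[OF A] by blast
    let ?n = "degree p"
    define b where "b = (\<Sum>i\<le>?n. coeff p i * ?s ^ (?n - i))"
    have b: "b \<in> A" unfolding b_def using p assms by (intro A_intros) auto
    have "?s ^ ?n = 2 * (?s ^ ?n * poly p (1 / ?s))" unfolding p(1)[symmetric] by simp
    also have "?s ^ ?n * poly p (1 / ?s) = b"
      unfolding poly_altdef b_def sum_distrib_left
      by (intro sum.cong) (use nz in \<open>auto simp: power_diff power_one_over field_simps\<close>)
    finally have *: "?s ^ ?n = 2 * b" .
    have "\<exists>r\<in>A. ?s ^ k = 1 - 2 * r" for k
    proof (induction k)
      case 0 thus ?case using A_intros(2) by (intro bexI[of _ 0]) auto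
    next
      case (Suc k)
      then obtain r where r: "r \<in> A" "?s ^ k = 1 - 2 * r" by blast
      have "?s ^ Suc k = 1 - 2 * (a + r - 2 * a * r)" unfolding power_Suc r(2) by (simp add: algebra_simps)
      moreover have "a + r - 2 * a * r \<in> A" using r assms by (intro A_intros) auto
      ultimately show ?case by blast
    qed
    then obtain r where r: "r \<in> A" "?s ^ ?n = 1 - 2 * r" by blast
    have "1 / 2 = b + r" using * r(2) by (simp add: field_simps)
    thus False using b r half A_intros(5) by metis
  qed
qed

text \<open>A certificate that \<open>2\<close> becomes invertible in \<open>A[x]\<close>; the
  degree bound is what the descent acts on.\<close>

definition rel :: "complex \<Rightarrow> nat \<Rightarrow> bool" where
  "rel x n \<longleftrightarrow> (\<exists>a. (\<forall>i. a i \<in> A) \<and> 1 = (\<Sum>i\<le>n. 2 * a i * x ^ i))"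

lemma rel_normalize:
  assumes "rel x n"
  obtains a where "\<And>i. a i \<in> A" "1 = (\<Sum>i\<in>{1..n}. 2 * a i * x ^ i)"
proof -
  from assms obtain a where a: "\<And>i. a i \<in> A" "1 = (\<Sum>i\<le>n. 2 * a i * x ^ i)" unfolding rel_def by blast
  let ?s = "1 - 2 * a 0"
  have s: "?s \<noteq> 0" "1 / ?s \<in> A" using one_minus_two_unit[OF a(1)[of 0]] .
  have "(\<Sum>i\<le>n. 2 * a i * x ^ i) = 2 * a 0 + (\<Sum>i\<in>{1..n}. 2 * a i * x ^ i)"
    by (simp add: sum.atMost_shift sum.atLeast1_atMost_eq lessThan_atLeast0)
  hence e: "?s = (\<Sum>i\<in>{1..n}. 2 * a i * x ^ i)" using a(2) by (simp add: algebra_simps)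
  have "(\<Sum>i\<in>{1..n}. 2 * (a i * (1 / ?s)) * x ^ i) = (\<Sum>i\<in>{1..n}. 2 * a i * x ^ i) / ?s"
    by (simp add: sum_divide_distrib algebra_simps)
  also have "\<dots> = 1" using e s(1) by (metis divide_self)
  finally show thesis using that[of "\<lambda>i. a i * (1 / ?s)"] a(1) s(2) A_intros(6) by metis
qed

lemma rel_ex:
  assumes "x \<notin> A" shows "\<exists>n. rel x n"
proof -
  have "1 / 2 \<in> adjoin A x" using max[OF adjoin(1,2)[OF A, of x]] adjoin(3)[OF A, of x] assms by auto
  then obtain a n where "1 / 2 = (\<Sum>i\<le>n. a i * x ^ i)" "\<forall>i. a i \<in> A" unfolding adjoin_def by blast
  hence "rel x n" unfolding rel_def
    by (intro exI[of _ a]) (simp add: mult.assoc flip: sum_distrib_left, metis nonzero_eq_divide_eq mult.commute zero_neq_numeral)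
  thus ?thesis ..
qed

text \<open>With constant terms removed, the relation for \<open>1/x\<close> multiplied by
  \<open>x^n\<close> expresses \<open>x^n\<close> through lower powers. Substituted into the
  relation for \<open>x\<close>, it lowers the degree.\<close>

lemma rel_reduce:
  assumes "rel x n" "rel (1 / x) m" "m \<le> n" "x \<noteq> 0"
  shows "n > 0 \<and> rel x (n - 1)"
proof -
  obtain a where a: "\<And>i. a i \<in> A" "1 = (\<Sum>i\<in>{1..n}. 2 * a i * x ^ i)" using rel_normalize[OF assms(1)] by blast
  obtain b where b: "\<And>i. b i \<in> A" "1 = (\<Sum>i\<in>{1..m}. 2 * b i * (1 / x) ^ i)" using rel_normalize[OF assms(2)] by blast
  have n: "n > 0" using a(2) by (cases n) auto
  have xn: "x ^ n = (\<Sum>i\<in>{1..m}. 2 * b i * x ^ (n - i))"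
  proof -
    have "x ^ n = (\<Sum>i\<in>{1..m}. 2 * b i * (1 / x) ^ i) * x ^ n" using b(2) by simp
    also have "\<dots> = (\<Sum>i\<in>{1..m}. 2 * b i * x ^ (n - i))"
      unfolding sum_distrib_right
      by (intro sum.cong) (use assms(3,4) in \<open>auto simp: power_diff power_one_over field_simps\<close>)
    finally show ?thesis .
  qed
  also have "\<dots> = (\<Sum>j\<in>{n-m..<n}. 2 * b (n - j) * x ^ j)"
    by (rule sum.reindex_bij_witness[of _ "\<lambda>j. n - j" "\<lambda>i. n - i"]) (use assms(3) in auto)
  also have "\<dots> = (\<Sum>j\<le>n-1. 2 * (if n - m \<le> j then b (n - j) else 0) * x ^ j)"
    by (intro sum.mono_neutral_cong_left) (use n in auto)
  finally have xn: "x ^ n = \<dots>" .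
  have "1 = (\<Sum>i\<in>{1..n-1}. 2 * a i * x ^ i) + 2 * a n * x ^ n"
    using a(2) n by (cases n) auto
  also have "(\<Sum>i\<in>{1..n-1}. 2 * a i * x ^ i) = (\<Sum>j\<le>n-1. 2 * (if j = 0 then 0 else a j) * x ^ j)"
    by (intro sum.mono_neutral_cong_left) auto
  also have "\<dots> + 2 * a n * x ^ n =
     (\<Sum>j\<le>n-1. 2 * ((if j = 0 then 0 else a j) + 2 * a n * (if n - m \<le> j then b (n - j) else 0)) * x ^ j)"
    unfolding xn sum_distrib_left sum.distrib[symmetric] by (intro sum.cong) (auto simp: algebra_simps)
  finally have "rel x (n - 1)" unfolding rel_def
    using a(1) b(1) by (intro exI[of _ "\<lambda>j. (if j = 0 then 0 else a j) + 2 * a n * (if n - m \<le> j then b (n - j) else 0)"])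
      (auto intro!: A_intros)
  thus ?thesis using n by blast
qed

text \<open>If both \<open>x\<close> and \<open>1/x\<close> were missing, both would have relations,
  and the larger of the two degrees could be lowered forever.\<close>

lemma valuation: "x \<in> A \<or> 1 / x \<in> A"
proof (rule ccontr)
  assume "\<not> ?thesis"
  hence x: "x \<notin> A" "1 / x \<notin> A" by auto
  have x0: "x \<noteq> 0" using x A_intros(2) by auto
  have "\<not> (rel y n \<and> rel (1 / y) m \<and> y \<noteq> 0)" for n m y
  proof (induction "n + m" arbitrary: n m y rule: less_induct)
    case less
    show ?case
    proof
      assume *: "rel y n \<and> rel (1 / y) m \<and> y \<noteq> 0"
      show False
      proof (cases "m \<le> n")
        case True
        thus False using rel_reduce[of y n m] less[of "n - 1" m y] * by auto
      next
        case False
        thus False using rel_reduce[of "1 / y" m n] less[of n "m - 1" y] * by auto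
      qed
    qed
  qed
  thus False using rel_ex[OF x(1)] rel_ex[OF x(2)] x0 by blast
qed

text \<open>The set of non-units, which is the maximal ideal because \<open>A\<close> is a valuation
  ring.\<close>

definition M :: "complex set" where
  "M = {x \<in> A. x = 0 \<or> 1 / x \<notin> A}"

lemma M_ideal: "x \<in> M \<Longrightarrow> y \<in> M \<Longrightarrow> x + y \<in> M" "x \<in> M \<Longrightarrow> a \<in> A \<Longrightarrow> a * x \<in> M"
  "0 \<in> M" "x \<in> M \<Longrightarrow> - x \<in> M" "M \<subseteq> A" "1 \<notin> M" "2 \<in> M"
proof -
  show mul: "a * x \<in> M" if "x \<in> M" "a \<in> A" for a x
  proof (cases "a * x = 0")
    case False
    have "1 / (a * x) \<notin> A"
    proof
      assume "1 / (a * x) \<in> A"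
      hence "a * (1 / (a * x)) \<in> A" using that A_intros(6) by blast
      moreover have "a * (1 / (a * x)) = 1 / x" using False by (simp add: field_simps)
      ultimately show False using that False by (auto simp: M_def)
    qed
    thus ?thesis using that A_intros(6) by (auto simp: M_def)
  qed (use A_intros(2) in \<open>auto simp: M_def\<close>)
  show "0 \<in> M" "M \<subseteq> A" "1 \<notin> M" using A_intros(1,2) by (auto simp: M_def)
  show "2 \<in> M" using A_intros(9) half by (auto simp: M_def)
  \<comment> \<open>Closure under addition rests on \<open>valuation\<close>: one of
    \<open>x/y\<close> and \<open>y/x\<close> lies in \<open>A\<close>, and the sum is a multiple of
    the other summand.\<close>
  have aux: "x + y \<in> M" if "x \<in> M" "y \<in> M" "x / y \<in> A" "y \<noteq> 0" for x y
    using mul[OF that(2), of "1 + x / y"] that A_intros(1,5) by (auto simp: distrib_right add.commute)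
  show "x + y \<in> M" if "x \<in> M" "y \<in> M" for x y
    using aux[OF that] aux[OF that(2,1)] valuation[of "x / y"] that
    by (cases "x = 0"; cases "y = 0") (auto simp: add.commute)
  show "- x \<in> M" if "x \<in> M" for x using mul[OF that, of "- 1"] A_intros(1,4) by auto
qed

lemma M_prime: "a \<in> A \<Longrightarrow> b \<in> A \<Longrightarrow> a * b \<in> M \<Longrightarrow> a \<in> M \<or> b \<in> M"
  using A_intros(6)[of "1 / a" "1 / b"] by (auto simp: M_def)

lemma M_minus: "x \<in> M \<Longrightarrow> y \<in> M \<Longrightarrow> x - y \<in> M"
  using M_ideal(1)[OF _ M_ideal(4), of x y] by simp

lemma M_sum: "(\<And>i. i \<in> I \<Longrightarrow> f i \<in> M) \<Longrightarrow> sum f I \<in> M"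
  by (induction I rule: infinite_finite_induct) (auto intro: M_ideal)

lemma M_power: "a \<in> A \<Longrightarrow> a ^ n \<in> M \<Longrightarrow> a \<in> M"
  by (induction n) (use M_ideal(6) M_prime A_intros(7) in auto)

text \<open>Valuation rings are integrally closed. If \<open>x\<close> is missing then
  \<open>1/x\<close> is present, and dividing the equation by \<open>x^(n-1)\<close> writes
  \<open>x\<close>, up to sign, as a polynomial in \<open>1/x\<close>.\<close>

lemma root_in_A:
  assumes "\<And>i. coeff p i \<in> A" "lead_coeff p = 1 \<or> lead_coeff p = -1" "poly p x = 0"
  shows "x \<in> A"
proof (rule ccontr)
  assume x: "x \<notin> A"
  hence y: "1 / x \<in> A" "x \<noteq> 0" using valuation A_intros(2) by auto
  define n where "n = degree p"
  have n: "n > 0"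
  proof (rule ccontr)
    assume "\<not> n > 0"
    then obtain a where "p = [:a:]" by (metis n_def neq0_conv degree_eq_zeroE)
    hence "poly p x = lead_coeff p" by simp
    thus False using assms by auto
  qed
  define q where "q = (\<Sum>i<n. coeff p i * (1 / x) ^ (n - 1 - i))"
  have q: "q \<in> A" unfolding q_def using assms(1) y by (intro A_intros) auto
  have "0 = (1 / x) ^ (n - 1) * poly p x" using assms by simp
  also have "poly p x = (\<Sum>i<n. coeff p i * x ^ i) + lead_coeff p * x ^ n"
    unfolding poly_altdef n_def[symmetric] lessThan_Suc_atMost[symmetric] by (simp add: n_def)
  also have "(1 / x) ^ (n - 1) * \<dots> = q + lead_coeff p * x"
  proof -
    have "(1 / x) ^ (n - 1) * x ^ n = x"
      using y n by (cases n) (auto simp: power_one_over field_simps)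
    moreover have "(1 / x) ^ (n - 1) * (coeff p i * x ^ i) = coeff p i * (1 / x) ^ (n - 1 - i)" if "i < n" for i
    proof -
      have "n - 1 = (n - 1 - i) + i" using that by simp
      hence "(1 / x) ^ (n - 1) = (1 / x) ^ (n - 1 - i) * (1 / x) ^ i" by (metis power_add)
      thus ?thesis using y by (simp add: power_one_over field_simps)
    qed
    ultimately show ?thesis unfolding q_def distrib_left sum_distrib_left
      by (intro arg_cong2[where f = "(+)"] sum.cong) auto
  qed
  finally have *: "q + lead_coeff p * x = 0" by simp
  have "x = - q \<or> x = q" using assms(2)
  proof
    assume "lead_coeff p = 1"
    thus ?thesis using * by (simp add: eq_neg_iff_add_eq_0 add.commute)
  next
    assume "lead_coeff p = -1"
    thus ?thesis using * by simp
  qed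
  thus False using q x A_intros(4) by auto
qed

end

lemma dyadic_place_exists: obtains A where "dyadic_place A"
  by (rule maximal_subring) (auto simp: dyadic_place_def)

section \<open>Even kernels\<close>

text \<open>Evenness removes the odd Taylor coefficients, so the series is one in
  \<open>z^2\<close>. In this way a square root of \<open>T^2 + 4\<close> can be used as an
  auxiliary variable without choosing a branch.\<close>

lemma holomorphic_even_factor:
  assumes "f holomorphic_on ball 0 1" "\<And>z. z \<in> ball 0 1 \<Longrightarrow> f (- z) = f z"
  obtains g where "g holomorphic_on ball 0 1" "\<And>z. z \<in> ball 0 1 \<Longrightarrow> f z = g (z ^ 2)"
proof -
  define a where "a n = (deriv ^^ n) f 0 / fact n" for n
  have s: "(\<lambda>n. a n * z ^ n) sums f z" if "z \<in> ball 0 1" for z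
    using holomorphic_power_series[OF assms(1) that] by (simp add: a_def)
  have even: "(\<lambda>n. a (2 * n) * (z ^ 2) ^ n) sums f z" if z: "z \<in> ball 0 1" for z
  proof -
    have "(\<lambda>n. (a n * z ^ n + a n * (- z) ^ n) / 2) sums ((f z + f (- z)) / 2)"
      using z by (intro sums_divide sums_add s) auto
    also have "(\<lambda>n. (a n * z ^ n + a n * (- z) ^ n) / 2) = (\<lambda>n. if even n then a n * z ^ n else 0)"
      by (auto simp: fun_eq_iff)
    also have "(f z + f (- z)) / 2 = f z" using assms(2)[OF z] by simp
    finally have "(\<lambda>n. if even n then a n * z ^ n else 0) sums f z" .
    moreover have "strict_mono (\<lambda>n::nat. 2 * n)" by (simp add: strict_mono_def)
    ultimately have "(\<lambda>n. if even (2 * n) then a (2 * n) * z ^ (2 * n) else 0) sums f z"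
      by (subst sums_mono_reindex[of "\<lambda>n. 2 * n"]) (auto elim!: evenE)
    thus ?thesis by (simp add: power_mult)
  qed
  define g where "g w = (\<Sum>n. a (2 * n) * w ^ n)" for w
  have g: "(\<lambda>n. a (2 * n) * (w - 0) ^ n) sums g w" if w: "w \<in> ball 0 1" for w
  proof -
    have "csqrt w \<in> ball 0 1" using w by simp
    from even[OF this] show ?thesis unfolding g_def by (simp add: summable_sums sums_iff)
  qed
  show thesis
  proof
    show "g holomorphic_on ball 0 1" by (rule power_series_holomorphic[OF g])
    show "f z = g (z ^ 2)" if "z \<in> ball 0 1" for z
      using even[OF that] unfolding g_def by (simp add: sums_iff)
  qed
qed

text \<open>The function is \<open>arcsin (sqrt w) / sqrt w\<close>. The positive real part selects
  the sign of the cosine, and the last property is the derivative of the identity for the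
  sine.\<close>

lemma arcsin_kernel:
  obtains asn where "asn holomorphic_on ball 0 1" "asn 0 = 1"
    "\<And>s. norm s < 1 \<Longrightarrow> sin (s * asn (s ^ 2)) = s"
    "\<And>s. norm s < 1 \<Longrightarrow> Re (cos (s * asn (s ^ 2))) > 0"
    "\<And>s. norm s < 1 \<Longrightarrow> (asn (s ^ 2) + 2 * s ^ 2 * deriv asn (s ^ 2)) * cos (s * asn (s ^ 2)) = 1"
proof -
  have re: "\<bar>Re z\<bar> < 1" if "z \<in> ball 0 1" for z :: complex
    using that abs_Re_le_cmod[of z] by simp
  have hol: "Arcsin holomorphic_on ball 0 1" using re by (intro holomorphic_on_Arcsin) auto
  have minus: "Arcsin (- z) = - Arcsin z" if "z \<in> ball 0 1" for z
    using Arcsin_bounds[OF re[OF that]] by (intro Arcsin_unique) (simp_all)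
  define f where "f z = (if z = 0 then deriv Arcsin 0 else Arcsin z / z)" for z
  have f_hol: "f holomorphic_on ball 0 1"
    by (rule pole_theorem_open_0[OF hol, of 0]) (auto simp: f_def)
  have f: "z * f z = Arcsin z" for z by (simp add: f_def)
  have "f (- z) = f z" if "z \<in> ball 0 1" for z using minus[OF that] by (simp add: f_def)
  then obtain g where g: "g holomorphic_on ball 0 1" "\<And>z. z \<in> ball 0 1 \<Longrightarrow> f z = g (z ^ 2)"
    using holomorphic_even_factor[OF f_hol] by blast
  have sg: "s * g (s ^ 2) = Arcsin s" if "norm s < 1" for s using f[of s] g(2)[of s] that by simp
  have ode: "(g (s ^ 2) + 2 * s ^ 2 * deriv g (s ^ 2)) * cos (s * g (s ^ 2)) = 1" if s: "norm s < 1" for s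
  proof -
    have s2: "s ^ 2 \<in> ball 0 1" using s by (simp add: norm_power power_less_one_iff)
    have g': "(g has_field_derivative deriv g (s ^ 2)) (at (s ^ 2))"
      by (rule holomorphic_derivI[OF g(1) _ s2]) auto
    have "((\<lambda>s. sin (s * g (s ^ 2))) has_field_derivative
        cos (s * g (s ^ 2)) * (g (s ^ 2) + s * (deriv g (s ^ 2) * (2 * s)))) (at s)"
      by (auto intro!: derivative_eq_intros DERIV_chain2[where f = g and g = "\<lambda>s. s ^ 2", OF g'] simp: algebra_simps)
    moreover have "((\<lambda>s. sin (s * g (s ^ 2))) has_field_derivative 1) (at s)"
    proof (rule has_field_derivative_transform_within_open)
      show "((\<lambda>s. s) has_field_derivative 1) (at s)" by (rule DERIV_ident)
      show "open (ball 0 1 :: complex set)" "s \<in> ball 0 1" using s by auto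
      show "z = sin (z * g (z ^ 2))" if "z \<in> ball 0 1" for z using sg[of z] that by simp
    qed
    ultimately have "cos (s * g (s ^ 2)) * (g (s ^ 2) + s * (deriv g (s ^ 2) * (2 * s))) = 1"
      by (rule DERIV_unique)
    thus ?thesis by (simp add: power2_eq_square algebra_simps)
  qed
  have "g 0 = 1" using ode[of 0] by simp
  have pos: "Re (cos (s * g (s ^ 2))) > 0" if s: "norm s < 1" for s
  proof -
    have "\<bar>Re (Arcsin s)\<bar> < pi / 2" using s by (intro Arcsin_bounds re) simp
    hence "cos (Re (Arcsin s)) > 0" by (intro cos_gt_zero_pi) auto
    thus ?thesis unfolding sg[OF s] Re_cos by (intro divide_pos_pos mult_pos_pos add_pos_pos) auto
  qed
  have sin: "sin (s * g (s ^ 2)) = s" if "norm s < 1" for s using sg[OF that] by simp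
  show thesis by (rule that[of g]) fact+
qed

text \<open>The zeros of \<open>sin (sqrt w) / sqrt w\<close> as a function of
  \<open>w\<close>.\<close>

definition sa :: "nat \<Rightarrow> complex" where
  "sa k = of_real ((pi * real (Suc k)) ^ 2)"

lemma sa_bounds: "norm (sa k) \<ge> 9 * real (Suc k) ^ 2" "norm (sa k) \<ge> 9" "sa k \<noteq> 0"
proof -
  have "pi \<ge> 3" using pi_gt3 by simp
  hence "pi ^ 2 \<ge> 3 ^ 2" by (intro power_mono) auto
  hence "pi ^ 2 * real (Suc k) ^ 2 \<ge> 9 * real (Suc k) ^ 2" by (intro mult_right_mono) auto
  moreover have "norm (sa k) = pi ^ 2 * real (Suc k) ^ 2"
    unfolding sa_def norm_of_real by (simp only: power_mult_distrib abs_mult abs_power2)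
  ultimately show *: "norm (sa k) \<ge> 9 * real (Suc k) ^ 2" by simp
  have "real (Suc k) ^ 2 \<ge> 1 ^ 2" by (intro power_mono) auto
  hence "9 * real (Suc k) ^ 2 \<ge> 9" by (simp only: one_power2)
  with * show "norm (sa k) \<ge> 9" by (rule order.trans[rotated])
  thus "sa k \<noteq> 0" by auto
qed

lemma summable_sa: "summable (\<lambda>k. 1 / norm (sa k))"
proof (rule summable_comparison_test')
  show "summable (\<lambda>k. 1 / real (Suc k) ^ 2)"
    using inverse_power_summable[of 2, where 'a = real] by (subst summable_Suc_iff) (simp add: field_simps)
  fix k :: nat
  have "9 * real (Suc k) ^ 2 \<ge> real (Suc k) ^ 2" by simp
  hence "norm (sa k) \<ge> real (Suc k) ^ 2" using sa_bounds(1)[of k] by linarith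
  thus "norm (1 / norm (sa k)) \<le> 1 / real (Suc k) ^ 2" by (simp add: frac_le)
qed

text \<open>Euler's product for the sine, read in \<open>w = z^2\<close> and uniformly convergent on
  the unit disc, gives both the holomorphic kernel and the partial fractions of its logarithmic
  derivative. The unit disc contains none of the zeros.\<close>

lemma sinc_kernel:
  obtains sinc where "sinc holomorphic_on ball 0 1" "\<And>z. norm z < 1 \<Longrightarrow> sin z = z * sinc (z ^ 2)"
    "\<And>w. norm w < 1 \<Longrightarrow> sinc w \<noteq> 0"
    "\<And>w. norm w < 1 \<Longrightarrow> (\<lambda>k. 1 / (w - sa k)) sums (deriv sinc w / sinc w)"
proof -
  define f where "f k w = 1 - w / sa k" for k w
  have "uniformly_convergent_on (cball 0 1) (\<lambda>N x. \<Prod>n<N. f n x)"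
  proof (rule uniformly_convergent_on_prod')
    show "continuous_on (cball 0 1) (f n)" for n
      unfolding f_def by (intro continuous_intros) (use sa_bounds in auto)
    show "uniformly_convergent_on (cball 0 1) (\<lambda>N x. \<Sum>n<N. norm (f n x - 1))"
      by (rule Weierstrass_m_test'[OF _ summable_sa]) (auto simp: f_def norm_divide divide_right_mono)
  qed auto
  then obtain sinc where lim: "uniform_limit (cball 0 1) (\<lambda>N x. \<Prod>n<N. f n x) sinc sequentially"
    by (auto simp: uniformly_convergent_on_def)
  have lim': "uniform_limit (ball 0 1) (\<lambda>N x. \<Prod>n<N. f n x) sinc sequentially"
    by (rule uniform_limit_on_subset[OF lim]) auto
  have f_hol: "f k holomorphic_on X" for k X unfolding f_def by (intro holomorphic_intros) (use sa_bounds in auto)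
  have hol: "sinc holomorphic_on ball 0 1"
  proof (rule holomorphic_uniform_sequence)
    show "(\<lambda>x. \<Prod>n<N. f n x) holomorphic_on ball 0 1" for N by (intro holomorphic_intros f_hol)
    fix x :: complex assume "x \<in> ball 0 1"
    then obtain d where "d > 0" "cball x d \<subseteq> ball 0 1" using open_contains_cball open_ball by blast
    thus "\<exists>d>0. cball x d \<subseteq> ball 0 1 \<and> uniform_limit (cball x d) (\<lambda>N x. \<Prod>n<N. f n x) sinc sequentially"
      using uniform_limit_on_subset[OF lim'] by blast
  qed auto
  have sin: "sin z = z * sinc (z ^ 2)" if "norm z < 1" for z
  proof -
    have "norm (z ^ 2) < 1" using that by (simp add: norm_power power_less_one_iff)
    hence "(\<lambda>N. \<Prod>n<N. f n (z ^ 2)) \<longlonglongrightarrow> sinc (z ^ 2)"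
      by (intro tendsto_uniform_limitI[OF lim]) auto
    hence 1: "(\<lambda>N. z * (\<Prod>n<N. f n (z ^ 2))) \<longlonglongrightarrow> z * sinc (z ^ 2)" by (intro tendsto_intros)
    have "(\<lambda>n. of_real pi * (z / of_real pi) * (\<Prod>k=1..n. 1 - (z / of_real pi) ^ 2 / of_nat k ^ 2))
        \<longlonglongrightarrow> sin (of_real pi * (z / of_real pi))"
      by (rule sin_product_formula_complex)
    also have "(\<lambda>n. of_real pi * (z / of_real pi) * (\<Prod>k=1..n. 1 - (z / of_real pi) ^ 2 / of_nat k ^ 2)) =
        (\<lambda>N. z * (\<Prod>n<N. f n (z ^ 2)))"
    proof
      fix N
      have "(\<Prod>k=1..N. 1 - (z / of_real pi) ^ 2 / of_nat k ^ 2) = (\<Prod>n<N. f n (z ^ 2))"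
        by (rule prod.reindex_bij_witness[of _ Suc "\<lambda>k. k - 1"])
          (auto simp: f_def sa_def power_divide power_mult_distrib simp del: of_nat_Suc)
      thus "of_real pi * (z / of_real pi) * (\<Prod>k=1..N. 1 - (z / of_real pi) ^ 2 / of_nat k ^ 2) = z * (\<Prod>n<N. f n (z ^ 2))"
        by simp
    qed
    also have "sin (of_real pi * (z / of_real pi)) = sin z" by simp
    finally show ?thesis using 1 by (rule LIMSEQ_unique)
  qed
  have nz: "sinc w \<noteq> 0" if w: "norm w < 1" for w
  proof (cases "w = 0")
    case True
    have "(\<lambda>N. \<Prod>n<N. f n 0) \<longlonglongrightarrow> sinc 0" by (intro tendsto_uniform_limitI[OF lim]) auto
    hence "sinc 0 = 1" by (simp add: f_def LIMSEQ_const_iff)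
    thus ?thesis using True by simp
  next
    case False
    define z where "z = csqrt w"
    have z: "z ^ 2 = w" "norm z < 1" "z \<noteq> 0" using w False by (auto simp: z_def)
    have "sin z \<noteq> 0"
    proof
      assume "sin z = 0"
      then obtain k :: int where k: "z = of_int k * pi" by (auto simp: sin_eq_0)
      hence "k \<noteq> 0" using z by auto
      hence "\<bar>real_of_int k\<bar> \<ge> 1" by linarith
      hence "\<bar>real_of_int k\<bar> * pi \<ge> 1 * 3" using pi_gt3 by (intro mult_mono) auto
      thus False using z(2) by (simp add: k norm_mult)
    qed
    thus ?thesis using sin[OF z(2)] z by auto
  qed
  have "(\<lambda>k. 1 / (w - sa k)) sums (deriv sinc w / sinc w)" if w: "norm w < 1" for w
  proof -
    have "(\<lambda>k. deriv (f k) w / f k w) sums (deriv sinc w / sinc w)"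
      by (rule logderiv_prodinf_complex_uniform_limit[OF lim']) (use w nz f_hol in auto)
    also have "(\<lambda>k. deriv (f k) w / f k w) = (\<lambda>k. 1 / (w - sa k))"
    proof
      fix k
      have "(f k has_field_derivative (- 1 / sa k)) (at w)"
        unfolding f_def by (auto intro!: derivative_eq_intros simp: sa_bounds)
      moreover have "w \<noteq> sa k" using w sa_bounds(2)[of k] by auto
      ultimately show "deriv (f k) w / f k w = 1 / (w - sa k)"
        using sa_bounds(3)[of k] by (simp add: DERIV_imp_deriv f_def field_simps)
    qed
    finally show ?thesis .
  qed
  thus thesis using that[of sinc] hol sin nz by blast
qed

text \<open>Each \<open>1 / (w - sa k)\<close> is a geometric sum of \<open>m\<close> terms plus a
  remainder divisible by \<open>w^m\<close>. Summation over \<open>k\<close> turns the coefficient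
  of index \<open>m - 1\<close> into minus the sum of \<open>1 / (sa k)^m\<close>, which is where
  the zeta value arises.\<close>

lemma logderiv_sinc_expansion:
  assumes sums: "\<And>w. norm w < 1 \<Longrightarrow> (\<lambda>k. 1 / (w - sa k)) sums L w" and m: "m > 0"
  obtains a r where "r holomorphic_on ball 0 1"
    "\<And>w. norm w < 1 \<Longrightarrow> L w = (\<Sum>k<m. a k * w ^ k) + w ^ m * r w"
    "a (m - 1) = - of_real (zeta_nat (2 * m)) / of_real pi ^ (2 * m)"
proof -
  have bound: "norm (1 / (sa k ^ j * (w - sa k))) \<le> 2 * (1 / norm (sa k))" if "norm w < 1" for w k j
  proof -
    have "norm (sa k) \<ge> 1" using sa_bounds(2)[of k] by simp
    hence "1 \<le> norm (sa k ^ j)" by (simp add: norm_power one_le_power)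
    moreover have "norm (sa k) / 2 \<le> norm (w - sa k)"
      using norm_triangle_ineq2[of "sa k" w] that sa_bounds(2)[of k] by (simp add: norm_minus_commute)
    ultimately have "1 * (norm (sa k) / 2) \<le> norm (sa k ^ j) * norm (w - sa k)" by (intro mult_mono) auto
    hence "norm (sa k) / 2 \<le> norm (sa k ^ j * (w - sa k))" by (simp add: norm_mult)
    moreover have "norm (sa k) / 2 > 0" using sa_bounds(3)[of k] by simp
    ultimately have "1 / norm (sa k ^ j * (w - sa k)) \<le> 1 / (norm (sa k) / 2)" by (intro divide_left_mono mult_pos_pos) auto
    thus ?thesis by (simp add: norm_divide)
  qed
  define r where "r w = (\<Sum>k. 1 / (sa k ^ m * (w - sa k)))" for w
  have ul: "uniform_limit (ball 0 1) (\<lambda>N w. \<Sum>k<N. 1 / (sa k ^ m * (w - sa k))) r sequentially"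
    unfolding r_def
    by (rule Weierstrass_m_test[where M = "\<lambda>k. 2 * (1 / norm (sa k))"])
      (use bound summable_mult[OF summable_sa, of 2] in auto)
  have r_hol: "r holomorphic_on ball 0 1"
  proof (rule holomorphic_uniform_sequence)
    show "(\<lambda>w. \<Sum>k<N. 1 / (sa k ^ m * (w - sa k))) holomorphic_on ball 0 1" for N
    proof (intro holomorphic_intros)
      fix k w assume "w \<in> ball (0::complex) 1"
      hence "w \<noteq> sa k" using sa_bounds(2)[of k] by auto
      thus "sa k ^ m * (w - sa k) \<noteq> 0" using sa_bounds(3)[of k] by simp
    qed
    fix x :: complex assume "x \<in> ball 0 1"
    then obtain d where "d > 0" "cball x d \<subseteq> ball 0 1" using open_contains_cball open_ball by blast
    thus "\<exists>d>0. cball x d \<subseteq> ball 0 1 \<and> uniform_limit (cball x d) (\<lambda>N w. \<Sum>k<N. 1 / (sa k ^ m * (w - sa k))) r sequentially"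
      using uniform_limit_on_subset[OF ul] by blast
  qed auto
  define a where "a j = - (\<Sum>k. 1 / sa k ^ Suc j)" for j
  have a: "(\<lambda>k. - (1 / sa k ^ Suc j)) sums a j" for j
  proof -
    have "summable (\<lambda>k. 1 / sa k ^ Suc j)"
    proof (rule summable_comparison_test'[OF summable_sa])
      fix k
      have "norm (sa k) \<ge> 1" using sa_bounds(2)[of k] by simp
      hence "norm (sa k) ^ 1 \<le> norm (sa k) ^ Suc j" by (intro power_increasing) auto
      thus "norm (1 / sa k ^ Suc j) \<le> 1 / norm (sa k)"
        using sa_bounds(3)[of k] by (simp only: norm_divide norm_power norm_one power_one_right)
          (intro divide_left_mono mult_pos_pos, auto)
    qed
    thus ?thesis unfolding a_def by (intro sums_minus summable_sums)
  qed
  have rs: "(\<lambda>k. 1 / (sa k ^ m * (w - sa k))) sums r w" if "norm w < 1" for w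
    unfolding r_def
    by (rule summable_sums, rule summable_comparison_test'[OF summable_mult[OF summable_sa, of 2]])
      (use bound that in blast)
  have "L w = (\<Sum>j<m. a j * w ^ j) + w ^ m * r w" if w: "norm w < 1" for w
  proof -
    have "(\<lambda>k. (\<Sum>j<m. - (1 / sa k ^ Suc j) * w ^ j) + w ^ m * (1 / (sa k ^ m * (w - sa k))))
        sums ((\<Sum>j<m. a j * w ^ j) + w ^ m * r w)"
      by (intro sums_add sums_mult sums_sum sums_mult2 a rs w)
    also have "(\<lambda>k. (\<Sum>j<m. - (1 / sa k ^ Suc j) * w ^ j) + w ^ m * (1 / (sa k ^ m * (w - sa k)))) = (\<lambda>k. 1 / (w - sa k))"
    proof
      fix k
      have ne: "w - sa k \<noteq> 0" using w sa_bounds(2)[of k] by auto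
      show "(\<Sum>j<m. - (1 / sa k ^ Suc j) * w ^ j) + w ^ m * (1 / (sa k ^ m * (w - sa k))) = 1 / (w - sa k)"
      proof (induction m)
        case 0 thus ?case by simp
      next
        case (Suc m)
        have "- (1 / sa k ^ Suc m) * w ^ m + w ^ Suc m * (1 / (sa k ^ Suc m * (w - sa k))) =
          w ^ m * (1 / (sa k ^ m * (w - sa k)))"
          using ne sa_bounds(3)[of k] by (simp add: field_simps)
        thus ?case using Suc by (simp only: sum.lessThan_Suc add.assoc)
      qed
    qed
    finally show ?thesis using sums[OF w] by (rule sums_unique2[symmetric])
  qed
  moreover have "a (m - 1) = - of_real (zeta_nat (2 * m)) / of_real pi ^ (2 * m)"
  proof -
    have summ: "summable (\<lambda>n. 1 / real (Suc n) ^ (2 * m))"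
      using inverse_power_summable[of "2 * m", where 'a = real] m by (subst summable_Suc_iff) (simp add: field_simps)
    have "(\<lambda>n. of_real (1 / real (Suc n) ^ (2 * m)) / of_real pi ^ (2 * m)) sums (of_real (zeta_nat (2 * m)) / of_real pi ^ (2 * m) :: complex)"
      unfolding zeta_nat_def by (intro sums_divide sums_of_real summable_sums summ)
    also have "(\<lambda>n. of_real (1 / real (Suc n) ^ (2 * m)) / of_real pi ^ (2 * m) :: complex) = (\<lambda>k. 1 / sa k ^ Suc (m - 1))"
      using m by (simp add: fun_eq_iff sa_def power_mult_distrib del: of_nat_Suc flip: power_mult)
    finally show ?thesis using m unfolding a_def by (simp add: sums_iff)
  qed
  ultimately show thesis using that r_hol by blast
qed

section \<open>Sums of residues of rational functions\<close>

text \<open>The integral over a circle enclosing all poles does not depend on the radius, and the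
  degree gap makes \<open>x\<close> times the function tend to \<open>0\<close>, so the integral
  vanishes.\<close>

lemma sum_residues_rational:
  fixes f g :: "complex poly"
  assumes g: "g \<noteq> 0" and deg: "degree f + 2 \<le> degree g"
  shows "(\<Sum>z | poly g z = 0. residue (\<lambda>x. poly f x / poly g x) z) = 0"
proof -
  let ?h = "\<lambda>x. poly f x / poly g x" and ?Z = "{z. poly g z = 0}"
  have fin: "finite ?Z" using g by (rule poly_roots_finite)
  define I where "I = 2 * pi * \<i> * (\<Sum>z\<in>?Z. residue ?h z)"
  obtain R0 where R0: "\<And>z. z \<in> ?Z \<Longrightarrow> norm z < R0"
    using finite_imp_bounded[OF fin] unfolding bounded_pos_less by blast
  have int: "(?h has_contour_integral I) (circlepath 0 R)" if R: "R > 0" "R \<ge> R0" for R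
  proof -
    have hol: "?h holomorphic_on UNIV - ?Z" by (intro holomorphic_intros) auto
    have im: "path_image (circlepath 0 R) \<subseteq> UNIV - ?Z"
      using R0 R by (auto simp: path_image_circlepath dist_norm dest!: R0)
    have "contour_integral (circlepath 0 R) ?h =
        2 * pi * \<i> * (\<Sum>p\<in>?Z. winding_number (circlepath 0 R) p * residue ?h p)"
      by (rule Residue_theorem[OF _ _ fin hol]) (use im in auto)
    also have "(\<Sum>p\<in>?Z. winding_number (circlepath 0 R) p * residue ?h p) = (\<Sum>p\<in>?Z. residue ?h p)"
    proof (intro sum.cong refl)
      fix z assume "z \<in> ?Z"
      hence "norm (z - 0) < R" using R0[of z] R by simp
      thus "winding_number (circlepath 0 R) z * residue ?h z = residue ?h z"
        by (simp only: winding_number_circlepath mult_1)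
    qed
    finally have "contour_integral (circlepath 0 R) ?h = I" unfolding I_def .
    moreover have "?h contour_integrable_on circlepath 0 R"
      using holomorphic_on_subset[OF hol im]
      by (intro contour_integrable_continuous_circlepath holomorphic_on_imp_continuous_on)
        (use R in simp)
    ultimately show ?thesis by (metis has_contour_integral_integral)
  qed
  have "degree ([:0, 1:] * f) < degree g"
    using deg degree_mult_le[of "[:0, 1:]" f] by simp
  hence lim: "((\<lambda>z. poly ([:0, 1:] * f) z / poly g z) \<longlongrightarrow> 0) at_infinity"
    by (rule poly_divide_tendsto_0_at_infinity)
  have "norm I \<le> e" if "e > 0" for e
  proof -
    have "e / (2 * pi) > 0" using that by simp
    then obtain R1 where R1: "\<And>z. norm z \<ge> R1 \<Longrightarrow> norm (z * ?h z) < e / (2 * pi)"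
      using lim unfolding Lim_at_infinity by (force simp: dist_norm)
    define R where "R = max 1 (max R0 R1)"
    have R: "R > 0" "R \<ge> R0" "R \<ge> R1" by (auto simp: R_def)
    have "norm I \<le> e / (2 * pi * R) * (2 * pi * R)"
    proof (rule has_contour_integral_bound_circlepath[OF int[OF R(1,2)]])
      fix x :: complex assume x: "norm (x - 0) = R"
      hence "R * norm (?h x) < e / (2 * pi)" using R1[of x] R(3) by (simp only: norm_mult diff_zero)
      thus "norm (?h x) \<le> e / (2 * pi * R)" using R by (simp add: field_simps)
    qed (use R that in auto)
    thus ?thesis using R by simp
  qed
  hence "norm I \<le> 0" by (rule field_le_epsilon[of _ 0, simplified])
  thus ?thesis by (simp add: I_def)
qed

text \<open>The multiplicity produced by the logarithmic derivative is the weight of the root in the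
  trace, so repeated roots of \<open>P_(p-1)\<close> are covered.\<close>

lemma residue_log_derivative:
  fixes p :: "complex poly"
  assumes p: "p \<noteq> 0" and h: "h holomorphic_on S" "open S" "z \<in> S"
  shows "residue (\<lambda>x. h x * (poly (pderiv p) x / poly p x)) z = of_nat (order z p) * h z"
proof -
  obtain q where q: "p = [:-z, 1:] ^ order z p * q" "\<not> [:-z, 1:] dvd q"
    using order_decomp[OF p] by blast
  define k where "k = order z p"
  have qz: "poly q z \<noteq> 0" using q(2) by (simp add: poly_eq_0_iff_dvd)
  hence q0: "q \<noteq> 0" by auto
  define T where "T = S - {x. poly q x = 0}"
  have T: "open T" "z \<in> T" "T \<subseteq> S"
    using h qz poly_roots_finite[OF q0] unfolding T_def by (auto intro!: open_Diff finite_imp_closed)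
  have hT: "h holomorphic_on T" using h(1) T(3) by (rule holomorphic_on_subset)
  have qT: "(\<lambda>x. h x * (poly (pderiv q) x / poly q x)) holomorphic_on T"
    by (intro holomorphic_intros hT) (auto simp: T_def)
  have kT: "(\<lambda>x. of_nat k * h x) holomorphic_on T" by (intro holomorphic_intros hT)
  have "residue (\<lambda>x. h x * (poly (pderiv p) x / poly p x)) z =
      residue (\<lambda>x. of_nat k * h x / (x - z) + h x * (poly (pderiv q) x / poly q x)) z"
  proof (rule residue_cong[OF _ refl])
    have "\<forall>\<^sub>F x in at z. x \<in> T" using T by (intro eventually_at_in_open') auto
    moreover have "\<forall>\<^sub>F x in at z. x \<noteq> z" by (simp add: eventually_at_filter)
    ultimately show "\<forall>\<^sub>F x in at z. h x * (poly (pderiv p) x / poly p x) =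
        of_nat k * h x / (x - z) + h x * (poly (pderiv q) x / poly q x)"
    proof eventually_elim
      case (elim x)
      have ne: "x - z \<noteq> 0" "poly q x \<noteq> 0" using elim by (auto simp: T_def)
      have pd: "poly (pderiv p) x = of_nat k * (x - z) ^ (k - 1) * poly q x + (x - z) ^ k * poly (pderiv q) x"
        unfolding q(1)[folded k_def]
        by (cases k) (simp_all add: pderiv_mult pderiv_power_Suc pderiv_pCons del: mult_pCons_left power_Suc)
      have px: "poly p x = (x - z) ^ k * poly q x" unfolding q(1)[folded k_def] by simp
      have "h x * (poly (pderiv p) x / poly p x) = h x * (of_nat k / (x - z) + poly (pderiv q) x / poly q x)"
        unfolding pd px using ne by (cases k) (simp_all add: field_simps)
      thus ?case by (simp add: algebra_simps)
    qed
  qed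
  also have "\<dots> = residue (\<lambda>x. of_nat k * h x / (x - z)) z + residue (\<lambda>x. h x * (poly (pderiv q) x / poly q x)) z"
  proof (rule residue_add[OF T(1,2)])
    show "(\<lambda>x. of_nat k * h x / (x - z)) holomorphic_on T - {z}"
      by (intro holomorphic_intros holomorphic_on_subset[OF hT]) auto
  qed (rule holomorphic_on_subset[OF qT], auto)
  also have "\<dots> = of_nat k * h z"
    using residue_simple[OF T(1,2) kT] residue_holo[OF T(1,2) qT] by simp
  finally show ?thesis by (simp add: k_def)
qed

section \<open>Families of functions depending polynomially on a parameter\<close>

text \<open>Holomorphic coefficients allow the residue in \<open>x\<close> to be taken coefficient
  by coefficient. The function \<open>f\<close> records the coefficient at the nominal degree
  \<open>e\<close> and may vanish, so that terms of lower degree drop out of the leading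
  term.\<close>

definition pfam :: "complex set \<Rightarrow> nat \<Rightarrow> (nat \<Rightarrow> complex \<Rightarrow> complex) \<Rightarrow> (complex \<Rightarrow> complex) \<Rightarrow> bool" where
  "pfam S e F f \<longleftrightarrow> (\<exists>p :: complex \<Rightarrow> complex poly. (\<forall>j. (\<lambda>x. coeff (p x) j) holomorphic_on S) \<and>
     (\<forall>x\<in>S. degree (p x) \<le> e \<and> coeff (p x) e = f x \<and> (\<forall>n. F n x = poly (p x) (of_nat n))))"

lemma pfamI:
  assumes "\<And>j. (\<lambda>x. coeff (p x) j) holomorphic_on S"
    "\<And>x. x \<in> S \<Longrightarrow> degree (p x) \<le> e" "\<And>x. x \<in> S \<Longrightarrow> coeff (p x) e = f x"
    "\<And>x n. x \<in> S \<Longrightarrow> F n x = poly (p x) (of_nat n)"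
  shows "pfam S e F f"
  using assms unfolding pfam_def by blast

lemma pfamE:
  assumes "pfam S e F f"
  obtains p where "\<And>j. (\<lambda>x. coeff (p x) j) holomorphic_on S"
    "\<And>x. x \<in> S \<Longrightarrow> degree (p x) \<le> e" "\<And>x. x \<in> S \<Longrightarrow> coeff (p x) e = f x"
    "\<And>x n. x \<in> S \<Longrightarrow> F n x = poly (p x) (of_nat n)"
  using assms unfolding pfam_def by blast

lemma pfam_affine:
  assumes "h holomorphic_on S" "k holomorphic_on S"
  shows "pfam S 1 (\<lambda>n x. of_nat n * h x + k x) h"
proof (rule pfamI)
  show "(\<lambda>x. coeff [:k x, h x:] j) holomorphic_on S" for j
    using assms by (cases j; cases "j - 1") (auto simp: coeff_pCons split: nat.split)
qed auto

lemma pfam_const: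
  assumes "h holomorphic_on S"
  shows "pfam S 0 (\<lambda>n x. h x) h"
proof (rule pfamI)
  show "(\<lambda>x. coeff [:h x:] j) holomorphic_on S" for j
    using assms by (cases j) auto
qed auto

lemma pfam_add:
  assumes "pfam S e F f" "pfam S e G g"
  shows "pfam S e (\<lambda>n x. F n x + G n x) (\<lambda>x. f x + g x)"
proof -
  obtain p where p: "\<And>j. (\<lambda>x. coeff (p x) j) holomorphic_on S"
      "\<And>x. x \<in> S \<Longrightarrow> degree (p x) \<le> e" "\<And>x. x \<in> S \<Longrightarrow> coeff (p x) e = f x"
      "\<And>x n. x \<in> S \<Longrightarrow> F n x = poly (p x) (of_nat n)"
    using assms(1) by (rule pfamE) (rule that)
  obtain q where q: "\<And>j. (\<lambda>x. coeff (q x) j) holomorphic_on S"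
      "\<And>x. x \<in> S \<Longrightarrow> degree (q x) \<le> e" "\<And>x. x \<in> S \<Longrightarrow> coeff (q x) e = g x"
      "\<And>x n. x \<in> S \<Longrightarrow> G n x = poly (q x) (of_nat n)"
    using assms(2) by (rule pfamE) (rule that)
  show ?thesis
  proof (rule pfamI)
    show "(\<lambda>x. coeff (p x + q x) j) holomorphic_on S" for j
      using p(1) q(1) by (auto intro: holomorphic_intros)
  qed (use p q in \<open>auto intro: degree_add_le\<close>)
qed

lemma pfam_mult:
  assumes "pfam S e F f" "pfam S e' G g"
  shows "pfam S (e + e') (\<lambda>n x. F n x * G n x) (\<lambda>x. f x * g x)"
proof -
  obtain p where p: "\<And>j. (\<lambda>x. coeff (p x) j) holomorphic_on S"
      "\<And>x. x \<in> S \<Longrightarrow> degree (p x) \<le> e" "\<And>x. x \<in> S \<Longrightarrow> coeff (p x) e = f x"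
      "\<And>x n. x \<in> S \<Longrightarrow> F n x = poly (p x) (of_nat n)"
    using assms(1) by (rule pfamE) (rule that)
  obtain q where q: "\<And>j. (\<lambda>x. coeff (q x) j) holomorphic_on S"
      "\<And>x. x \<in> S \<Longrightarrow> degree (q x) \<le> e'" "\<And>x. x \<in> S \<Longrightarrow> coeff (q x) e' = g x"
      "\<And>x n. x \<in> S \<Longrightarrow> G n x = poly (q x) (of_nat n)"
    using assms(2) by (rule pfamE) (rule that)
  have top: "coeff (a * b) (e + e') = coeff a e * coeff b e'"
    if "degree a \<le> e" "degree b \<le> e'" for a b :: "complex poly"
  proof -
    have "coeff (a * b) (e + e') = (\<Sum>i\<le>e + e'. if i = e then coeff a e * coeff b e' else 0)"
      unfolding coeff_mult
    proof (intro sum.cong refl)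
      fix i assume "i \<in> {..e + e'}"
      show "coeff a i * coeff b (e + e' - i) = (if i = e then coeff a e * coeff b e' else 0)"
        using that by (cases i e rule: linorder_cases) (auto simp: coeff_eq_0)
    qed
    thus ?thesis by simp
  qed
  show ?thesis
  proof (rule pfamI)
    show "(\<lambda>x. coeff (p x * q x) j) holomorphic_on S" for j
      unfolding coeff_mult using p(1) q(1) by (auto intro!: holomorphic_intros)
    show "degree (p x * q x) \<le> e + e'" if "x \<in> S" for x
      using degree_mult_le[of "p x" "q x"] p(2)[OF that] q(2)[OF that] by linarith
  qed (use p q top in auto)
qed

lemma pfam_power:
  assumes "pfam S e F f"
  shows "pfam S (k * e) (\<lambda>n x. F n x ^ k) (\<lambda>x. f x ^ k)"
proof (induction k)
  case 0 show ?case using pfam_const[of "\<lambda>_. 1" S] by simp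
next
  case (Suc k) show ?case using pfam_mult[OF assms Suc] by simp
qed

lemma pfam_raise:
  assumes "pfam S e F f" "e < e'"
  shows "pfam S e' F (\<lambda>_. 0)"
proof -
  obtain p where p: "\<And>j. (\<lambda>x. coeff (p x) j) holomorphic_on S"
      "\<And>x. x \<in> S \<Longrightarrow> degree (p x) \<le> e" "\<And>x. x \<in> S \<Longrightarrow> coeff (p x) e = f x"
      "\<And>x n. x \<in> S \<Longrightarrow> F n x = poly (p x) (of_nat n)"
    using assms(1) by (rule pfamE) (rule that)
  show ?thesis
  proof (rule pfamI[OF p(1)])
    fix x assume "x \<in> S"
    hence "degree (p x) \<le> e" by (rule p(2))
    with assms(2) show "degree (p x) \<le> e'" "coeff (p x) e' = 0" by (auto intro: coeff_eq_0)
  qed (rule p(4))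
qed

lemma pfam_zero: "pfam S e (\<lambda>_ _. 0) (\<lambda>_. 0)"
  by (rule pfamI[where p = "\<lambda>_. 0"]) auto

lemma pfam_sum:
  assumes "\<And>i. i \<in> I \<Longrightarrow> pfam S e (F i) (f i)"
  shows "pfam S e (\<lambda>n x. \<Sum>i\<in>I. F i n x) (\<lambda>x. \<Sum>i\<in>I. f i x)"
  using assms by (induction I rule: infinite_finite_induct) (auto intro: pfam_zero pfam_add)

lemma residue_sum:
  assumes "open S" "z \<in> S" "\<And>i. i \<in> I \<Longrightarrow> f i holomorphic_on S - {z}"
  shows "residue (\<lambda>x. \<Sum>i\<in>I. f i x) z = (\<Sum>i\<in>I. residue (f i) z)"
  using assms(3)
proof (induction I rule: infinite_finite_induct)
  case (insert i I)
  have "residue (\<lambda>x. f i x + (\<Sum>i\<in>I. f i x)) z = residue (f i) z + residue (\<lambda>x. \<Sum>i\<in>I. f i x) z"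
    using insert.prems by (intro residue_add[OF assms(1,2)]) (auto intro!: holomorphic_intros)
  thus ?case using insert by simp
qed (auto simp: residue_const)

lemma pfam_residue:
  assumes F: "pfam (S - {z}) e F f" and S: "open S" "z \<in> S"
  obtains q where "degree q \<le> e" "coeff q e = residue f z" "\<And>n. residue (F n) z = poly q (of_nat n)"
proof -
  obtain p where p: "\<And>j. (\<lambda>x. coeff (p x) j) holomorphic_on S - {z}"
      "\<And>x. x \<in> S - {z} \<Longrightarrow> degree (p x) \<le> e" "\<And>x. x \<in> S - {z} \<Longrightarrow> coeff (p x) e = f x"
      "\<And>x n. x \<in> S - {z} \<Longrightarrow> F n x = poly (p x) (of_nat n)"
    using F by (rule pfamE) (rule that)
  have ev: "\<forall>\<^sub>F x in at z. x \<in> S - {z}" using S by (intro eventually_at_in_open) auto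
  define q where "q = (\<Sum>j\<le>e. monom (residue (\<lambda>x. coeff (p x) j) z) j)"
  show thesis
  proof
    show "degree q \<le> e" unfolding q_def by (intro degree_sum_le) (auto intro: order.trans[OF degree_monom_le])
    have "coeff q e = residue (\<lambda>x. coeff (p x) e) z" unfolding q_def by (simp add: coeff_sum)
    also have "\<dots> = residue f z" using ev by (intro residue_cong) (auto elim!: eventually_mono simp: p(3))
    finally show "coeff q e = residue f z" .
    fix n
    have "residue (F n) z = residue (\<lambda>x. \<Sum>j\<le>e. of_nat n ^ j * coeff (p x) j) z"
    proof (intro residue_cong refl)
      show "\<forall>\<^sub>F x in at z. F n x = (\<Sum>j\<le>e. of_nat n ^ j * coeff (p x) j)"
        using ev
      proof eventually_elim
        case (elim x)
        have "poly (p x) (of_nat n) = (\<Sum>j\<le>e. coeff (p x) j * of_nat n ^ j)"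
          unfolding poly_altdef using p(2)[OF elim]
          by (intro sum.mono_neutral_left) (auto simp: coeff_eq_0)
        thus ?case using p(4)[OF elim] by (simp add: mult.commute)
      qed
    qed
    also have "\<dots> = (\<Sum>j\<le>e. residue (\<lambda>x. of_nat n ^ j * coeff (p x) j) z)"
      by (intro residue_sum[OF S] holomorphic_intros p(1))
    also have "\<dots> = (\<Sum>j\<le>e. of_nat n ^ j * residue (\<lambda>x. coeff (p x) j) z)"
      by (intro sum.cong refl residue_lmul[OF S] p(1))
    also have "\<dots> = poly q (of_nat n)" unfolding q_def by (simp add: poly_sum poly_monom mult.commute)
    finally show "residue (F n) z = poly q (of_nat n)" .
  qed
qed

section \<open>The residue at a parabolic point\<close>

text \<open>The kernel \<open>arcsin (sqrt w) / sqrt w\<close>, fixed once so that all parabolic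
  points share the same function.\<close>

definition asn :: "complex \<Rightarrow> complex" where
  "asn = (SOME f. f holomorphic_on ball 0 1 \<and> f 0 = 1 \<and> (\<forall>s. norm s < 1 \<longrightarrow>
     sin (s * f (s ^ 2)) = s \<and> Re (cos (s * f (s ^ 2))) > 0 \<and>
     (f (s ^ 2) + 2 * s ^ 2 * deriv f (s ^ 2)) * cos (s * f (s ^ 2)) = 1))"

lemma asn:
  "asn holomorphic_on ball 0 1" "asn 0 = 1"
  "norm s < 1 \<Longrightarrow> sin (s * asn (s ^ 2)) = s"
  "norm s < 1 \<Longrightarrow> Re (cos (s * asn (s ^ 2))) > 0"
  "norm s < 1 \<Longrightarrow> (asn (s ^ 2) + 2 * s ^ 2 * deriv asn (s ^ 2)) * cos (s * asn (s ^ 2)) = 1"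
proof -
  have "\<exists>f. f holomorphic_on ball 0 1 \<and> f 0 = 1 \<and> (\<forall>s. norm s < 1 \<longrightarrow>
     sin (s * f (s ^ 2)) = s \<and> Re (cos (s * f (s ^ 2))) > 0 \<and>
     (f (s ^ 2) + 2 * s ^ 2 * deriv f (s ^ 2)) * cos (s * f (s ^ 2)) = 1)"
    using arcsin_kernel by metis
  from someI_ex[OF this, folded asn_def]
  show "asn holomorphic_on ball 0 1" "asn 0 = 1"
    "norm s < 1 \<Longrightarrow> sin (s * asn (s ^ 2)) = s"
    "norm s < 1 \<Longrightarrow> Re (cos (s * asn (s ^ 2))) > 0"
    "norm s < 1 \<Longrightarrow> (asn (s ^ 2) + 2 * s ^ 2 * deriv asn (s ^ 2)) * cos (s * asn (s ^ 2)) = 1"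
    by blast+
qed

definition sinc :: "complex \<Rightarrow> complex" where
  "sinc = (SOME f. f holomorphic_on ball 0 1 \<and> (\<forall>z. norm z < 1 \<longrightarrow> sin z = z * f (z ^ 2)) \<and>
     (\<forall>w. norm w < 1 \<longrightarrow> f w \<noteq> 0 \<and> (\<lambda>k. 1 / (w - sa k)) sums (deriv f w / f w)))"

lemma sinc:
  "sinc holomorphic_on ball 0 1" "norm z < 1 \<Longrightarrow> sin z = z * sinc (z ^ 2)"
  "norm w < 1 \<Longrightarrow> sinc w \<noteq> 0" "norm w < 1 \<Longrightarrow> (\<lambda>k. 1 / (w - sa k)) sums (deriv sinc w / sinc w)"
proof -
  have "\<exists>f. f holomorphic_on ball 0 1 \<and> (\<forall>z. norm z < 1 \<longrightarrow> sin z = z * f (z ^ 2)) \<and>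
     (\<forall>w. norm w < 1 \<longrightarrow> f w \<noteq> 0 \<and> (\<lambda>k. 1 / (w - sa k)) sums (deriv f w / f w))"
    using sinc_kernel by metis
  from someI_ex[OF this, folded sinc_def]
  show "sinc holomorphic_on ball 0 1" "norm z < 1 \<Longrightarrow> sin z = z * sinc (z ^ 2)"
  "norm w < 1 \<Longrightarrow> sinc w \<noteq> 0" "norm w < 1 \<Longrightarrow> (\<lambda>k. 1 / (w - sa k)) sums (deriv sinc w / sinc w)"
    by blast+
qed

lemma mult_divide_eq_1D: "y * (z / k) = 1 \<Longrightarrow> k \<noteq> 0 \<Longrightarrow> y * z = (k :: complex)"
  by (simp add: field_simps)

lemma log_derivative_mult3:
  fixes c :: complex
  assumes "c \<noteq> 0" "p \<noteq> 0" "q \<noteq> 0" "r \<noteq> 0"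
  shows "c * (p' * (q * r) + (q' * r + r' * s * q) * p) / (c * (p * (q * r))) = p' / p + q' / q + r' / r * s"
  using assms by (simp add: add_divide_distrib distrib_right)

lemma square_eq_Re_pos:
  assumes "p ^ 2 = q ^ 2" "Re p > 0" "Re q > 0" shows "p = q"
  using assms by (auto simp: power2_eq_iff)

text \<open>Trace \<open>2 \<iota> cos \<theta>\<close> and determinant \<open>-1\<close> mean
  eigenvalues \<open>\<iota> exp (i \<theta>)\<close> and \<open>\<iota> exp (- i \<theta>)\<close>.
  Leaving the root \<open>\<iota>\<close> of \<open>-1\<close> open covers \<open>T = 2 \<i>\<close>
  and \<open>T = -2 \<i>\<close> together.\<close>

lemma fibo_trig:
  assumes "\<iota> ^ 2 = (-1 :: complex)"
  shows "fibo (2 * \<iota> * cos \<theta>) k * sin \<theta> * \<iota> = \<iota> ^ k * sin (of_nat k * \<theta>)"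
proof (induction k rule: induct_nat_012)
  case (ge2 k)
  have s: "sin (of_nat (Suc (Suc k)) * \<theta>) = 2 * cos \<theta> * sin (of_nat (Suc k) * \<theta>) - sin (of_nat k * \<theta>)"
  proof -
    have "of_nat (Suc (Suc k)) * \<theta> = of_nat (Suc k) * \<theta> + \<theta>" "of_nat k * \<theta> = of_nat (Suc k) * \<theta> - \<theta>"
      by (simp_all add: algebra_simps)
    thus ?thesis by (simp only: sin_add sin_diff) (simp add: algebra_simps)
  qed
  have "fibo (2 * \<iota> * cos \<theta>) (Suc (Suc k)) * sin \<theta> * \<iota> =
    2 * \<iota> * cos \<theta> * (fibo (2 * \<iota> * cos \<theta>) (Suc k) * sin \<theta> * \<iota>) + fibo (2 * \<iota> * cos \<theta>) k * sin \<theta> * \<iota>"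
    by (simp add: algebra_simps)
  also have "\<dots> = 2 * \<iota> * cos \<theta> * (\<iota> ^ Suc k * sin (of_nat (Suc k) * \<theta>)) + \<iota> ^ k * sin (of_nat k * \<theta>)"
    using ge2 by simp
  also have "\<dots> = \<iota> ^ k * (\<iota> ^ 2 * (2 * cos \<theta> * sin (of_nat (Suc k) * \<theta>)) + sin (of_nat k * \<theta>))"
    by (simp add: algebra_simps power2_eq_square)
  also have "\<dots> = \<iota> ^ k * \<iota> ^ 2 * sin (of_nat (Suc (Suc k)) * \<theta>)"
    unfolding s assms by (simp add: algebra_simps)
  also have "\<iota> ^ k * \<iota> ^ 2 = \<iota> ^ Suc (Suc k)" by (simp add: power2_eq_square)
  finally show ?case .
qed simp_all

text \<open>\<open>QQ\<close> is the Gram identity after completing the square. \<open>QK\<close> is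
  the differential relation that makes \<open>K\<close> the part of the derivative of the angle that
  does not grow with \<open>n\<close>; see \<open>omega_eq\<close>.\<close>

locale parabolic_data =
  fixes t u A B K :: "complex poly" and \<tau> z0 :: complex
  assumes tau: "\<tau> = 1 \<or> \<tau> = -1" and tz: "poly t z0 = 2 * \<i> * \<tau>" and uz: "poly u z0 \<noteq> 0"
    and QK: "(2 * A - t * B) * K = 2 * t * pderiv t * B * u + 2 * (t ^ 2 + 4) * (u * pderiv B - pderiv u * B)"
    and QQ: "(2 * A - t * B) ^ 2 = 4 * u ^ 2 + (t ^ 2 + 4) * B ^ 2"
    and D_nz: "t ^ 2 + 4 \<noteq> 0"
begin

text \<open>For either root \<open>s\<close> of \<open>s^2 = D / 4\<close> the angle of the
  monodromy is \<open>\<theta> = s * a\<close>, the phase of \<open>P n\<close> is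
  \<open>\<phi> = s * \<psi>\<close>, and \<open>s * zt n = n \<theta> + \<phi>\<close>,
  \<open>w n = (s * zt n)^2\<close>. None of \<open>a\<close>, \<open>\<psi>\<close>,
  \<open>zt\<close>, \<open>w\<close> depends on the choice of \<open>s\<close>. The number
  \<open>\<sigma>\<close> is a sign.\<close>

definition "D = t ^ 2 + 4"
definition "Q = 2 * A - t * B"
definition "\<iota> = \<i> * \<tau>"
definition "\<sigma> = poly Q z0 / (2 * poly u z0)"
definition "a x = asn (poly D x / 4)"
definition "\<rho> x = \<iota> * \<sigma> * poly B x / poly u x"
definition "\<psi> x = \<rho> x * asn (poly D x * \<rho> x ^ 2 / 4)"
definition "zt n x = of_nat n * a x + \<psi> x"
definition "w n x = poly D x / 4 * zt n x ^ 2"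
definition "P n = fibo t n * A + fibo t (n - 1) * B"

lemma tau2: "\<tau> ^ 2 = 1" "\<iota> ^ 2 = -1" "\<iota> \<noteq> 0"
  using tau by (auto simp: \<iota>_def power_mult_distrib)

lemma poly_D: "poly D x = poly t x ^ 2 + 4" by (simp add: D_def)

lemma poly_D': "poly (pderiv D) x = 2 * poly t x * poly (pderiv t) x"
  by (simp add: D_def power2_eq_square pderiv_add pderiv_mult pderiv_numeral)

lemma Dz: "poly D z0 = 0"
  unfolding poly_D tz using tau2(1) by (simp add: power_mult_distrib)

lemma QQ': "poly Q x ^ 2 = 4 * poly u x ^ 2 + poly D x * poly B x ^ 2"
  using arg_cong[OF QQ, of "\<lambda>p. poly p x"] by (simp add: Q_def D_def)

lemma sigma2: "\<sigma> ^ 2 = 1" "\<sigma> \<noteq> 0"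
proof -
  show "\<sigma> ^ 2 = 1" using QQ'[of z0] uz by (simp add: \<sigma>_def Dz power_divide power_mult_distrib)
  thus "\<sigma> \<noteq> 0" by auto
qed

text \<open>The norm bounds keep the kernels within their disc, and the positive real parts
  determine both cosines, which the algebra alone gives only up to sign.\<close>

definition good :: "complex \<Rightarrow> bool" where
  "good x \<longleftrightarrow> norm (poly D x / 4) < 1 \<and> norm (poly D x * \<rho> x ^ 2 / 4) < 1 \<and> poly u x \<noteq> 0 \<and>
     Re (poly t x / (2 * \<iota>)) > 0 \<and> Re (\<sigma> * poly Q x / (2 * poly u x)) > 0 \<and> (x \<noteq> z0 \<longrightarrow> poly D x \<noteq> 0)"

lemma good_nbhd: obtains S where "open S" "z0 \<in> S" "\<And>x. x \<in> S \<Longrightarrow> good x"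
proof -
  have lim: "((\<lambda>x. poly p x) \<longlongrightarrow> poly p z0) (nhds z0)" for p :: "complex poly"
    using poly_isCont[of z0 p] by (simp add: isCont_def tendsto_nhds_iff)
  have 1: "\<forall>\<^sub>F x in nhds z0. norm (poly D x / 4) < 1"
  proof -
    have "((\<lambda>x. norm (poly D x / 4)) \<longlongrightarrow> norm (poly D z0 / 4)) (nhds z0)" by (intro tendsto_intros lim) auto
    thus ?thesis by (rule order_tendstoD) (simp add: Dz)
  qed
  have 2: "\<forall>\<^sub>F x in nhds z0. norm (poly D x * \<rho> x ^ 2 / 4) < 1"
  proof -
    have "((\<lambda>x. norm (poly D x * \<rho> x ^ 2 / 4)) \<longlongrightarrow> norm (poly D z0 * \<rho> z0 ^ 2 / 4)) (nhds z0)"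
      unfolding \<rho>_def by (intro tendsto_intros lim) (use uz in auto)
    thus ?thesis by (rule order_tendstoD) (simp add: Dz)
  qed
  have 3: "\<forall>\<^sub>F x in nhds z0. poly u x \<noteq> 0"
    by (rule tendsto_imp_eventually_ne[OF lim uz])
  have 4: "\<forall>\<^sub>F x in nhds z0. Re (poly t x / (2 * \<iota>)) > 0"
  proof -
    have "((\<lambda>x. Re (poly t x / (2 * \<iota>))) \<longlongrightarrow> Re (poly t z0 / (2 * \<iota>))) (nhds z0)"
      by (intro tendsto_intros lim) (use tau2 in auto)
    thus ?thesis by (rule order_tendstoD) (use tau2(3) in \<open>simp add: tz \<iota>_def\<close>)
  qed
  have 5: "\<forall>\<^sub>F x in nhds z0. Re (\<sigma> * poly Q x / (2 * poly u x)) > 0"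
  proof -
    have "((\<lambda>x. Re (\<sigma> * poly Q x / (2 * poly u x))) \<longlongrightarrow> Re (\<sigma> * poly Q z0 / (2 * poly u z0))) (nhds z0)"
      by (intro tendsto_intros lim) (use uz in auto)
    moreover have "\<sigma> * poly Q z0 / (2 * poly u z0) = 1" using sigma2(1) by (simp add: \<sigma>_def power2_eq_square)
    ultimately show ?thesis by (auto dest!: order_tendstoD(1)[of _ _ _ 0])
  qed
  have 6: "\<forall>\<^sub>F x in nhds z0. x \<noteq> z0 \<longrightarrow> poly D x \<noteq> 0"
  proof -
    have "finite ({x. poly D x = 0} - {z0})" using poly_roots_finite[of D] D_nz by (simp add: D_def)
    hence "open (- ({x. poly D x = 0} - {z0}))" by (intro open_Compl finite_imp_closed)
    hence "\<forall>\<^sub>F x in nhds z0. x \<in> - ({x. poly D x = 0} - {z0})" by (rule eventually_nhds_in_open) auto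
    thus ?thesis by eventually_elim auto
  qed
  have "\<forall>\<^sub>F x in nhds z0. good x"
    using 1 2 3 4 5 6 by eventually_elim (simp add: good_def)
  thus thesis using that unfolding eventually_nhds by blast
qed

end

locale parabolic_nbhd = parabolic_data +
  fixes S :: "complex set"
  assumes S: "open S" "z0 \<in> S" and good: "\<And>x. x \<in> S \<Longrightarrow> good x"
begin

lemma goodD:
  assumes "x \<in> S"
  shows "norm (poly D x / 4) < 1" "norm (poly D x * \<rho> x ^ 2 / 4) < 1" "poly u x \<noteq> 0"
    "Re (poly t x / (2 * \<iota>)) > 0" "Re (\<sigma> * poly Q x / (2 * poly u x)) > 0" "x \<noteq> z0 \<Longrightarrow> poly D x \<noteq> 0"
    "poly t x \<noteq> 0" "poly Q x \<noteq> 0"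
  using good[OF assms] by (auto simp: good_def)

lemma asn_hol:
  assumes "f holomorphic_on S" "\<And>x. x \<in> S \<Longrightarrow> norm (f x) < 1"
  shows "(\<lambda>x. asn (f x)) holomorphic_on S"
proof -
  have "f ` S \<subseteq> ball 0 1" using assms(2) by auto
  from holomorphic_on_compose_gen[OF assms(1) asn(1) this] show ?thesis by (simp add: o_def)
qed

lemma \<rho>_hol: "\<rho> holomorphic_on S"
  unfolding \<rho>_def by (intro holomorphic_intros) (auto dest: goodD)

lemma a_hol: "a holomorphic_on S"
  unfolding a_def by (intro asn_hol holomorphic_intros) (auto dest: goodD)

lemma \<psi>_hol: "\<psi> holomorphic_on S"
  unfolding \<psi>_def by (intro holomorphic_intros \<rho>_hol asn_hol) (use goodD(2) in auto)

lemma zt_hol: "zt n holomorphic_on S"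
  unfolding zt_def by (intro holomorphic_intros a_hol \<psi>_hol)

lemma w_hol: "w n holomorphic_on S"
  unfolding w_def by (intro holomorphic_intros zt_hol) auto

lemma S_deriv: "f holomorphic_on S \<Longrightarrow> x \<in> S \<Longrightarrow> (f has_field_derivative deriv f x) (at x)"
  by (rule holomorphic_derivI[OF _ S(1)])

lemma small_root:
  assumes "norm (v :: complex) < 1"
  obtains s where "s ^ 2 = v" "norm s < 1"
proof
  show "csqrt v ^ 2 = v" by simp
  show "norm (csqrt v) < 1" using assms by simp
qed

lemma asn_deriv: "norm v < 1 \<Longrightarrow> (asn has_field_derivative deriv asn v) (at v)"
  by (rule holomorphic_derivI[OF asn(1)]) auto

lemma angle_theta:
  assumes x: "x \<in> S" and s: "s ^ 2 = poly D x / 4"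
  shows "sin (s * a x) = s" "cos (s * a x) = poly t x / (2 * \<iota>)"
proof -
  have "norm (s ^ 2) < 1" using goodD(1)[OF x] by (simp only: s)
  hence n: "norm s < 1" by (simp add: norm_power power_less_one_iff)
  have ax: "a x = asn (s ^ 2)" by (simp add: a_def s)
  show sn: "sin (s * a x) = s" using asn(3)[OF n] by (simp add: ax)
  show "cos (s * a x) = poly t x / (2 * \<iota>)"
  proof (rule square_eq_Re_pos)
    have "cos (s * a x) ^ 2 = 1 - s ^ 2" by (simp add: cos_squared_eq sn)
    also have "\<dots> = (poly t x / (2 * \<iota>)) ^ 2"
      by (simp add: s poly_D power_divide power_mult_distrib tau2 field_simps)
    finally show "cos (s * a x) ^ 2 = (poly t x / (2 * \<iota>)) ^ 2" .
  qed (use asn(4)[OF n] goodD(4)[OF x] in \<open>simp_all add: ax\<close>)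
qed

lemma angle_phi:
  assumes x: "x \<in> S" and s: "s ^ 2 = poly D x / 4"
  shows "sin (s * \<psi> x) = s * \<rho> x" "cos (s * \<psi> x) = \<sigma> * poly Q x / (2 * poly u x)"
proof -
  have s2: "(s * \<rho> x) ^ 2 = poly D x * \<rho> x ^ 2 / 4" by (simp add: power_mult_distrib s)
  have "norm ((s * \<rho> x) ^ 2) < 1" using goodD(2)[OF x] by (simp only: s2)
  hence n: "norm (s * \<rho> x) < 1" unfolding norm_power by (subst (asm) power_less_one_iff) auto
  have ax: "s * \<psi> x = (s * \<rho> x) * asn ((s * \<rho> x) ^ 2)" by (simp add: \<psi>_def s2)
  show sn: "sin (s * \<psi> x) = s * \<rho> x" using asn(3)[OF n] by (simp only: ax)
  show "cos (s * \<psi> x) = \<sigma> * poly Q x / (2 * poly u x)"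
  proof (rule square_eq_Re_pos)
    have "cos (s * \<psi> x) ^ 2 = 1 - (s * \<rho> x) ^ 2" by (simp only: cos_squared_eq sn)
    also have "\<dots> = 1 - poly D x / 4 * \<rho> x ^ 2" by (simp add: s2)
    also have "\<rho> x ^ 2 = - (poly B x ^ 2) / poly u x ^ 2"
      unfolding \<rho>_def by (simp only: power_mult_distrib power_divide tau2 sigma2) simp
    also have "1 - poly D x / 4 * (- (poly B x ^ 2) / poly u x ^ 2) = (\<sigma> * poly Q x / (2 * poly u x)) ^ 2"
      using goodD(3)[OF x] unfolding power_mult_distrib power_divide QQ' sigma2
      by (simp add: field_simps)
    finally show "cos (s * \<psi> x) ^ 2 = (\<sigma> * poly Q x / (2 * poly u x)) ^ 2" .
  qed (use asn(4)[OF n] goodD(5)[OF x] in \<open>simp_all only: ax\<close>)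
qed

text \<open>Differentiation of \<open>sin (s a) = s\<close>; the root \<open>s\<close> enters only
  through \<open>s^2 = D / 4\<close> and \<open>D' = 2 t t'\<close>, so it disappears from the
  result.\<close>

lemma a_ode:
  assumes x: "x \<in> S"
  shows "poly D x * deriv a x + poly t x * poly (pderiv t) x * a x = 2 * \<iota> * poly (pderiv t) x"
proof -
  let ?v = "poly D x / 4"
  obtain s where s: "s ^ 2 = ?v" "norm s < 1" using small_root[OF goodD(1)[OF x]] .
  have "(a has_field_derivative deriv asn ?v * (poly (pderiv D) x / 4)) (at x)"
    unfolding a_def
    by (rule DERIV_chain2[where f = asn and g = "\<lambda>x. poly D x / 4", OF asn_deriv[OF goodD(1)[OF x]]])
      (auto intro!: derivative_eq_intros poly_DERIV)
  hence da: "deriv a x = deriv asn ?v * (poly (pderiv D) x / 4)" by (rule DERIV_imp_deriv)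
  have "(a x + 2 * ?v * deriv asn ?v) * (poly t x / (2 * \<iota>)) = 1"
    using asn(5)[OF s(2)] angle_theta(2)[OF x s(1)] by (simp add: a_def s(1))
  hence *: "(a x + 2 * ?v * deriv asn ?v) * poly t x = 2 * \<iota>"
    by (rule mult_divide_eq_1D) (use tau2(3) in simp)
  have "poly D x * deriv a x + poly t x * poly (pderiv t) x * a x =
    ((a x + 2 * ?v * deriv asn ?v) * poly t x) * poly (pderiv t) x"
    unfolding da poly_D' by (simp add: algebra_simps)
  thus ?thesis unfolding * .
qed

text \<open>The same computation for the phase, now starting from
  \<open>sin \<phi> = s \<rho>\<close>. The assumption \<open>QK\<close> is what identifies the
  right-hand side with \<open>K / u\<close>.\<close>

lemma \<psi>_ode:
  assumes x: "x \<in> S"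
  shows "poly D x * deriv \<psi> x + poly t x * poly (pderiv t) x * \<psi> x = \<iota> * poly K x / poly u x"
proof -
  let ?D = "poly D x" and ?v = "poly D x * \<rho> x ^ 2 / 4" and ?t = "poly t x" and ?t' = "poly (pderiv t) x"
    and ?u = "poly u x" and ?B = "poly B x" and ?u' = "poly (pderiv u) x" and ?B' = "poly (pderiv B) x"
  note u = goodD(3)[OF x]
  obtain s where s: "s ^ 2 = ?D / 4" "norm s < 1" using small_root[OF goodD(1)[OF x]] .
  have s2: "(s * \<rho> x) ^ 2 = ?v" by (simp add: power_mult_distrib s)
  have "norm ((s * \<rho> x) ^ 2) < 1" using goodD(2)[OF x] by (simp only: s2)
  hence n: "norm (s * \<rho> x) < 1" unfolding norm_power by (subst (asm) power_less_one_iff) auto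
  define \<rho>' where "\<rho>' = \<iota> * \<sigma> * (?B' * ?u - ?B * ?u') / ?u ^ 2"
  have d\<rho>: "(\<rho> has_field_derivative \<rho>') (at x)"
    unfolding \<rho>_def \<rho>'_def using u
    by (auto intro!: derivative_eq_intros poly_DERIV simp: power2_eq_square field_simps)
  have dv: "((\<lambda>x. poly D x * \<rho> x ^ 2 / 4) has_field_derivative
      (2 * ?t * ?t' * \<rho> x ^ 2 + 2 * ?D * \<rho> x * \<rho>') / 4) (at x)"
    by (auto intro!: derivative_eq_intros poly_DERIV d\<rho> simp: poly_D' algebra_simps)
  have "((\<lambda>x. asn (poly D x * \<rho> x ^ 2 / 4)) has_field_derivative
      deriv asn ?v * ((2 * ?t * ?t' * \<rho> x ^ 2 + 2 * ?D * \<rho> x * \<rho>') / 4)) (at x)"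
    by (rule DERIV_chain2[where f = asn and g = "\<lambda>x. poly D x * \<rho> x ^ 2 / 4", OF asn_deriv[OF goodD(2)[OF x]] dv])
  from DERIV_mult[OF d\<rho> this]
  have "(\<psi> has_field_derivative \<rho>' * asn ?v +
      \<rho> x * (deriv asn ?v * ((2 * ?t * ?t' * \<rho> x ^ 2 + 2 * ?D * \<rho> x * \<rho>') / 4))) (at x)"
    unfolding \<psi>_def by (simp add: algebra_simps)
  hence d\<psi>: "deriv \<psi> x = \<rho>' * asn ?v + \<rho> x * (deriv asn ?v * ((2 * ?t * ?t' * \<rho> x ^ 2 + 2 * ?D * \<rho> x * \<rho>') / 4))"
    by (rule DERIV_imp_deriv)
  have ode: "(asn ?v + 2 * ?v * deriv asn ?v) * (\<sigma> * poly Q x / (2 * ?u)) = 1"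
    using asn(5)[OF n] angle_phi(2)[OF x s(1)] by (simp only: s2) (simp add: \<psi>_def mult.assoc)
  have "?D * deriv \<psi> x + ?t * ?t' * \<psi> x = (?D * \<rho>' + ?t * ?t' * \<rho> x) * (asn ?v + 2 * ?v * deriv asn ?v)"
    unfolding d\<psi> by (simp add: \<psi>_def algebra_simps power2_eq_square)
  hence *: "(?D * deriv \<psi> x + ?t * ?t' * \<psi> x) * (\<sigma> * poly Q x / (2 * ?u)) = ?D * \<rho>' + ?t * ?t' * \<rho> x"
    by (simp only: mult.assoc[of _ "asn ?v + _"] ode mult_1_right)
  have h1: "poly Q x * poly K x = 2 * ?t * ?t' * ?B * ?u + 2 * ?D * (?u * ?B' - ?u' * ?B)"
    using arg_cong[OF QK, of "\<lambda>p. poly p x"] by (simp add: Q_def D_def)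
  have h2: "?D * \<rho>' + ?t * ?t' * \<rho> x =
      \<iota> * \<sigma> * (2 * ?t * ?t' * ?B * ?u + 2 * ?D * (?u * ?B' - ?u' * ?B)) / (2 * ?u ^ 2)"
    unfolding \<rho>'_def \<rho>_def using u by (simp add: field_simps power2_eq_square)
  have eq: "(?D * deriv \<psi> x + ?t * ?t' * \<psi> x) * (\<sigma> * poly Q x / (2 * ?u)) =
      (\<iota> * poly K x / ?u) * (\<sigma> * poly Q x / (2 * ?u))"
    unfolding * h2 h1[symmetric] by (simp add: power2_eq_square mult_ac)
  have ne: "\<sigma> * poly Q x / (2 * ?u) \<noteq> 0" using sigma2(2) goodD(8)[OF x] u by simp
  show ?thesis by (rule iffD1[OF mult_right_cancel[OF ne] eq])
qed

text \<open>The bracket is \<open>4 s\<close> times the derivative of the angle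
  \<open>s * zt n\<close>. Thus \<open>\<Omega>\<close> and the logarithmic derivative of
  \<open>P n\<close> are governed by one and the same angle.\<close>

lemma omega_eq:
  assumes x: "x \<in> S"
  shows "2 * of_nat n * poly u x * poly (pderiv t) x + poly K x =
    - \<iota> * poly u x * (poly D x * deriv (zt n) x + poly t x * poly (pderiv t) x * zt n x)"
proof -
  have "(zt n has_field_derivative of_nat n * deriv a x + deriv \<psi> x) (at x)"
    unfolding zt_def
    by (auto intro!: derivative_eq_intros S_deriv[OF a_hol x] S_deriv[OF \<psi>_hol x])
  hence "deriv (zt n) x = of_nat n * deriv a x + deriv \<psi> x" by (rule DERIV_imp_deriv)
  hence "poly D x * deriv (zt n) x + poly t x * poly (pderiv t) x * zt n x =
     of_nat n * (poly D x * deriv a x + poly t x * poly (pderiv t) x * a x) +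
     (poly D x * deriv \<psi> x + poly t x * poly (pderiv t) x * \<psi> x)"
    by (simp add: zt_def algebra_simps)
  also have "\<dots> = of_nat n * (2 * \<iota> * poly (pderiv t) x) + \<iota> * poly K x / poly u x"
    unfolding a_ode[OF x] \<psi>_ode[OF x] ..
  also have "- \<iota> * poly u x * \<dots> = - (\<iota> ^ 2) * (2 * of_nat n * poly u x * poly (pderiv t) x + poly K x)"
    using goodD(3)[OF x] by (simp add: field_simps power2_eq_square)
  finally show ?thesis by (simp add: tau2)
qed

text \<open>Away from \<open>z0\<close> this is the addition theorem for
  \<open>sin (n \<theta> + \<phi>)\<close> divided by \<open>s\<close>. At \<open>z0\<close> itself,
  where \<open>s = 0\<close>, it follows by continuity.\<close>

lemma P_eq_sinc:
  assumes x: "x \<in> S" and n: "n > 0" and small: "norm (w n x) < 1"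
  shows "poly (P n) x = \<sigma> * \<iota> ^ (n - 1) * poly u x * zt n x * sinc (w n x)"
proof -
  have *: "poly (P n) x = \<sigma> * \<iota> ^ (n - 1) * poly u x * zt n x * sinc (w n x)"
    if x: "x \<in> S" "norm (w n x) < 1" and ne: "x \<noteq> z0" for x
  proof -
    have D: "poly D x \<noteq> 0" using goodD(6)[OF x(1) ne] .
    obtain s where s: "s ^ 2 = poly D x / 4" "norm s < 1" using small_root[OF goodD(1)[OF x(1)]] .
    have s0: "s \<noteq> 0" using s D by auto
    define \<theta> \<phi> where "\<theta> = s * a x" and "\<phi> = s * \<psi> x"
    have th: "sin \<theta> = s" "cos \<theta> = poly t x / (2 * \<iota>)" using angle_theta[OF x(1) s(1)] by (simp_all add: \<theta>_def)
    have ph: "sin \<phi> = s * \<rho> x" "cos \<phi> = \<sigma> * poly Q x / (2 * poly u x)" using angle_phi[OF x(1) s(1)] by (simp_all add: \<phi>_def)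
    have t: "poly t x = 2 * \<iota> * cos \<theta>" using th(2) tau2(3) by simp
    have z: "s * zt n x = of_nat n * \<theta> + \<phi>" by (simp add: zt_def \<theta>_def \<phi>_def algebra_simps)
    have w: "(s * zt n x) ^ 2 = w n x" by (simp add: w_def power_mult_distrib s)
    have "norm ((s * zt n x) ^ 2) < 1" using x(2) by (simp only: w)
    hence sm: "norm (s * zt n x) < 1" unfolding norm_power by (subst (asm) power_less_one_iff) auto
    obtain k where k: "n = Suc k" using n by (cases n) auto
    have fib: "fibo (poly t x) j * s * \<iota> = \<iota> ^ j * sin (of_nat j * \<theta>)" for j
      unfolding t th(1)[symmetric] by (rule fibo_trig[OF tau2(2)])
    have pf: "poly (fibo t j) x = fibo (poly t x) j" for j
      by (induction j rule: induct_nat_012) simp_all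
    have "sin (of_nat k * \<theta>) = sin (of_nat n * \<theta> - \<theta>)" by (simp add: k algebra_simps)
    hence sk: "sin (of_nat k * \<theta>) = sin (of_nat n * \<theta>) * cos \<theta> - cos (of_nat n * \<theta>) * s"
      by (simp only: sin_diff th(1))
    have A: "poly A x = poly Q x / 2 + \<iota> * cos \<theta> * poly B x" by (simp add: Q_def t)
    have "poly (P n) x * (s * \<iota>) = (fibo (poly t x) n * s * \<iota>) * poly A x + (fibo (poly t x) k * s * \<iota>) * poly B x"
      by (simp add: P_def pf k algebra_simps)
    also have "\<dots> = \<iota> ^ k * (\<iota> * sin (of_nat n * \<theta>) * poly Q x / 2 - cos (of_nat n * \<theta>) * s * poly B x
        + (1 + \<iota> ^ 2) * (sin (of_nat n * \<theta>) * cos \<theta> * poly B x))"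
      unfolding fib sk A by (simp add: k algebra_simps power2_eq_square)
    also have "1 + \<iota> ^ 2 = 0" by (simp add: tau2)
    also have "\<iota> ^ k * (\<iota> * sin (of_nat n * \<theta>) * poly Q x / 2 - cos (of_nat n * \<theta>) * s * poly B x
        + 0 * (sin (of_nat n * \<theta>) * cos \<theta> * poly B x)) =
        \<sigma> * \<iota> ^ k * poly u x * \<iota> * sin (of_nat n * \<theta> + \<phi>)"
    proof -
      have 1: "\<sigma> * poly u x * cos \<phi> = poly Q x / 2"
        using goodD(3)[OF x(1)] sigma2(1) by (simp add: ph power2_eq_square field_simps)
      have "\<sigma> * poly u x * \<iota> * sin \<phi> = \<iota> ^ 2 * \<sigma> ^ 2 * (s * poly B x)"
        using goodD(3)[OF x(1)] by (simp add: ph \<rho>_def power2_eq_square)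
      hence 2: "\<sigma> * poly u x * \<iota> * sin \<phi> = - (s * poly B x)" by (simp add: tau2 sigma2)
      have "\<sigma> * \<iota> ^ k * poly u x * \<iota> * sin (of_nat n * \<theta> + \<phi>) =
        \<iota> ^ k * (\<iota> * sin (of_nat n * \<theta>) * (\<sigma> * poly u x * cos \<phi>) + cos (of_nat n * \<theta>) * (\<sigma> * poly u x * \<iota> * sin \<phi>))"
        by (simp only: sin_add) (simp add: algebra_simps)
      thus ?thesis unfolding 1 2 by (simp add: algebra_simps)
    qed
    also have "sin (of_nat n * \<theta> + \<phi>) = s * zt n x * sinc (w n x)"
      using sinc(2)[OF sm] by (simp only: z[symmetric] w)
    finally have "poly (P n) x * (s * \<iota>) = \<sigma> * \<iota> ^ k * poly u x * zt n x * sinc (w n x) * (s * \<iota>)"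
      by (simp add: mult_ac)
    thus ?thesis using s0 tau2(3) k by simp
  qed
  show ?thesis
  proof (cases "x = z0")
    case False
    thus ?thesis using * x small by blast
  next
    case True
    let ?F = "\<lambda>x. \<sigma> * \<iota> ^ (n - 1) * poly u x * zt n x * sinc (w n x)"
    have cw: "isCont (w n) z0" and cz: "isCont (zt n) z0"
      using holomorphic_on_imp_continuous_on[OF w_hol] holomorphic_on_imp_continuous_on[OF zt_hol] S
      by (simp_all add: continuous_on_eq_continuous_at)
    have "isCont sinc (w n z0)"
      using holomorphic_on_imp_continuous_on[OF sinc(1)] by (simp add: continuous_on_eq_continuous_at w_def Dz)
    hence "isCont (\<lambda>x. sinc (w n x)) z0" by (rule isCont_o2[OF cw])
    hence "isCont ?F z0" using cz by (intro continuous_intros) auto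
    hence l1: "(?F \<longlongrightarrow> ?F z0) (at z0)" by (simp add: isCont_def)
    have l2: "((\<lambda>x. poly (P n) x) \<longlongrightarrow> poly (P n) z0) (at z0)" using poly_isCont[of z0 "P n"] by (simp add: isCont_def)
    have "((\<lambda>x. norm (w n x)) \<longlongrightarrow> norm (w n z0)) (at z0)" using cw by (intro tendsto_intros) (simp add: isCont_def)
    hence "\<forall>\<^sub>F x in at z0. norm (w n x) < 1" by (rule order_tendstoD) (simp add: w_def Dz)
    moreover have "\<forall>\<^sub>F x in at z0. x \<in> S" using S by (intro eventually_at_in_open') auto
    moreover have "\<forall>\<^sub>F x in at z0. x \<noteq> z0" by (simp add: eventually_at_filter)
    ultimately have "\<forall>\<^sub>F x in at z0. poly (P n) x = ?F x" by eventually_elim (use * in blast)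
    hence "((\<lambda>x. poly (P n) x) \<longlongrightarrow> ?F z0) (at z0)" using l1 by (subst tendsto_cong)
    thus ?thesis using l2 True by (auto intro: tendsto_unique[OF trivial_limit_at])
  qed
qed

lemma log_derivative_eq:
  assumes n: "n > 0" and nz: "poly (P n) z0 \<noteq> 0"
  obtains T where "open T" "z0 \<in> T" "T \<subseteq> S" "\<And>x. x \<in> T \<Longrightarrow> norm (w n x) < 1" "\<And>x. x \<in> T \<Longrightarrow> zt n x \<noteq> 0"
    "\<And>x. x \<in> T \<Longrightarrow> poly (pderiv (P n)) x / poly (P n) x = poly (pderiv u) x / poly u x +
       deriv (zt n) x / zt n x + deriv sinc (w n x) / sinc (w n x) * deriv (w n) x"
proof -
  have cw: "isCont (w n) z0" and cz: "isCont (zt n) z0"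
    using holomorphic_on_imp_continuous_on[OF w_hol] holomorphic_on_imp_continuous_on[OF zt_hol] S
    by (simp_all add: continuous_on_eq_continuous_at)
  have lw: "(w n \<longlongrightarrow> w n z0) (nhds z0)" and lz: "(zt n \<longlongrightarrow> zt n z0) (nhds z0)"
    using cw cz by (simp_all add: isCont_def tendsto_nhds_iff)
  have wz: "w n z0 = 0" by (simp add: w_def Dz)
  have "poly (P n) z0 = \<sigma> * \<iota> ^ (n - 1) * poly u z0 * zt n z0 * sinc (w n z0)"
    by (rule P_eq_sinc[OF S(2) n]) (simp add: wz)
  hence ztz: "zt n z0 \<noteq> 0" using nz by auto
  have "((\<lambda>x. norm (w n x)) \<longlongrightarrow> norm (w n z0)) (nhds z0)" by (intro tendsto_intros lw)
  hence "\<forall>\<^sub>F x in nhds z0. norm (w n x) < 1" by (rule order_tendstoD) (simp add: wz)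
  moreover have "\<forall>\<^sub>F x in nhds z0. zt n x \<noteq> 0" by (rule tendsto_imp_eventually_ne[OF lz ztz])
  moreover have "\<forall>\<^sub>F x in nhds z0. x \<in> S" using S by (rule eventually_nhds_in_open)
  ultimately have "\<forall>\<^sub>F x in nhds z0. norm (w n x) < 1 \<and> zt n x \<noteq> 0 \<and> x \<in> S"
    by eventually_elim auto
  then obtain T where T: "open T" "z0 \<in> T" "\<And>x. x \<in> T \<Longrightarrow> norm (w n x) < 1 \<and> zt n x \<noteq> 0 \<and> x \<in> S"
    unfolding eventually_nhds by blast
  show thesis
  proof (rule that[OF T(1,2)])
    fix x assume x: "x \<in> T"
    hence xS: "x \<in> S" and wx: "norm (w n x) < 1" and zx: "zt n x \<noteq> 0" using T(3) by auto
    define c where "c = \<sigma> * \<iota> ^ (n - 1)"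
    have c: "c \<noteq> 0" using sigma2 tau2 by (simp add: c_def)
    have ds: "((\<lambda>x. sinc (w n x)) has_field_derivative deriv sinc (w n x) * deriv (w n) x) (at x)"
      by (rule DERIV_chain2[where f = sinc and g = "w n"])
        (use wx in \<open>auto intro: holomorphic_derivI[OF sinc(1)] S_deriv[OF w_hol xS]\<close>)
    define F where "F = (\<lambda>x. c * (poly u x * (zt n x * sinc (w n x))))"
    have dF: "(F has_field_derivative c * (poly (pderiv u) x * (zt n x * sinc (w n x)) +
        (deriv (zt n) x * sinc (w n x) + deriv sinc (w n x) * deriv (w n) x * zt n x) * poly u x)) (at x)"
      unfolding F_def by (intro DERIV_cmult DERIV_mult poly_DERIV ds S_deriv[OF zt_hol xS])
    have "((\<lambda>x. poly (P n) x) has_field_derivative c * (poly (pderiv u) x * (zt n x * sinc (w n x)) +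
        (deriv (zt n) x * sinc (w n x) + deriv sinc (w n x) * deriv (w n) x * zt n x) * poly u x)) (at x)"
    proof (rule has_field_derivative_transform_within_open[OF dF T(1) x])
      fix y assume "y \<in> T"
      thus "F y = poly (P n) y" using T(3)[of y] P_eq_sinc[of y n] n by (simp add: F_def c_def mult_ac)
    qed
    hence d: "poly (pderiv (P n)) x = c * (poly (pderiv u) x * (zt n x * sinc (w n x)) +
        (deriv (zt n) x * sinc (w n x) + deriv sinc (w n x) * deriv (w n) x * zt n x) * poly u x)"
      by (rule DERIV_unique[OF poly_DERIV])
    have p: "poly (P n) x = c * (poly u x * (zt n x * sinc (w n x)))"
      using P_eq_sinc[OF xS n wx] by (simp add: c_def mult_ac)
    show "poly (pderiv (P n)) x / poly (P n) x = poly (pderiv u) x / poly u x +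
       deriv (zt n) x / zt n x + deriv sinc (w n x) / sinc (w n x) * deriv (w n) x"
      unfolding d p by (rule log_derivative_mult3) (use c zx goodD(3)[OF xS] sinc(3)[OF wx] in auto)
  qed (use T(3) in auto)
qed

end

context parabolic_data
begin

text \<open>Since \<open>w\<close> has the factor \<open>D\<close>, the product
  \<open>\<Omega> * w\<close> is holomorphic at \<open>z0\<close>. Hence the expansion of
  \<open>sinc' / sinc\<close> counts only below order \<open>m\<close>, and these terms are
  polynomial in \<open>n\<close>. The one remaining quotient, \<open>zt' / zt\<close>, is split so
  that its non-polynomial part has no pole.\<close>

theorem residue_polynomial:
  assumes m: "m > 0"
  obtains q where "degree q \<le> 3 * m"
    "poly (pderiv t) z0 \<noteq> 0 \<Longrightarrow> coeff q (3 * m) =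
       - of_real (zeta_nat (2 * m)) / of_real pi ^ (2 * m) * (poly u z0 * poly (pderiv t) z0 / 2) ^ m"
    "\<And>n. n > 0 \<Longrightarrow> poly (P n) z0 \<noteq> 0 \<Longrightarrow>
       residue (\<lambda>x. ((2 * of_nat n * poly u x * poly (pderiv t) x + poly K x) / poly D x) ^ m *
         (poly (pderiv (P n)) x / poly (P n) x)) z0 = poly q (of_nat n)"
proof -
  obtain S where "open S" "z0 \<in> S" "\<And>x. x \<in> S \<Longrightarrow> good x" by (rule good_nbhd) (rule that)
  then interpret parabolic_nbhd t u A B K \<tau> z0 S by unfold_locales
  obtain g r where r: "r holomorphic_on ball 0 1"
    and gr: "\<And>w. norm w < 1 \<Longrightarrow> deriv sinc w / sinc w = (\<Sum>k<m. g k * w ^ k) + w ^ m * r w"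
    and gm: "g (m - 1) = - of_real (zeta_nat (2 * m)) / of_real pi ^ (2 * m)"
    by (rule logderiv_sinc_expansion[OF sinc(4) m], assumption, rule that)
  define S' where "S' = S - {z0}"
  have D0: "poly D x \<noteq> 0" if "x \<in> S'" for x using that goodD(6) by (auto simp: S'_def)
  have u0: "poly u x \<noteq> 0" if "x \<in> S'" for x using that goodD(3) by (auto simp: S'_def)
  note hS = holomorphic_on_subset[of _ S S']
  have sub: "S' \<subseteq> S" by (auto simp: S'_def)
  have openS': "open S'" using S by (auto simp: S'_def)
  define t' where "t' x = poly (pderiv t) x" for x
  define a' \<psi>' where "a' = deriv a" and "\<psi>' = deriv \<psi>"
  have a'_hol: "a' holomorphic_on S" and \<psi>'_hol: "\<psi>' holomorphic_on S"
    unfolding a'_def \<psi>'_def using a_hol \<psi>_hol S by (auto intro: holomorphic_deriv)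
  have t'_hol: "t' holomorphic_on X" for X unfolding t'_def by (intro holomorphic_intros)
  define zt' where "zt' n x = of_nat n * a' x + \<psi>' x" for n x
  have dzt: "deriv (zt n) x = zt' n x" if "x \<in> S" for n x
  proof -
    have "(zt n has_field_derivative of_nat n * deriv a x + deriv \<psi> x) (at x)"
      unfolding zt_def
      by (auto intro!: derivative_eq_intros S_deriv[OF a_hol that] S_deriv[OF \<psi>_hol that])
    thus ?thesis unfolding zt'_def a'_def \<psi>'_def by (rule DERIV_imp_deriv)
  qed
  define w' where "w' n x = (2 * poly t x * t' x * zt n x ^ 2 + 2 * poly D x * (zt n x * zt' n x)) / 4" for n x
  have dw: "deriv (w n) x = w' n x" if "x \<in> S" for n x
  proof -
    have "(w n has_field_derivative w' n x) (at x)"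
      unfolding w_def w'_def t'_def
      by (auto intro!: derivative_eq_intros poly_DERIV S_deriv[OF zt_hol that] simp: dzt[OF that] poly_D' power2_eq_square algebra_simps)
    thus ?thesis by (rule DERIV_imp_deriv)
  qed
  define \<Omega> where "\<Omega> n x = (2 * of_nat n * poly u x * t' x + poly K x) / poly D x" for n x
  have \<Omega>: "\<Omega> n x = - \<iota> * poly u x * (zt' n x + poly t x * t' x / poly D x * zt n x)" if "x \<in> S'" for n x
  proof -
    have xS: "x \<in> S" using that sub by auto
    have "\<Omega> n x = - \<iota> * poly u x * (poly D x * zt' n x + poly t x * t' x * zt n x) / poly D x"
      using omega_eq[OF xS, of n] unfolding \<Omega>_def t'_def dzt[OF xS] by simp
    also have "\<dots> = - \<iota> * poly u x * ((poly D x * zt' n x + poly t x * t' x * zt n x) / poly D x)"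
      by (simp only: times_divide_eq_right)
    also have "(poly D x * zt' n x + poly t x * t' x * zt n x) / poly D x = zt' n x + poly t x * t' x / poly D x * zt n x"
      using D0[OF that] by (simp add: add_divide_distrib)
    finally show ?thesis .
  qed
  define f where "f x = 2 * poly u x * t' x / poly D x" for x
  have f_hol: "f holomorphic_on S'" unfolding f_def using D0 by (intro holomorphic_intros t'_hol) auto
  have pf\<Omega>: "pfam S' 1 \<Omega> f"
  proof -
    have "pfam S' 1 (\<lambda>n x. of_nat n * f x + poly K x / poly D x) f"
      by (intro pfam_affine f_hol holomorphic_intros) (use D0 in auto)
    thus ?thesis by (rule back_subst[of "\<lambda>F. pfam S' 1 F f"]) (auto simp: fun_eq_iff \<Omega>_def f_def add_divide_distrib)
  qed
  have pfzt: "pfam S' 1 zt a"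
    unfolding zt_def by (rule pfam_affine) (use a_hol \<psi>_hol sub holomorphic_on_subset in blast)+
  have pfzt': "pfam S' 1 zt' a'"
    unfolding zt'_def by (rule pfam_affine) (use a'_hol \<psi>'_hol sub holomorphic_on_subset in blast)+
  have pfw: "pfam S' 2 w (\<lambda>x. poly D x / 4 * a x ^ 2)"
  proof -
    have "pfam S' (0 + 2 * 1) (\<lambda>n x. poly D x / 4 * zt n x ^ 2) (\<lambda>x. poly D x / 4 * a x ^ 2)"
      by (intro pfam_mult pfam_power pfzt pfam_const holomorphic_intros) auto
    moreover have "0 + 2 * 1 = (2 :: nat)" by simp
    ultimately show ?thesis unfolding w_def[abs_def] by (simp only:)
  qed
  have pfw': "pfam S' 2 w' (\<lambda>x. poly t x * t' x / 2 * a x ^ 2 + poly D x / 2 * (a x * a' x))"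
  proof -
    have "pfam S' (0 + 2 * 1) (\<lambda>n x. poly t x * t' x / 2 * zt n x ^ 2) (\<lambda>x. poly t x * t' x / 2 * a x ^ 2)"
      by (intro pfam_mult pfam_power pfzt pfam_const holomorphic_intros t'_hol) auto
    moreover have "pfam S' (0 + (1 + 1)) (\<lambda>n x. poly D x / 2 * (zt n x * zt' n x)) (\<lambda>x. poly D x / 2 * (a x * a' x))"
      by (intro pfam_mult pfzt pfzt' pfam_const holomorphic_intros) auto
    ultimately have "pfam S' 2 (\<lambda>n x. poly t x * t' x / 2 * zt n x ^ 2 + poly D x / 2 * (zt n x * zt' n x))
       (\<lambda>x. poly t x * t' x / 2 * a x ^ 2 + poly D x / 2 * (a x * a' x))"
      by (intro pfam_add) (simp_all add: numeral_2_eq_2)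
    thus ?thesis by (rule back_subst[of "\<lambda>F. pfam S' 2 F _"]) (auto simp: fun_eq_iff w'_def field_simps)
  qed
  define G1 where "G1 n x = \<Omega> n x ^ m * (poly (pderiv u) x / poly u x)" for n x
  define qq where "qq x = poly t x * t' x / poly D x" for x
  \<comment> \<open>In \<open>(zt' + qq * zt)^m - zt'^m\<close> a factor \<open>zt\<close> cancels
    the denominator of \<open>zt' / zt\<close>. What is left over, \<open>zt'^(m+1) / zt\<close>, is
    holomorphic at \<open>z0\<close> and is absorbed by \<open>H\<close>.\<close>
  define G2 where "G2 n x = (- \<iota> * poly u x) ^ m * (zt' n x * (qq x *
     (\<Sum>i<m. (zt' n x + qq x * zt n x) ^ i * zt' n x ^ (m - 1 - i))))" for n x
  define G3 where "G3 k n x = g k * (\<Omega> n x ^ m * (w n x ^ k * w' n x))" for k n x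
  define top where "top x = f x ^ m * ((poly D x / 4 * a x ^ 2) ^ (m - 1) *
     (poly t x * t' x / 2 * a x ^ 2 + poly D x / 2 * (a x * a' x)))" for x
  have "pfam S' (3 * m) G1 (\<lambda>_. 0)"
  proof (rule pfam_raise)
    have "pfam S' (m * 1 + 0) G1 (\<lambda>x. f x ^ m * (poly (pderiv u) x / poly u x))"
      unfolding G1_def by (intro pfam_mult pfam_power pf\<Omega> pfam_const holomorphic_intros) (use u0 in auto)
    thus "pfam S' m G1 (\<lambda>x. f x ^ m * (poly (pderiv u) x / poly u x))" by simp
  qed (use m in simp)
  moreover have "pfam S' (3 * m) G2 (\<lambda>_. 0)"
  proof -
    have qh: "qq holomorphic_on S'" unfolding qq_def using D0 by (intro holomorphic_intros t'_hol) auto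
    have pq: "pfam S' 1 (\<lambda>n x. zt' n x + qq x * zt n x) (\<lambda>x. a' x + qq x * a x)"
      using pfam_add[OF pfzt' pfam_mult[OF pfam_const[OF qh] pfzt, unfolded add_0_left]] .
    have "pfam S' (m - 1) (\<lambda>n x. (zt' n x + qq x * zt n x) ^ i * zt' n x ^ (m - 1 - i))
       (\<lambda>x. (a' x + qq x * a x) ^ i * a' x ^ (m - 1 - i))" if "i \<in> {..<m}" for i
      using pfam_mult[OF pfam_power[OF pq, of i] pfam_power[OF pfzt', of "m - 1 - i"]] that by simp
    hence "pfam S' (m - 1) (\<lambda>n x. \<Sum>i<m. (zt' n x + qq x * zt n x) ^ i * zt' n x ^ (m - 1 - i))
       (\<lambda>x. \<Sum>i<m. (a' x + qq x * a x) ^ i * a' x ^ (m - 1 - i))"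
      by (rule pfam_sum)
    hence "pfam S' (0 + (1 + (0 + (m - 1)))) G2 (\<lambda>x. (- \<iota> * poly u x) ^ m * (a' x * (qq x *
      (\<Sum>i<m. (a' x + qq x * a x) ^ i * a' x ^ (m - 1 - i)))))"
      unfolding G2_def by (intro pfam_mult pfzt' pfam_const qh holomorphic_intros)
    thus ?thesis by (rule pfam_raise) (use m in simp)
  qed
  moreover have "pfam S' (3 * m) (\<lambda>n x. \<Sum>k<m. G3 k n x) (\<lambda>x. \<Sum>k<m. if k = m - 1 then g k * top x else 0)"
  proof (rule pfam_sum)
    fix k assume k: "k \<in> {..<m}"
    \<comment> \<open>The degree in \<open>n\<close> is \<open>m\<close> from
      \<open>\<Omega>^m\<close>, \<open>2 k\<close> from \<open>w^k\<close> and \<open>2\<close>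
      from \<open>w'\<close>; only \<open>k = m - 1\<close> attains \<open>3 m\<close>.\<close>
    have p: "pfam S' (0 + (m * 1 + (k * 2 + 2))) (G3 k) (\<lambda>x. g k * (f x ^ m * ((poly D x / 4 * a x ^ 2) ^ k *
       (poly t x * t' x / 2 * a x ^ 2 + poly D x / 2 * (a x * a' x)))))"
      unfolding G3_def by (intro pfam_mult pfam_power pfw pfw' pf\<Omega> pfam_const holomorphic_intros)
    show "pfam S' (3 * m) (G3 k) (\<lambda>x. if k = m - 1 then g k * top x else 0)"
    proof (cases "k = m - 1")
      case True
      have "0 + (m * 1 + (k * 2 + 2)) = 3 * m" using m True by simp
      thus ?thesis using p True by (simp add: top_def)
    next
      case False
      thus ?thesis using pfam_raise[OF p, of "3 * m"] k by simp
    qed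
  qed
  ultimately have "pfam S' (3 * m) (\<lambda>n x. G1 n x + (G2 n x + (\<Sum>k<m. G3 k n x)))
      (\<lambda>x. 0 + (0 + (\<Sum>k<m. if k = m - 1 then g k * top x else 0)))"
    by (intro pfam_add)
  also have "(\<lambda>x. 0 + (0 + (\<Sum>k<m. if k = m - 1 then g k * top x else 0))) = (\<lambda>x. g (m - 1) * top x)"
    using m by (auto simp: fun_eq_iff)
  finally have pfG: "pfam (S - {z0}) (3 * m) (\<lambda>n x. G1 n x + (G2 n x + (\<Sum>k<m. G3 k n x))) (\<lambda>x. g (m - 1) * top x)"
    by (simp only: S'_def)
  obtain q where q: "degree q \<le> 3 * m" "coeff q (3 * m) = residue (\<lambda>x. g (m - 1) * top x) z0"
    "\<And>n. residue (\<lambda>x. G1 n x + (G2 n x + (\<Sum>k<m. G3 k n x))) z0 = poly q (of_nat n)"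
    by (rule pfam_residue[OF pfG S]) (rule that)
  show thesis
  proof (rule that[OF q(1)])
    assume t'z: "poly (pderiv t) z0 \<noteq> 0"
    show "coeff q (3 * m) = - of_real (zeta_nat (2 * m)) / of_real pi ^ (2 * m) * (poly u z0 * poly (pderiv t) z0 / 2) ^ m"
    proof -
      have top_eq: "g (m - 1) * top x * (x - z0) = g (m - 1) * ((2 * poly u x * t' x) ^ m *
          ((a x ^ 2 / 4) ^ (m - 1) * (\<iota> * t' x * a x))) / (poly D x / (x - z0))" if x: "x \<in> S'" for x
      proof -
        have xS: "x \<in> S" and xz: "x \<noteq> z0" using x by (auto simp: S'_def)
        \<comment> \<open>This is the derivative of \<open>D a^2 / 4\<close>. By
          \<open>a_ode\<close> it simplifies so that \<open>top\<close> keeps a single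
          \<open>D\<close> in the denominator, hence a simple pole when \<open>t'\<close> does not
          vanish at \<open>z0\<close>.\<close>
        have "poly t x * t' x / 2 * a x ^ 2 + poly D x / 2 * (a x * a' x) =
            a x / 2 * (poly D x * deriv a x + poly t x * poly (pderiv t) x * a x)"
          by (simp add: t'_def a'_def power2_eq_square algebra_simps)
        also have "\<dots> = \<iota> * t' x * a x" unfolding a_ode[OF xS] by (simp add: t'_def)
        finally have 1: "poly t x * t' x / 2 * a x ^ 2 + poly D x / 2 * (a x * a' x) = \<iota> * t' x * a x" .
        have 2: "f x ^ m * (poly D x / 4 * a x ^ 2) ^ (m - 1) =
            (2 * poly u x * t' x) ^ m * (a x ^ 2 / 4) ^ (m - 1) / poly D x"
        proof -
          obtain k where k: "m = Suc k" using m by (cases m) auto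
          have "f x ^ k * (poly D x / 4 * a x ^ 2) ^ k = (2 * poly u x * t' x) ^ k * (a x ^ 2 / 4) ^ k"
            unfolding power_mult_distrib[symmetric] f_def using D0[OF x] by (simp add: field_simps)
          thus ?thesis by (simp add: k f_def mult_ac)
        qed
        have "top x = (f x ^ m * (poly D x / 4 * a x ^ 2) ^ (m - 1)) * (\<iota> * t' x * a x)"
          unfolding top_def 1 by (simp add: mult.assoc)
        hence "top x = ((2 * poly u x * t' x) ^ m * ((a x ^ 2 / 4) ^ (m - 1) * (\<iota> * t' x * a x))) / poly D x"
          unfolding 2 by (simp only: times_divide_eq_left mult.assoc)
        thus ?thesis by (simp only: divide_divide_eq_right times_divide_eq_left times_divide_eq_right)
      qed
      have lim: "((\<lambda>x. g (m - 1) * top x * (x - z0)) \<longlongrightarrow> g (m - 1) * ((2 * poly u z0 * t' z0) ^ m *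
          ((a z0 ^ 2 / 4) ^ (m - 1) * (\<iota> * t' z0 * a z0))) / poly (pderiv D) z0) (at z0)"
      proof (rule Lim_transform_eventually)
        have c: "isCont a z0"
          using holomorphic_on_imp_continuous_on[OF a_hol] S by (simp add: continuous_on_eq_continuous_at)
        have "((\<lambda>x. poly D x / (x - z0)) \<longlongrightarrow> poly (pderiv D) z0) (at z0)"
          using poly_DERIV[of D z0] by (simp add: has_field_derivative_iff Dz)
        moreover have "poly (pderiv D) z0 \<noteq> 0" using t'z by (simp add: poly_D' tz tau2 \<iota>_def[symmetric] mult.assoc)
        ultimately show "((\<lambda>x. g (m - 1) * ((2 * poly u x * t' x) ^ m *
          ((a x ^ 2 / 4) ^ (m - 1) * (\<iota> * t' x * a x))) / (poly D x / (x - z0))) \<longlongrightarrow> g (m - 1) * ((2 * poly u z0 * t' z0) ^ m *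
          ((a z0 ^ 2 / 4) ^ (m - 1) * (\<iota> * t' z0 * a z0))) / poly (pderiv D) z0) (at z0)"
          using c unfolding t'_def by (intro tendsto_intros) (auto simp: isCont_def intro!: poly_isCont[unfolded isCont_def])
        have "\<forall>\<^sub>F x in at z0. x \<in> S'" unfolding S'_def using S by (intro eventually_at_in_open) auto
        thus "\<forall>\<^sub>F x in at z0. g (m - 1) * ((2 * poly u x * t' x) ^ m *
          ((a x ^ 2 / 4) ^ (m - 1) * (\<iota> * t' x * a x))) / (poly D x / (x - z0)) = g (m - 1) * top x * (x - z0)"
          by eventually_elim (simp only: top_eq)
      qed
      have hol: "(\<lambda>x. g (m - 1) * top x) holomorphic_on S - {z0}"
        unfolding top_def S'_def[symmetric]
        by (intro holomorphic_intros f_hol t'_hol holomorphic_on_subset[OF a_hol sub] holomorphic_on_subset[OF a'_hol sub]) auto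
      have "residue (\<lambda>x. g (m - 1) * top x) z0 = g (m - 1) * ((2 * poly u z0 * t' z0) ^ m *
          ((a z0 ^ 2 / 4) ^ (m - 1) * (\<iota> * t' z0 * a z0))) / poly (pderiv D) z0"
        by (rule residue_simple'[OF S hol lim])
      also have "a z0 = 1" by (simp add: a_def Dz asn(2))
      also have "poly (pderiv D) z0 = 4 * \<iota> * t' z0" by (simp add: poly_D' tz \<iota>_def t'_def)
      also have "g (m - 1) * ((2 * poly u z0 * t' z0) ^ m * ((1\<^sup>2 / 4) ^ (m - 1) * (\<iota> * t' z0 * 1))) / (4 * \<iota> * t' z0)
          = g (m - 1) * ((2 * poly u z0 * t' z0) ^ m * ((1 / 4) ^ (m - 1) * (1 / 4)))"
        using tau2(3) t'z by (simp add: t'_def)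
      also have "(1 / 4 :: complex) ^ (m - 1) * (1 / 4) = (1 / 4) ^ m" using m by (cases m) auto
      also have "(2 * poly u z0 * t' z0) ^ m * (1 / 4) ^ m = (poly u z0 * t' z0 / 2) ^ m"
        unfolding power_mult_distrib[symmetric] by (simp add: field_simps)
      finally show ?thesis unfolding q(2) gm t'_def .
    qed
  next
    fix n assume n: "n > 0" and nz: "poly (P n) z0 \<noteq> 0"
    obtain T where T: "open T" "z0 \<in> T" "T \<subseteq> S" "\<And>x. x \<in> T \<Longrightarrow> norm (w n x) < 1" "\<And>x. x \<in> T \<Longrightarrow> zt n x \<noteq> 0"
      "\<And>x. x \<in> T \<Longrightarrow> poly (pderiv (P n)) x / poly (P n) x = poly (pderiv u) x / poly u x +
       deriv (zt n) x / zt n x + deriv sinc (w n x) / sinc (w n x) * deriv (w n) x"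
      by (rule log_derivative_eq[OF n nz]) (rule that)
    \<comment> \<open>Everything without a pole at \<open>z0\<close>: the leftover of the
      \<open>zt' / zt\<close> term, and the tail of the expansion, where \<open>w^m\<close> has
      cancelled \<open>D^m\<close>.\<close>
    define H where "H x = (- \<iota> * poly u x) ^ m * (zt' n x ^ Suc m / zt n x) +
        (- \<iota> * poly u x * (poly D x * zt' n x + poly t x * t' x * zt n x) * zt n x ^ 2 / 4) ^ m * r (w n x) * w' n x" for x
    have zt'_hol: "zt' n holomorphic_on S" unfolding zt'_def by (intro holomorphic_intros a'_hol \<psi>'_hol)
    have w'_hol: "w' n holomorphic_on S" unfolding w'_def by (intro holomorphic_intros t'_hol zt_hol zt'_hol) auto
    have rw: "(\<lambda>x. r (w n x)) holomorphic_on T"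
    proof -
      have "w n ` T \<subseteq> ball 0 1" using T(4) by auto
      from holomorphic_on_compose_gen[OF holomorphic_on_subset[OF w_hol T(3)] r this] show ?thesis by (simp add: o_def)
    qed
    have H_hol: "H holomorphic_on T"
      unfolding H_def using T(5)
      by (intro holomorphic_intros t'_hol rw holomorphic_on_subset[OF zt'_hol T(3)] holomorphic_on_subset[OF zt_hol T(3)]
          holomorphic_on_subset[OF w'_hol T(3)]) auto
    have eq: "\<Omega> n x ^ m * (poly (pderiv (P n)) x / poly (P n) x) =
        (G1 n x + (G2 n x + (\<Sum>k<m. G3 k n x))) + H x" if x: "x \<in> T - {z0}" for x
    proof -
      have xS: "x \<in> S" and xS': "x \<in> S'" using x T(3) by (auto simp: S'_def)
      have zx: "zt n x \<noteq> 0" and wx: "norm (w n x) < 1" using x T(4,5) by auto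
      note D = D0[OF xS']
      have e2: "\<Omega> n x ^ m * (zt' n x / zt n x) = G2 n x + (- \<iota> * poly u x) ^ m * (zt' n x ^ Suc m / zt n x)"
      proof -
        have "(zt' n x + qq x * zt n x) ^ m - zt' n x ^ m =
          (qq x * zt n x) * (\<Sum>i<m. (zt' n x + qq x * zt n x) ^ i * zt' n x ^ (m - 1 - i))"
          using power_diff_sumr2[of "zt' n x + qq x * zt n x" m "zt' n x"] by (simp add: mult.commute)
        hence "(zt' n x + qq x * zt n x) ^ m * (zt' n x / zt n x) =
          (zt' n x ^ m + (qq x * zt n x) * (\<Sum>i<m. (zt' n x + qq x * zt n x) ^ i * zt' n x ^ (m - 1 - i))) * (zt' n x / zt n x)"
          by (simp only: diff_eq_eq add.commute)
        also have "\<dots> = zt' n x * (qq x * (\<Sum>i<m. (zt' n x + qq x * zt n x) ^ i * zt' n x ^ (m - 1 - i))) + zt' n x ^ Suc m / zt n x"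
          using zx by (simp add: field_simps)
        finally show ?thesis
          unfolding \<Omega>[OF xS'] qq_def[symmetric] power_mult_distrib[of "- \<iota> * poly u x"] mult.assoc[of "(- \<iota> * poly u x) ^ m"] G2_def
          by (simp only: distrib_left)
      qed
      have e3: "\<Omega> n x ^ m * (deriv sinc (w n x) / sinc (w n x) * w' n x) = (\<Sum>k<m. G3 k n x) +
          (- \<iota> * poly u x * (poly D x * zt' n x + poly t x * t' x * zt n x) * zt n x ^ 2 / 4) ^ m * r (w n x) * w' n x"
      proof -
        have "\<Omega> n x * w n x = - \<iota> * poly u x * (poly D x * zt' n x + poly t x * t' x * zt n x) * zt n x ^ 2 / 4"
        proof -
          define X where "X = zt' n x + poly t x * t' x / poly D x * zt n x"
          have "poly D x * X = poly D x * zt' n x + poly t x * t' x * zt n x"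
            using D by (simp add: X_def distrib_left)
          moreover have "\<Omega> n x * w n x = - \<iota> * poly u x * (poly D x * X) * zt n x ^ 2 / 4"
            unfolding \<Omega>[OF xS'] w_def X_def[symmetric] by (simp add: mult_ac)
          ultimately show ?thesis by simp
        qed
        hence "(- \<iota> * poly u x * (poly D x * zt' n x + poly t x * t' x * zt n x) * zt n x ^ 2 / 4) ^ m = \<Omega> n x ^ m * w n x ^ m"
          by (metis power_mult_distrib)
        moreover have "\<Omega> n x ^ m * ((\<Sum>k<m. g k * w n x ^ k) * w' n x) = (\<Sum>k<m. G3 k n x)"
          unfolding G3_def sum_distrib_left sum_distrib_right by (intro sum.cong refl) (simp add: mult_ac)
        ultimately show ?thesis unfolding gr[OF wx] distrib_left distrib_right by (simp only: mult.assoc)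
      qed
      have "\<Omega> n x ^ m * (poly (pderiv (P n)) x / poly (P n) x) = G1 n x + \<Omega> n x ^ m * (zt' n x / zt n x) +
          \<Omega> n x ^ m * (deriv sinc (w n x) / sinc (w n x) * w' n x)"
        using T(6)[of x] x by (simp add: dzt[OF xS] dw[OF xS] G1_def distrib_left)
      thus ?thesis unfolding e2 e3 H_def by simp
    qed
    have GT: "(\<lambda>x. G1 n x + (G2 n x + (\<Sum>k<m. G3 k n x))) holomorphic_on T - {z0}"
    proof -
      have sT: "T - {z0} \<subseteq> S'" using T(3) by (auto simp: S'_def)
      note h = holomorphic_on_subset[OF _ sT] and h' = holomorphic_on_subset[OF _ order.trans[OF sT sub]]
      have \<Omega>h: "\<Omega> n holomorphic_on S'" unfolding \<Omega>_def using D0 by (intro holomorphic_intros t'_hol) auto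
      have qh: "qq holomorphic_on S'" unfolding qq_def using D0 by (intro holomorphic_intros t'_hol) auto
      show ?thesis unfolding G1_def G2_def G3_def using u0 sT
        by (intro holomorphic_intros h[OF \<Omega>h] h[OF qh] h'[OF zt_hol] h'[OF zt'_hol] h'[OF w_hol] h'[OF w'_hol]) auto
    qed
    have ev: "\<forall>\<^sub>F x in at z0. x \<in> T - {z0}" using T by (intro eventually_at_in_open) auto
    have "residue (\<lambda>x. \<Omega> n x ^ m * (poly (pderiv (P n)) x / poly (P n) x)) z0 =
        residue (\<lambda>x. (G1 n x + (G2 n x + (\<Sum>k<m. G3 k n x))) + H x) z0"
      by (intro residue_cong refl eventually_mono[OF ev] eq)
    also have "\<dots> = residue (\<lambda>x. G1 n x + (G2 n x + (\<Sum>k<m. G3 k n x))) z0 + residue H z0"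
      by (rule residue_add[OF T(1,2) GT]) (rule holomorphic_on_subset[OF H_hol], auto)
    also have "residue H z0 = 0" by (rule residue_holo[OF T(1,2) H_hol])
    finally show "residue (\<lambda>x. ((2 * of_nat n * poly u x * poly (pderiv t) x + poly K x) / poly D x) ^ m *
         (poly (pderiv (P n)) x / poly (P n) x)) z0 = poly q (of_nat n)"
      unfolding q(3) \<Omega>_def t'_def by simp
  qed
qed

end

section \<open>The sign pattern of the signature polynomials\<close>

definition pat :: "int \<Rightarrow> int \<Rightarrow> nat \<Rightarrow> int" where
  "pat b d k = (if even (int k * b div d) then 1 else -1)"

lemma cpoly_sum: "cpoly (sum f X) = (\<Sum>x\<in>X. cpoly (f x))"
  by (induction X rule: infinite_finite_induct) (simp_all add: cpoly_add)

lemma cpoly_fund: "cpoly (fund e [:0, 1:] k) = fund e [:0, 1:] k"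
proof (induction k rule: induct_nat_012)
  case (ge2 k)
  have "cpoly (of_int (e (Suc k)) * [:0, 1:]) = of_int (e (Suc k)) * [:0, 1:]"
    by (simp add: of_int_poly map_poly_pCons)
  thus ?case using ge2 by (simp only: fund.simps cpoly_add cpoly_mult)
qed simp_all

lemma fibo_add: "fibo t (Suc (k + l)) = fibo t (Suc k) * fibo t (Suc l) + fibo t k * fibo t l"
  using fibo_shift[of "\<lambda>n. fibo t (n + l)" t k] by simp

lemma minus_Suc_div: "0 < d \<Longrightarrow> (- (y + 1)) div d = - 1 - y div (d :: int)"
proof -
  assume d: "0 < d"
  have "- (y + 1) = (- 1 - y div d) * d + (d - 1 - y mod d)"
    using mult_div_mod_eq[of d y] by (simp add: algebra_simps)
  moreover have "0 \<le> d - 1 - y mod d" "d - 1 - y mod d < d" using d pos_mod_bound[OF d, of y] pos_mod_sign[OF d, of y] by linarith+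
  ultimately show ?thesis by (metis add.commute div_mult_self1 div_pos_pos_trivial add_0 d less_numeral_extra(3))
qed

locale sl2 =
  fixes a b c d :: int
  assumes det: "a * d - b * c = 1" and odd_a: "odd a" and odd_d: "odd d" and even_b: "even b" and even_c: "even c"
    and b0: "0 \<le> b" and b_less: "b < d" and c0: "0 < c"
begin

lemma d0: "0 < d" using b0 b_less by simp

lemma coprime_bd: "coprime b d"
proof (rule coprimeI)
  fix x assume "x dvd b" "x dvd d"
  hence "x dvd a * d - b * c" by simp
  thus "x dvd 1" by (simp add: det)
qed

lemma coprime_cd: "coprime c d"
proof (rule coprimeI)
  fix x assume "x dvd c" "x dvd d"
  hence "x dvd a * d - b * c" by simp
  thus "x dvd 1" by (simp add: det)
qed

sublocale pattern "pat b d" "nat c" "nat d"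
proof
  show "odd (nat d)" "even (nat c)" "0 < nat c" using odd_d even_c c0 d0 by (auto simp: even_nat_iff)
  show "pat b d k = 1 \<or> pat b d k = - 1" for k by (simp add: pat_def)
  show "pat b d 0 = 1" by (simp add: pat_def)
  show "pat b d (k + nat d) = pat b d k" for k
  proof -
    have "int (k + nat d) * b = int k * b + b * d" using d0 by (simp add: algebra_simps)
    hence "int (k + nat d) * b div d = int k * b div d + b" using d0 by simp
    thus ?thesis using even_b by (simp add: pat_def)
  qed
  show "pat b d (nat d - k) = - pat b d k" if k: "0 < k" "k < nat d" for k
  proof -
    have nd: "\<not> d dvd int k * b"
    proof
      assume "d dvd int k * b"
      hence "d dvd int k" using coprime_bd by (simp add: coprime_dvd_mult_left_iff coprime_commute)
      thus False using k zdvd_imp_le[of d "int k"] by simp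
    qed
    have "int (nat d - k) * b = - (int k * b) + b * d" using k d0 by (simp add: of_nat_diff algebra_simps)
    hence "int (nat d - k) * b div d = b + - (int k * b) div d" using d0 by (simp only: div_mult_self1)
    also have "- (int k * b) div d = - 1 - (int k * b) div d" using nd d0 by (subst zdiv_zminus1_eq_if) (auto simp: dvd_eq_mod_eq_0)
    finally show ?thesis using even_b by (simp add: pat_def)
  qed
  show "pat b d (nat c + n * nat d - k) = pat b d k" if k: "0 < k" "k < nat c + n * nat d" for k n
  proof -
    \<comment> \<open>From \<open>c b = a d - 1\<close>. The floor becomes
      \<open>a - 1 + n b - floor(k b / d)\<close>, and \<open>a - 1 + n b\<close> is even.\<close>
    have "int (nat c + n * nat d - k) * b = - (int k * b + 1) + (a + int n * b) * d"
      using k c0 d0 det by (simp add: of_nat_diff algebra_simps)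
    hence "int (nat c + n * nat d - k) * b div d = - (int k * b + 1) div d + (a + int n * b)" using d0
      by (simp add: add.commute)
    also have "\<dots> = a + int n * b - 1 - int k * b div d" using minus_Suc_div[OF d0, of "int k * b"] by simp
    finally show ?thesis using even_b odd_a by (simp add: pat_def)
  qed
qed

text \<open>The fractions \<open>q_n / p_n\<close> and \<open>b / d\<close> differ by exactly
  \<open>1 / (d p_n)\<close>, so for \<open>k < p_n\<close> their multiples by \<open>k\<close>
  differ by less than \<open>1 / d\<close> and have the same floor.\<close>

lemma sgn_eps_eq:
  assumes "int k < c + d * int n"
  shows "sgn_eps (a + b * int n) (c + d * int n) k = pat b d k"
proof -
  let ?p = "c + d * int n" and ?q = "a + b * int n"
  have p0: "0 < ?p" using c0 d0 by (simp add: add_pos_nonneg)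
  define y r where "y = int k * b div d" and "r = int k * b mod d"
  have r: "0 \<le> r" "r < d" "int k * b = y * d + r" using d0 by (simp_all add: y_def r_def)
  have "?q * d = 1 + b * ?p" using det by (simp add: algebra_simps)
  hence "int k * ?q * d = int k * (1 + b * ?p)" by (simp only: mult.assoc)
  hence "int k * ?q * d = int k + (int k * b) * ?p" by (simp add: algebra_simps)
  hence e: "(int k * ?q - y * ?p) * d = int k + r * ?p" unfolding r(3) by (simp add: algebra_simps)
  have "r * ?p \<le> (d - 1) * ?p" using r p0 by (intro mult_right_mono) auto
  hence "(int k * ?q - y * ?p) * d < ?p * d" unfolding e using assms by (simp add: algebra_simps)
  hence l: "int k * ?q - y * ?p < ?p" using d0 by simp
  have "0 \<le> (int k * ?q - y * ?p) * d" unfolding e using r p0 by simp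
  hence g: "0 \<le> int k * ?q - y * ?p" using d0 by (simp add: zero_le_mult_iff)
  have "int k * ?q = (int k * ?q - y * ?p) + y * ?p" by simp
  hence "int k * ?q div ?p = ((int k * ?q - y * ?p) + y * ?p) div ?p" by simp
  also have "\<dots> = y + (int k * ?q - y * ?p) div ?p" using p0 by (intro div_mult_self1) simp
  also have "(int k * ?q - y * ?p) div ?p = 0" by (rule div_pos_pos_trivial[OF g l])
  finally have "int k * ?q div ?p = y" by simp
  moreover have "\<lfloor>real k * of_int ?q / of_int ?p\<rfloor> = int k * ?q div ?p"
    using floor_divide_of_int_eq[of "int k * ?q" ?p, where 'a = real] by simp
  moreover have "0 \<le> y" unfolding y_def using b0 d0 by (simp add: pos_imp_zdiv_nonneg_iff)
  ultimately show ?thesis by (simp add: sgn_eps_def pat_def y_def[symmetric] even_nat_iff)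
qed

abbreviation R :: "nat \<Rightarrow> complex poly" where "R \<equiv> fund (pat b d) [:0, 1:]"

lemma sgn_P_eq:
  assumes "int k < c + d * int n"
  shows "map_poly of_int (sgn_P (a + b * int n) (c + d * int n) k) = R (Suc k)"
  using assms
proof (induction k rule: induct_nat_012)
  case 1
  have "sgn_eps (a + b * int n) (c + d * int n) 1 = pat b d 1" by (rule sgn_eps_eq) (use 1 in simp)
  thus ?case by (simp add: map_poly_pCons of_int_poly)
next
  case (ge2 k)
  have "sgn_eps (a + b * int n) (c + d * int n) (Suc (Suc k)) = pat b d (Suc (Suc k))" by (rule sgn_eps_eq[OF ge2.prems])
  hence "map_poly of_int (sgn_P (a + b * int n) (c + d * int n) (Suc (Suc k))) =
      [:0, of_int (pat b d (Suc (Suc k))):] * R (Suc (Suc k)) + R (Suc k)"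
    using ge2 by (simp only: sgn_P.simps cpoly_add cpoly_mult) (simp add: map_poly_pCons)
  thus ?case by (simp only: fund.simps) (simp add: of_int_poly)
qed simp

lemma fund_deriv_rec:
  "pderiv (R (Suc (Suc k))) = of_int (pat b d (Suc k)) * (R (Suc k) + [:0, 1:] * pderiv (R (Suc k))) + pderiv (R k)"
  by (simp add: pderiv_add pderiv_mult pderiv_pCons pderiv_smult of_int_poly algebra_simps)

text \<open>The confluent Christoffel-Darboux identity \<open>sol_deriv_sum\<close>, applied to the
  solution and its derivative in \<open>X\<close>; the overall sign is \<open>1\<close> because
  \<open>N\<close> is odd. At a root of \<open>R N\<close> only the second product survives.\<close>

lemma sgn_Omega_eq:
  assumes n: "odd n" and N: "N = nat c + n * nat d"
  shows "map_poly of_int (sgn_Omega (a + b * int n) (c + d * int n)) =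
    pderiv (R (N - 1)) * R N - pderiv (R N) * R (N - 1)"
proof -
  let ?p = "c + d * int n" and ?q = "a + b * int n"
  have p: "nat ?p = N" "int N = ?p" using c0 d0 N by (simp_all add: nat_add_distrib nat_mult_distrib mult.commute)
  have N2: "N \<ge> 2" "even (N - 1)" "N = Suc (N - 1)"
  proof -
    have "odd N" using N n odd_d even_c c0 d0 by (simp add: even_nat_iff)
    moreover have "nat c \<noteq> 0" using c0 by simp
    moreover have "nat c \<noteq> 1" using even_c by auto
    hence "nat c \<ge> 2" using \<open>nat c \<noteq> 0\<close> by linarith
    ultimately show "N \<ge> 2" "even (N - 1)" "N = Suc (N - 1)" using N by auto
  qed
  have "map_poly of_int (sgn_Omega ?q ?p) =
      (\<Sum>k = 0..N - 2. map_poly of_int (smult ((-1) ^ k * sgn_eps ?q ?p (Suc k)) (sgn_P ?q ?p k ^ 2)) :: complex poly)"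
    unfolding sgn_Omega_def p(1) by (rule cpoly_sum)
  also have "\<dots> = (\<Sum>k = 0..N - 2. (-1) ^ k * of_int (pat b d (Suc k)) * R (Suc k) ^ 2)"
  proof (intro sum.cong refl)
    fix k assume "k \<in> {0..N - 2}"
    hence k: "int (Suc k) < ?p" using N2 unfolding p(2)[symmetric] by auto
    have 1: "sgn_eps ?q ?p (Suc k) = pat b d (Suc k)" by (rule sgn_eps_eq[OF k])
    have 2: "map_poly of_int (sgn_P ?q ?p k) = R (Suc k)" by (rule sgn_P_eq) (use k in simp)
    have 3: "map_poly of_int (smult z f) = smult (of_int z) (map_poly of_int f :: complex poly)" for z f
      by (rule poly_eqI) (simp add: coeff_map_poly)
    have "map_poly of_int (smult ((-1) ^ k * sgn_eps ?q ?p (Suc k)) (sgn_P ?q ?p k ^ 2)) =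
        smult (of_int ((-1) ^ k * pat b d (Suc k))) (R (Suc k) ^ 2)"
      by (simp only: 3 1 power2_eq_square cpoly_mult 2)
    also have "\<dots> = of_int ((-1) ^ k * pat b d (Suc k)) * R (Suc k) ^ 2" by (simp only: of_int_poly) simp
    finally show "map_poly of_int (smult ((-1) ^ k * sgn_eps ?q ?p (Suc k)) (sgn_P ?q ?p k ^ 2)) =
        (-1) ^ k * of_int (pat b d (Suc k)) * R (Suc k) ^ 2" by simp
  qed
  also have "{0..N - 2} = {..<N - 1}" using N2 by auto
  also have "(\<Sum>k<N - 1. (-1) ^ k * of_int (pat b d (Suc k)) * R (Suc k) ^ 2) =
      (-1) ^ (N - 1) * (pderiv (R (N - 1)) * R (Suc (N - 1)) - pderiv (R (Suc (N - 1))) * R (N - 1))"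
    by (rule sol_deriv_sum[OF sol_fund fund_deriv_rec]) simp_all
  finally show ?thesis using N2 by simp
qed

lemma R_degree: "degree (R (Suc k)) = k \<and> (lead_coeff (R (Suc k)) = 1 \<or> lead_coeff (R (Suc k)) = -1)"
proof (induction k rule: less_induct)
  case (less k)
  show ?case
  proof (cases k)
    case (Suc j)
    have dj: "degree (R (Suc j)) = j" "lead_coeff (R (Suc j)) = 1 \<or> lead_coeff (R (Suc j)) = -1" using less[of j] Suc by auto
    have nz: "R (Suc j) \<noteq> 0" using dj(2) by auto
    define x where "x = of_int (pat b d (Suc j)) * [:0, 1:] * R (Suc j)"
    have x: "x = smult (of_int (pat b d (Suc j))) (pCons 0 (R (Suc j)))" by (simp add: x_def of_int_poly)
    have e: "pat b d (Suc j) = 1 \<or> pat b d (Suc j) = -1" by (rule unit)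
    have dx: "degree x = Suc j" using e nz dj by (auto simp: x)
    have lx: "lead_coeff x = 1 \<or> lead_coeff x = -1" unfolding dx using e dj by (auto simp: x)
    have "degree (R j) < Suc j \<or> R j = 0" using less[of "j - 1"] Suc by (cases j) auto
    hence "degree (R j) < degree x" using dx by auto
    moreover have "R (Suc k) = x + R j" by (simp add: Suc x_def)
    ultimately show ?thesis using dx lx Suc
      by (metis add.commute degree_add_eq_right lead_coeff_add_le)
  qed simp
qed

lemma R_int: "coeff (R k) i \<in> \<int>"
  unfolding cpoly_fund[symmetric] by (simp add: coeff_map_poly)

lemma poly_fund: "poly (fund e [:0, 1:] k) x = fund e x k"
  by (induction k rule: induct_nat_012) (simp_all add: of_int_poly)

end

section \<open>Reduction of the recurrence modulo the dyadic place\<close>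

context dyadic_place
begin

lemma Ints_A: "x \<in> \<int> \<Longrightarrow> x \<in> A"
  by (auto elim!: Ints_cases intro: A_intros)

lemma fibo_A: "z \<in> A \<Longrightarrow> fibo z k \<in> A"
  by (induction k rule: induct_nat_012) (auto intro: A_intros)

text \<open>Since \<open>2\<close> lies in \<open>M\<close>, the signs \<open>1\<close> and
  \<open>-1\<close> agree modulo \<open>M\<close>, and the recurrence becomes the Fibonacci
  recurrence.\<close>

lemma fund_fibo_M:
  assumes z: "z \<in> A" and e: "\<And>k. e k = 1 \<or> e k = (-1 :: int)"
  shows "fund e z k - fibo z k \<in> M"
proof (induction k rule: induct_nat_012)
  case (ge2 k)
  have "fund e z (Suc (Suc k)) - fibo z (Suc (Suc k)) =
      of_int (e (Suc k)) * z * (fund e z (Suc k) - fibo z (Suc k)) + (fund e z k - fibo z k)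
      + (of_int (e (Suc k)) - 1) * z * fibo z (Suc k)"
    by (simp add: algebra_simps)
  moreover have "(of_int (e (Suc k)) - 1) * z * fibo z (Suc k) \<in> M"
  proof (cases "e (Suc k) = 1")
    case False
    hence "(of_int (e (Suc k)) - 1) * z * fibo z (Suc k) = (- z * fibo z (Suc k)) * 2" using e[of "Suc k"] by simp
    thus ?thesis using M_ideal(2)[OF M_ideal(7)] z fibo_A[OF z] A_intros by metis
  qed (simp add: M_ideal)
  moreover have "of_int (e (Suc k)) * z * (fund e z (Suc k) - fibo z (Suc k)) \<in> M"
    using ge2(2) z by (intro M_ideal A_intros) auto
  ultimately show ?case using ge2(1) by (simp only: M_ideal(1))
qed (use M_ideal in auto)

lemma fibo_consecutive:
  assumes z: "z \<in> A" and "fibo z k \<in> M" "fibo z (Suc k) \<in> M"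
  shows False
  using assms(2,3)
proof (induction k)
  case 0
  thus ?case using M_ideal(6) by simp
next
  case (Suc k)
  have "fibo z k = fibo z (Suc (Suc k)) - z * fibo z (Suc k)" by simp
  hence "fibo z k \<in> M" using Suc.prems M_minus M_ideal(2) z by metis
  thus ?case using Suc by blast
qed

text \<open>Euclid's algorithm on the indices: by \<open>fibo_add\<close>, a common zero modulo
  \<open>M\<close> of the terms \<open>k\<close> and \<open>l\<close> is one of the terms
  \<open>k - l\<close> and \<open>l\<close>, as neighbouring terms never vanish together.\<close>

lemma fibo_coprime:
  assumes z: "z \<in> A" and "coprime k l" "fibo z k \<in> M" "fibo z l \<in> M"
  shows False
  using assms(2-)
proof (induction "k + l" arbitrary: k l rule: less_induct)
  case less
  have step: False if kl: "l \<le> k" "coprime k l" "fibo z k \<in> M" "fibo z l \<in> M"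
    and IH: "\<And>k' l'. k' + l' < k + l \<Longrightarrow> coprime k' l' \<Longrightarrow> fibo z k' \<in> M \<Longrightarrow> fibo z l' \<in> M \<Longrightarrow> False" for k l
  proof (cases l)
    case 0
    hence "k = 1" using kl(2) by simp
    thus False using kl(3) M_ideal(6) by simp
  next
    case (Suc j)
    have k: "k = Suc ((k - l) + j)" using kl(1) Suc by simp
    have "fibo z k = fibo z (Suc (k - l)) * fibo z (Suc j) + fibo z (k - l) * fibo z j"
      by (subst k) (rule fibo_add)
    hence "fibo z (k - l) * fibo z j = fibo z k - fibo z (Suc (k - l)) * fibo z l" using Suc by simp
    hence "fibo z (k - l) * fibo z j \<in> M" using kl(3,4) M_minus M_ideal(2) fibo_A[OF z] by metis
    hence "fibo z (k - l) \<in> M \<or> fibo z j \<in> M" using M_prime fibo_A[OF z] by blast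
    thus False
    proof
      assume "fibo z (k - l) \<in> M"
      moreover have "coprime (k - l) l" using kl(1,2) by (metis coprime_diff_one_left_nat coprime_iff_gcd_eq_1 gcd_diff1_nat)
      ultimately show False using IH[of "k - l" l] kl Suc by auto
    next
      assume "fibo z j \<in> M"
      thus False using fibo_consecutive[OF z] kl(4) Suc by blast
    qed
  qed
  show False
  proof (cases "l \<le> k")
    case True
    thus ?thesis using step[OF True less.prems] less.hyps by blast
  next
    case False
    thus ?thesis using step[of k l] less.prems less.hyps by (metis add.commute coprime_commute nat_le_linear)
  qed
qed

lemma fibo_odd_M:
  assumes "z \<in> M" "odd k"
  shows "fibo z k - 1 \<in> M"
proof -
  have "fibo z (Suc (2 * j)) - 1 \<in> M" for j
  proof (induction j)
    case (Suc j)
    have zA: "z \<in> A" using assms M_ideal(5) by auto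
    have "fibo z (Suc (2 * Suc j)) - 1 = fibo z (Suc (Suc (2 * j))) * z + (fibo z (Suc (2 * j)) - 1)" by simp
    thus ?case using Suc M_ideal(1)[OF M_ideal(2)[OF assms(1) fibo_A[OF zA]]] by metis
  qed (simp add: M_ideal)
  thus ?thesis using assms(2) by (auto elim!: oddE)
qed

end

context sl2
begin

text \<open>At a root of \<open>R N\<close> the Fibonacci term \<open>N\<close> vanishes modulo
  \<open>M\<close>, so the term \<open>d\<close> does not, \<open>N\<close> and \<open>d\<close>
  being coprime. Also \<open>z\<close> is not in \<open>M\<close>, because for odd \<open>N\<close>
  the Fibonacci term at \<open>0\<close> is \<open>1\<close>. Hence \<open>T(z)^2\<close> is a unit,
  whereas \<open>4\<close> is not.\<close>

lemma R_root_units: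
  fixes z :: complex
  assumes n: "odd n" and z: "fund (pat b d) z (nat c + n * nat d) = 0"
  shows "fund (pat b d) z (nat d) \<noteq> 0" "(z * fund (pat b d) z (nat d)) ^ 2 + 4 \<noteq> 0"
proof -
  obtain A where "dyadic_place A" by (rule dyadic_place_exists)
  then interpret dyadic_place A .
  define N where "N = nat c + n * nat d"
  have N: "odd N" unfolding N_def using n odd_d even_c c0 d0 by (simp add: even_nat_iff)
  obtain k where k: "N = Suc k" using N by (cases N) auto
  have zA: "z \<in> A"
    by (rule root_in_A[of "R N"]) (use R_int Ints_A R_degree[of k] z in \<open>auto simp: poly_fund N_def[symmetric] k\<close>)
  have f: "fund (pat b d) z k - fibo z k \<in> M" for k by (rule fund_fibo_M[OF zA]) (rule unit)
  have fN: "fibo z N \<in> M" using M_ideal(4)[OF f[of N]] z by (simp add: N_def)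
  have "coprime N (nat d)"
  proof -
    have "coprime (nat c) (nat d)" using coprime_cd c0 d0 by (simp add: coprime_int_iff[symmetric])
    thus ?thesis unfolding N_def by (metis add.commute coprime_iff_gcd_eq_1 gcd_add_mult gcd.commute mult.commute)
  qed
  hence "fibo z (nat d) \<notin> M" using fibo_coprime[OF zA _ fN] by blast
  hence u: "fund (pat b d) z (nat d) \<notin> M" using M_minus[OF _ f[of "nat d"]] by fastforce
  thus "fund (pat b d) z (nat d) \<noteq> 0" using M_ideal(3) by auto
  have zM: "z \<notin> M"
  proof
    assume zM: "z \<in> M"
    have "1 \<in> M" using M_minus[OF fN fibo_odd_M[OF zM N]] by simp
    thus False using M_ideal(6) by simp
  qed
  have uA: "fund (pat b d) z (nat d) \<in> A"
    using f[of "nat d"] fibo_A[OF zA] A_intros(5) M_ideal(5) by (metis diff_add_cancel subsetD)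
  have "z * fund (pat b d) z (nat d) \<notin> M" using M_prime[OF zA uA] zM u by blast
  hence "(z * fund (pat b d) z (nat d)) ^ 2 \<notin> M" using M_power A_intros(6)[OF zA uA] by blast
  moreover have "- (4 :: complex) \<in> M" using M_ideal(2)[OF M_ideal(7), of "-2"] A_intros by simp
  ultimately show "(z * fund (pat b d) z (nat d)) ^ 2 + 4 \<noteq> 0" by (metis add_eq_0_iff2)
qed

end

section \<open>The signature as a polynomial\<close>

lemma sum_proots:
  fixes p :: "complex poly"
  assumes "p \<noteq> 0"
  shows "(\<Sum>z\<in>#proots p. f z) = (\<Sum>z | poly p z = 0. of_nat (order z p) * (f z :: complex))"
proof -
  have *: "(\<Sum>z\<in>#A. f z) = (\<Sum>z\<in>set_mset A. of_nat (count A z) * f z)" for A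
  proof (induction A)
    case (add x A)
    have "(\<Sum>z\<in>set_mset (add_mset x A). of_nat (count (add_mset x A) z) * f z) =
        (\<Sum>z\<in>insert x (set_mset A). (if z = x then f z else 0) + of_nat (count A z) * f z)"
      by (intro sum.cong) (auto simp: algebra_simps)
    also have "\<dots> = f x + (\<Sum>z\<in>insert x (set_mset A). of_nat (count A z) * f z)"
      by (simp add: sum.distrib)
    also have "(\<Sum>z\<in>insert x (set_mset A). of_nat (count A z) * f z) = (\<Sum>z\<in>set_mset A. of_nat (count A z) * f z)"
      by (intro sum.mono_neutral_right) (auto simp: not_in_iff)
    finally show ?case using add by simp
  qed simp
  show ?thesis unfolding * using assms by simp
qed

text \<open>The derivatives stay in the span of two neighbouring terms, at the price of the
  denominator \<open>t^2 + 4\<close>; this is how \<open>DD\<close> enters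
  \<open>Omega_at_root\<close>.\<close>

lemma fibo_pderiv:
  fixes t :: "complex poly"
  shows "(t ^ 2 + 4) * pderiv (fibo t (Suc k)) = pderiv t * (of_nat k * t * fibo t (Suc k) + 2 * of_nat (Suc k) * fibo t k)"
    "(t ^ 2 + 4) * pderiv (fibo t k) = pderiv t * (2 * of_nat k * fibo t (Suc k) - of_nat (Suc k) * t * fibo t k)"
proof (induction k)
  case (Suc k)
  case 1
  have "pderiv (fibo t (Suc (Suc k))) = pderiv t * fibo t (Suc k) + t * pderiv (fibo t (Suc k)) + pderiv (fibo t k)"
    by (simp add: pderiv_add pderiv_mult algebra_simps)
  hence "(t ^ 2 + 4) * pderiv (fibo t (Suc (Suc k))) = (t ^ 2 + 4) * (pderiv t * fibo t (Suc k)) +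
      t * ((t ^ 2 + 4) * pderiv (fibo t (Suc k))) + (t ^ 2 + 4) * pderiv (fibo t k)"
    by (simp add: algebra_simps)
  also have "\<dots> = pderiv t * (of_nat (Suc k) * t * fibo t (Suc (Suc k)) + 2 * of_nat (Suc (Suc k)) * fibo t (Suc k))"
    unfolding Suc.IH by (simp add: algebra_simps power2_eq_square)
  finally show ?case .
  case 2
  show ?case unfolding Suc.IH by (simp add: algebra_simps)
qed simp_all

section \<open>The polynomials \<open>T\<close>, \<open>U\<close>, \<open>K\<close> free of
  \<open>n\<close>, and the value of \<open>\<Omega>\<close> at the roots\<close>

context sl2
begin

abbreviation "X \<equiv> [:0, 1:] :: complex poly"
definition "U = R (nat d)"
definition "T = X * U"
definition "AA = R (nat c + nat d)"
definition "BB = R (nat c)"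
definition "A2 = R (nat c + nat d - 1)"
definition "B2 = R (nat c - 1)"
definition "VV = R (nat d - 1)"
definition "WW = cofund (pat b d) X (nat d - 1)"
definition "DD = T ^ 2 + 4"

lemma rels:
  "AA = (T + VV) * BB + U * B2" "BB = U * A2 + VV * AA" "A2 = (T + VV) * B2 + U * cofund (pat b d) X (nat c - 1)"
  "U * WW + VV ^ 2 = 1" "AA * B2 - A2 * BB = U" "AA ^ 2 - T * AA * BB - BB ^ 2 = U ^ 2"
  unfolding AA_def BB_def A2_def B2_def VV_def WW_def U_def T_def
  using A_eq[of X] B_eq[of X] A2_eq[of X] det_half[of X] A_B2[of X] gram[of X] by simp_all

lemma U_nz: "U \<noteq> 0"
proof -
  obtain k where "nat d = Suc k" using d0 by (cases "nat d") auto
  thus ?thesis using R_degree[of k] unfolding U_def by auto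
qed

text \<open>By \<open>u w + v^2 = 1\<close> the element \<open>v\<close> is invertible modulo
  \<open>U\<close>, so it is enough that \<open>U\<close> divides \<open>v\<close> times the
  numerator. That product is reduced with the derivative of the same identity and with the two
  expressions \<open>bw\<close> and \<open>a2\<close> for \<open>A2\<close>.\<close>

lemma numerator_dvd: "U dvd pderiv T * BB * (T * AA + 2 * BB) + DD * (AA * pderiv BB - pderiv AA * BB)"
proof -
  define r where "r = cofund (pat b d) X (nat c - 1)"
  define u u' v v' w w' B B' C C' where defs: "u = U" "u' = pderiv U" "v = VV" "v' = pderiv VV" "w = WW" "w' = pderiv WW"
    "B = BB" "B' = pderiv BB" "C = B2" "C' = pderiv B2"
  have t': "pderiv T = u + X * u'" by (simp add: T_def pderiv_mult pderiv_pCons defs)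
  have A: "AA = (X * u + v) * B + u * C" using rels(1) by (simp add: defs T_def)
  have A': "pderiv AA = (u + X * u' + v') * B + (X * u + v) * B' + (u' * C + u * C')"
    using arg_cong[OF rels(1), of pderiv] by (simp add: pderiv_add pderiv_mult t' defs T_def pderiv_pCons algebra_simps)
  have vv: "u * w + v ^ 2 = 1" using rels(4) by (simp add: defs)
  have vv': "2 * v * v' = - (u' * w) - u * w'"
    using arg_cong[OF vv, of pderiv] by (simp add: pderiv_add pderiv_mult defs power2_eq_square algebra_simps eq_neg_iff_add_eq_0)
  have a2: "A2 = (X * u + v) * C + u * r" using rels(3) by (simp add: defs T_def r_def)
  have "u * (B * (w - X * v)) = u * (A2 + v * C)"
  proof -
    have "B = u * A2 + v * AA" using rels(2) by (simp add: defs)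
    thus ?thesis unfolding A using vv by algebra
  qed
  hence bw: "B * (w - X * v) = A2 + v * C" using U_nz by (simp add: defs)
  define num where "num = (u + X * u') * B * ((X * u) * AA + 2 * B) + ((X * u) ^ 2 + 4) * (AA * B' - pderiv AA * B)"
  define s where "s = B ^ 2 * (X * u * v - 2) + X * u' * B ^ 2 * X * v - X ^ 2 * u * v' * B ^ 2 - X ^ 2 * u * u' * C * B
     + X * u * (u + X * u') * B * C + ((X * u) ^ 2 + 4) * (C * B' - C' * B)"
  define n0 where "n0 = - 2 * X * u' * B ^ 2 - 4 * v' * B ^ 2 - 4 * u' * B * C"
  have num: "num = u * s + n0" unfolding num_def s_def n0_def A' unfolding A by algebra
  have "v * n0 = - 2 * B * u' * (v * X * B - w * B + 2 * v * C) + 2 * u * w' * B ^ 2"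
    unfolding n0_def using vv' by algebra
  also have "v * X * B - w * B + 2 * v * C = - (u * (X * C + r))" using bw a2 by algebra
  finally have "v * n0 = u * (2 * B * u' * (X * C + r) + 2 * w' * B ^ 2)" by algebra
  hence "num = u * (w * num + v * (v * s + 2 * B * u' * (X * C + r) + 2 * w' * B ^ 2))"
    using num vv by algebra
  moreover have "pderiv T * BB * (T * AA + 2 * BB) + DD * (AA * pderiv BB - pderiv AA * BB) = num"
    unfolding num_def DD_def t' by (simp only: T_def defs)
  ultimately show ?thesis unfolding defs(1) by (metis dvd_triv_left)
qed

text \<open>The numerator of \<open>\<Omega>\<close> at a root of \<open>P_(p-1)\<close> is affine
  in \<open>n\<close>; this is its constant part, and the division is exact by
  \<open>numerator_dvd\<close>.\<close>

definition "KK = (pderiv T * BB * (T * AA + 2 * BB) + DD * (AA * pderiv BB - pderiv AA * BB)) div U"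

lemma U_KK: "U * KK = pderiv T * BB * (T * AA + 2 * BB) + DD * (AA * pderiv BB - pderiv AA * BB)"
  unfolding KK_def using numerator_dvd by simp

definition "QQ = 2 * AA - T * BB"

lemma QQ_square: "QQ ^ 2 = 4 * U ^ 2 + DD * BB ^ 2"
  unfolding QQ_def DD_def using rels(6) by algebra

text \<open>Multiplication by \<open>QQ\<close> lets the Gram identity and its derivative extract a
  further factor \<open>U\<close>. The outcome is the relation that \<open>parabolic_data\<close>
  asks for, and it also reveals the degree of \<open>KK\<close>.\<close>

lemma QQ_KK: "QQ * KK = 2 * T * pderiv T * BB * U + 2 * DD * (U * pderiv BB - pderiv U * BB)"
proof -
  define A' B' t' u' where d: "A' = pderiv AA" "B' = pderiv BB" "t' = pderiv T" "u' = pderiv U"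
  have g': "2 * AA * A' - (t' * AA * BB + T * A' * BB + T * AA * B') - 2 * BB * B' = 2 * U * u'"
  proof -
    have "pderiv (AA * AA - T * AA * BB - BB * BB) = pderiv (U * U)" using rels(6) by (simp only: power2_eq_square)
    thus ?thesis unfolding pderiv_diff pderiv_mult d by algebra
  qed
  have 1: "QQ * (AA * B' - A' * BB) = 2 * U ^ 2 * B' - BB * (2 * U * u' + t' * AA * BB)"
    unfolding QQ_def using rels(6) g' by algebra
  have 2: "QQ * (T * AA + 2 * BB) = 2 * T * U ^ 2 + DD * AA * BB"
    unfolding QQ_def DD_def using rels(6) by algebra
  have "U * (QQ * KK) = t' * BB * (QQ * (T * AA + 2 * BB)) + DD * (QQ * (AA * B' - A' * BB))"
    using arg_cong[OF U_KK, of "\<lambda>x. QQ * x"] unfolding d by (simp add: algebra_simps)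
  also have "\<dots> = U * (2 * T * t' * BB * U + 2 * DD * (U * B' - u' * BB))"
    unfolding 1 2 by (simp add: algebra_simps power2_eq_square)
  finally show ?thesis using U_nz by (simp add: d)
qed

lemma degrees:
  "degree U = nat d - 1" "degree T = nat d" "degree BB = nat c - 1" "degree AA = nat c + nat d - 1" "degree DD = 2 * nat d"
  "U \<noteq> 0" "T \<noteq> 0" "BB \<noteq> 0" "AA \<noteq> 0" "DD \<noteq> 0"
proof -
  have n: "nat d > 0" "nat c > 0" using d0 c0 by auto
  have R: "degree (R k) = k - 1" "R k \<noteq> 0" if "k > 0" for k
    using R_degree[of "k - 1"] that by (auto simp del: fund.simps)
  show 1: "degree U = nat d - 1" "degree BB = nat c - 1" "degree AA = nat c + nat d - 1" "BB \<noteq> 0" "AA \<noteq> 0"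
    using R n by (simp_all add: U_def BB_def AA_def)
  show "U \<noteq> 0" by (rule U_nz)
  thus 2: "degree T = nat d" "T \<noteq> 0" using 1 n by (simp_all add: T_def)
  have "degree (T ^ 2) = 2 * nat d" using 2 by (simp add: degree_power_eq)
  moreover have "degree (4 :: complex poly) < 2 * nat d" using n by (simp add: degree_numeral)
  ultimately show 3: "degree DD = 2 * nat d" unfolding DD_def by (simp add: degree_add_eq_left)
  show "DD \<noteq> 0" using 3 n by auto
qed

text \<open>In degree \<open>c + d - 1\<close> the coefficient is twice a sign minus a sign, which
  cannot vanish.\<close>

lemma degree_QQ: "degree QQ \<ge> nat c + nat d - 1" "QQ \<noteq> 0"
proof -
  have n: "nat d > 0" "nat c > 0" using d0 c0 by auto
  have R: "lead_coeff (R k) = 1 \<or> lead_coeff (R k) = -1" if "k > 0" for k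
    using R_degree that by (metis Suc_pred')
  let ?N = "nat c + nat d - 1"
  have la: "coeff AA ?N = 1 \<or> coeff AA ?N = -1" using R[of "nat c + nat d"] degrees n by (simp add: AA_def)
  have "lead_coeff (T * BB) = lead_coeff U * lead_coeff BB" by (simp add: T_def lead_coeff_mult)
  moreover have "degree (T * BB) = ?N"
  proof -
    have "degree (T * BB) = nat d + (nat c - 1)" using degrees by (simp add: degree_mult_eq)
    also have "\<dots> = ?N" using n by arith
    finally show ?thesis .
  qed
  moreover have "lead_coeff U = 1 \<or> lead_coeff U = -1" "lead_coeff BB = 1 \<or> lead_coeff BB = -1"
    using R n by (simp_all add: U_def BB_def)
  ultimately have lb: "coeff (T * BB) ?N = 1 \<or> coeff (T * BB) ?N = -1" by auto
  have "coeff QQ ?N = 2 * coeff AA ?N - coeff (T * BB) ?N"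
    unfolding QQ_def by (simp add: numeral_poly)
  hence "coeff QQ ?N \<noteq> 0" using la lb by auto
  thus "degree QQ \<ge> ?N" "QQ \<noteq> 0" by (auto intro: le_degree)
qed

text \<open>The top terms in the defining formula cancel, so it bounds the degree too weakly;
  comparing degrees in \<open>QQ_KK\<close> gives the bound needed for the decay of the
  integrand.\<close>

lemma degree_KK: "degree KK \<le> 2 * nat d - 2"
proof (cases "KK = 0")
  case False
  have n: "nat d > 0" "nat c \<ge> 2" using d0 c0 even_c by (auto elim!: evenE)
  have m2: "degree (2 * p) \<le> degree p" for p :: "complex poly"
    using degree_mult_le[of 2 p] by (simp add: degree_numeral)
  note dm = degree_mult_le
  have "degree (2 * T * pderiv T * BB * U) \<le> nat d + (nat d - 1) + (nat c - 1) + (nat d - 1)"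
  proof -
    have "degree (2 * T * pderiv T * BB * U) \<le> degree (2 * T) + degree (pderiv T) + degree BB + degree U"
      by (rule order.trans[OF dm] add_mono order.refl)+
    thus ?thesis using m2[of T] degree_pderiv[of T] degrees by simp
  qed
  hence 1: "degree (2 * T * pderiv T * BB * U) \<le> nat c + 3 * nat d - 3" using n by simp
  have e1: "degree (U * pderiv BB) \<le> nat c + nat d - 3"
  proof -
    have "degree (U * pderiv BB) \<le> (nat d - 1) + ((nat c - 1) - 1)"
      using dm[of U "pderiv BB"] degree_pderiv[of BB] degrees by simp
    also have "\<dots> = nat c + nat d - 3" using n by arith
    finally show ?thesis .
  qed
  have e2: "degree (pderiv U * BB) \<le> nat c + nat d - 3"
  \<comment> \<open>For \<open>d = 1\<close> the truncated difference \<open>d - 1 - 1\<close> would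
    spoil the bound, but then \<open>U\<close> is constant.\<close>
  proof (cases "nat d = 1")
    case True
    hence "degree U = 0" using degrees by simp
    hence "pderiv U = 0" by (simp add: pderiv_eq_0_iff)
    thus ?thesis by simp
  next
    case False
    hence "nat d \<ge> 2" using n by simp
    have "degree (pderiv U * BB) \<le> ((nat d - 1) - 1) + (nat c - 1)"
      using dm[of "pderiv U" BB] unfolding degree_pderiv degrees .
    also have "\<dots> = nat c + nat d - 3"
    proof -
      have "((x - 1) - 1) + (y - 1) = y + x - 3" if "x \<ge> 2" "y \<ge> 2" for x y :: nat using that by arith
      from this[OF \<open>nat d \<ge> 2\<close> n(2)] show ?thesis .
    qed
    finally show ?thesis .
  qed
  have "degree (2 * DD * (U * pderiv BB - pderiv U * BB)) \<le> 2 * nat d + (nat c + nat d - 3)"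
    using dm[of "2 * DD" "U * pderiv BB - pderiv U * BB"] m2[of DD] degree_diff_le[OF e1 e2] degrees(5) by linarith
  hence 2: "degree (2 * DD * (U * pderiv BB - pderiv U * BB)) \<le> nat c + 3 * nat d - 3" using n by simp
  have "degree (QQ * KK) \<le> nat c + 3 * nat d - 3" unfolding QQ_KK by (rule degree_add_le[OF 1 2])
  thus ?thesis using degree_QQ False n by (simp add: degree_mult_eq)
qed simp

lemma R_N_eq:
  assumes "n > 0"
  shows "R (nat c + n * nat d) = fibo T n * AA + fibo T (n - 1) * BB"
    "R (nat c + n * nat d - 1) = fibo T n * A2 + fibo T (n - 1) * B2"
proof -
  obtain k where k: "n = Suc k" using assms by (cases n) auto
  show "R (nat c + n * nat d) = fibo T n * AA + fibo T (n - 1) * BB"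
    using monodromy_fibo[OF sol_fund[of "pat b d" X], of "nat c" k] by (simp add: k AA_def BB_def T_def U_def)
  have "nat c - 1 + n * nat d = nat c + n * nat d - 1" "nat c - 1 + nat d = nat c + nat d - 1" using c0 by auto
  thus "R (nat c + n * nat d - 1) = fibo T n * A2 + fibo T (n - 1) * B2"
    using monodromy_fibo[OF sol_fund[of "pat b d" X], of "nat c - 1" k] by (simp add: k A2_def B2_def T_def U_def)
qed

text \<open>At a root, Cramer's rule with determinant \<open>A E - C B = u\<close> yields
  \<open>u F = - B p2\<close> and \<open>u F1 = A p2\<close>, where \<open>p2^2 = -1\<close>.
  Inserted into the derivative of \<open>P\<close>, these turn the terms growing with
  \<open>n\<close> into the Gram form, that is, into \<open>u^2\<close>.\<close>

lemma Omega_at_root: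
  assumes n: "odd n" and z: "poly (R (nat c + n * nat d)) z = 0"
  shows "- poly (pderiv (R (nat c + n * nat d))) z * poly (R (nat c + n * nat d - 1)) z =
    (2 * of_nat n * poly U z * poly (pderiv T) z + poly KK z) / poly DD z"
proof -
  obtain k where k: "n = Suc k" using n by (cases n) auto
  define P P2 where "P = R (nat c + n * nat d)" and "P2 = R (nat c + n * nat d - 1)"
  have P: "P = fibo T (Suc k) * AA + fibo T k * BB" "P2 = fibo T (Suc k) * A2 + fibo T k * B2"
    using R_N_eq[of n] by (simp_all add: P_def P2_def k)
  have sq: "poly P2 z ^ 2 = -1"
  proof -
    have "P * cofund (pat b d) X (nat c + n * nat d - 1) - P2 ^ 2 = 1"
      unfolding P_def P2_def by (rule fund_square[OF n])
    from arg_cong[OF this, of "\<lambda>p. poly p z"] have "- (poly P2 z ^ 2) = 1" using z by (simp add: P_def)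
    thus ?thesis by (simp add: minus_equation_iff)
  qed
  define F F1 A B A' B' u t t' p2 D C E where defs: "F = poly (fibo T (Suc k)) z" "F1 = poly (fibo T k) z"
    "A = poly AA z" "B = poly BB z" "A' = poly (pderiv AA) z" "B' = poly (pderiv BB) z" "u = poly U z"
    "t = poly T z" "t' = poly (pderiv T) z" "p2 = poly P2 z" "D = poly DD z" "C = poly A2 z" "E = poly B2 z"
  have units: "u \<noteq> 0" "D \<noteq> 0"
    using R_root_units[OF n, of z] z by (simp_all add: defs U_def DD_def T_def poly_fund)
  have uE: "A * E - C * B = u" using arg_cong[OF rels(5), of "\<lambda>p. poly p z"] by (simp add: defs)
  have gr: "A ^ 2 - t * A * B - B ^ 2 = u ^ 2" using arg_cong[OF rels(6), of "\<lambda>p. poly p z"] by (simp add: defs)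
  have p0: "F * A + F1 * B = 0" using z P(1) by (simp add: P_def defs)
  have p2: "p2 = F * C + F1 * E" using P(2) by (simp add: defs)
  have s: "p2 ^ 2 = -1" using sq by (simp add: defs)
  have "- B * p2 = F * (A * E - C * B) - E * (F * A + F1 * B)" unfolding p2 by (simp add: algebra_simps)
  hence uF1: "u * F = - B * p2" using p0 uE by simp
  have "A * p2 = F1 * (A * E - C * B) + C * (F * A + F1 * B)" unfolding p2 by (simp add: algebra_simps)
  hence uF2: "u * F1 = A * p2" using p0 uE by simp
  have dF: "D * poly (pderiv (fibo T (Suc k))) z = t' * (of_nat k * t * F + 2 * of_nat (Suc k) * F1)"
    "D * poly (pderiv (fibo T k)) z = t' * (2 * of_nat k * F - of_nat (Suc k) * t * F1)"
    using arg_cong[OF fibo_pderiv(1)[of T k], of "\<lambda>p. poly p z"] arg_cong[OF fibo_pderiv(2)[of T k], of "\<lambda>p. poly p z"]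
    by (simp_all add: defs DD_def of_nat_poly)
  have uK: "u * poly KK z = t' * B * (t * A + 2 * B) + D * (A * B' - A' * B)"
    using arg_cong[OF U_KK, of "\<lambda>p. poly p z"] by (simp add: defs)
  define G G1 \<kappa> where "G = poly (pderiv (fibo T (Suc k))) z" and "G1 = poly (pderiv (fibo T k)) z" and "\<kappa> = (of_nat k :: complex)"
  have dP: "poly (pderiv P) z = G * A + F * A' + G1 * B + F1 * B'"
    unfolding P(1) by (simp add: pderiv_add pderiv_mult defs G_def G1_def algebra_simps)
  have dF': "D * G = t' * (\<kappa> * t * F + 2 * (\<kappa> + 1) * F1)" "D * G1 = t' * (2 * \<kappa> * F - (\<kappa> + 1) * t * F1)"
    using dF by (simp_all add: G_def G1_def \<kappa>_def add.commute)
  have e1: "D * (G * A + F * A' + G1 * B + F1 * B') = t' * ((\<kappa> * t * F + 2 * (\<kappa> + 1) * F1) * A + (2 * \<kappa> * F - (\<kappa> + 1) * t * F1) * B) + D * (F * A' + F1 * B')"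
    using dF' by algebra
  have "u * (D * (G * A + F * A' + G1 * B + F1 * B')) =
      t' * ((\<kappa> * t * (u * F) + 2 * (\<kappa> + 1) * (u * F1)) * A + (2 * \<kappa> * (u * F) - (\<kappa> + 1) * t * (u * F1)) * B) + D * ((u * F) * A' + (u * F1) * B')"
    unfolding e1 by (simp add: algebra_simps)
  also have "\<dots> = p2 * (t' * (2 * (\<kappa> + 1) * (A ^ 2 - t * A * B - B ^ 2) + t * A * B + 2 * B ^ 2) + D * (A * B' - A' * B))"
    unfolding uF1 uF2 by (simp add: algebra_simps power2_eq_square)
  also have "\<dots> = p2 * (u * (2 * (\<kappa> + 1) * u * t' + poly KK z))"
    unfolding gr using uK by algebra
  finally have "u * (D * (G * A + F * A' + G1 * B + F1 * B') * p2) = u * (p2 ^ 2 * (2 * (\<kappa> + 1) * u * t' + poly KK z))"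
    by (simp add: power2_eq_square mult_ac)
  hence "D * (G * A + F * A' + G1 * B + F1 * B') * p2 = p2 ^ 2 * (2 * (\<kappa> + 1) * u * t' + poly KK z)"
    using units by simp
  hence "D * (- (G * A + F * A' + G1 * B + F1 * B') * p2) = 2 * (\<kappa> + 1) * u * t' + poly KK z"
    unfolding s by (simp only: mult_minus_left mult_minus_right mult_1_left minus_minus mult.assoc)
  hence "- poly (pderiv P) z * p2 = (2 * (\<kappa> + 1) * u * t' + poly KK z) / D"
    unfolding dP using units by (simp add: field_simps)
  moreover have "(of_nat n :: complex) = \<kappa> + 1" by (simp add: k \<kappa>_def)
  ultimately show ?thesis unfolding P_def[symmetric] P2_def[symmetric] defs by (simp only:)
qed

lemma signature_sum:
  assumes n: "odd n"
  shows "of_rat (signature (Suc m) (a + b * int n) (c + d * int n)) =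
    (\<Sum>z | poly (R (nat c + n * nat d)) z = 0. of_nat (order z (R (nat c + n * nat d))) *
      ((2 * of_nat n * poly U z * poly (pderiv T) z + poly KK z) / poly DD z) ^ m)"
proof -
  define N where "N = nat c + n * nat d"
  have N0: "N > 0" using c0 by (simp add: N_def)
  then obtain j where j: "N = Suc j" by (cases N) auto
  have nz: "R N \<noteq> 0" using R_degree[of j] by (auto simp: j)
  have p: "nat (c + d * int n) = N" "int N = c + d * int n"
    using c0 d0 by (simp_all add: N_def nat_add_distrib nat_mult_distrib mult.commute)
  have P: "map_poly of_int (sgn_P (a + b * int n) (c + d * int n) (nat (c + d * int n) - 1)) = R N"
    unfolding p(1) by (subst sgn_P_eq) (use p(2) N0 in \<open>auto simp: j\<close>)
  have pw: "map_poly of_rat (q ^ k) = (map_poly of_rat q ^ k :: complex poly)" for q k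
    by (induction k) (simp_all add: map_poly_of_rat_hom)
  have "of_rat (signature (Suc m) (a + b * int n) (c + d * int n)) =
      quot_trace (R N) (map_poly of_int (sgn_Omega (a + b * int n) (c + d * int n)) ^ m)"
    by (simp only: signature_def of_rat_quot_trace pw map_poly_of_rat_of_int P diff_Suc_1)
  also have "\<dots> = (\<Sum>z\<in>#proots (R N). poly (map_poly of_int (sgn_Omega (a + b * int n) (c + d * int n)) ^ m) z)"
    by (rule quot_trace_eq_sum_roots[OF nz])
  also have "\<dots> = (\<Sum>z | poly (R N) z = 0. of_nat (order z (R N)) *
      poly (map_poly of_int (sgn_Omega (a + b * int n) (c + d * int n)) ^ m) z)"
    by (rule sum_proots[OF nz])
  also have "\<dots> = (\<Sum>z | poly (R N) z = 0. of_nat (order z (R N)) *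
      ((2 * of_nat n * poly U z * poly (pderiv T) z + poly KK z) / poly DD z) ^ m)"
  proof (intro sum.cong refl)
    fix z assume "z \<in> {z. poly (R N) z = 0}"
    hence z: "poly (R N) z = 0" by simp
    have "poly (map_poly of_int (sgn_Omega (a + b * int n) (c + d * int n))) z = - poly (pderiv (R N)) z * poly (R (N - 1)) z"
      unfolding sgn_Omega_eq[OF n N_def] using z by simp
    also have "\<dots> = (2 * of_nat n * poly U z * poly (pderiv T) z + poly KK z) / poly DD z"
      using Omega_at_root[OF n] z by (simp add: N_def)
    finally show "of_nat (order z (R N)) * poly (map_poly of_int (sgn_Omega (a + b * int n) (c + d * int n)) ^ m) z =
        of_nat (order z (R N)) * ((2 * of_nat n * poly U z * poly (pderiv T) z + poly KK z) / poly DD z) ^ m"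
      by (simp add: poly_power)
  qed
  finally show ?thesis by (simp add: N_def)
qed

theorem signature_complex_poly:
  assumes m: "m > 0"
  obtains Q :: "complex poly" where "degree Q \<le> 3 * m"
    "\<And>n. odd n \<Longrightarrow> of_rat (signature (Suc m) (a + b * int n) (c + d * int n)) = poly Q (of_nat n)"
    "(\<And>z. poly DD z = 0 \<Longrightarrow> poly (pderiv T) z \<noteq> 0) \<Longrightarrow> coeff Q (3 * m) =
       of_real (zeta_nat (2 * m)) / of_real pi ^ (2 * m) * (\<Sum>z | poly DD z = 0. (poly U z * poly (pderiv T) z / 2) ^ m)"
proof -
  let ?Z = "{z. poly DD z = 0}"
  have fin: "finite ?Z" using degrees poly_roots_finite by blast
  let ?P = "\<lambda>n. R (nat c + n * nat d)"
  define h where "h n x = ((2 * of_nat n * poly U x * poly (pderiv T) x + poly KK x) / poly DD x) ^ m *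
         (poly (pderiv (?P n)) x / poly (?P n) x)" for n x
  define admissible where "admissible z q \<longleftrightarrow> degree q \<le> 3 * m \<and>
      (poly (pderiv T) z \<noteq> 0 \<longrightarrow> coeff q (3 * m) =
       - of_real (zeta_nat (2 * m)) / of_real pi ^ (2 * m) * (poly U z * poly (pderiv T) z / 2) ^ m) \<and>
      (\<forall>n. odd n \<longrightarrow> residue (h n) z = poly q (of_nat n))" for z q
  have nzP: "poly (?P n) z \<noteq> 0" if "odd n" "poly DD z = 0" for n z
    using R_root_units(2)[OF that(1), of z] that(2) by (auto simp: DD_def T_def U_def poly_fund)
  have ex: "\<exists>q. admissible z q" if z: "z \<in> ?Z" for z
  proof -
    have tz: "poly T z ^ 2 = -4" using z by (simp add: DD_def add_eq_0_iff2)
    have "(poly T z - 2 * \<i>) * (poly T z + 2 * \<i>) = 0" using tz by (simp add: algebra_simps power2_eq_square)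
    hence "poly T z = 2 * \<i> \<or> poly T z = - (2 * \<i>)" by (simp add: eq_neg_iff_add_eq_0)
    then obtain \<tau> :: complex where \<tau>: "\<tau> = 1 \<or> \<tau> = -1" "poly T z = 2 * \<i> * \<tau>"
      by (metis mult.right_neutral mult_minus_right)
    have uz: "poly U z \<noteq> 0" using tz by (auto simp: T_def)
    interpret parabolic_data T U AA BB KK \<tau> z
      by unfold_locales (use \<tau> uz QQ_KK QQ_square degrees in \<open>simp_all add: QQ_def DD_def\<close>)
    obtain q where q: "degree q \<le> 3 * m"
      "poly (pderiv T) z \<noteq> 0 \<Longrightarrow> coeff q (3 * m) =
         - of_real (zeta_nat (2 * m)) / of_real pi ^ (2 * m) * (poly U z * poly (pderiv T) z / 2) ^ m"
      "\<And>n. n > 0 \<Longrightarrow> poly (P n) z \<noteq> 0 \<Longrightarrow>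
         residue (\<lambda>x. ((2 * of_nat n * poly U x * poly (pderiv T) x + poly KK x) / poly D x) ^ m *
           (poly (pderiv (P n)) x / poly (P n) x)) z = poly q (of_nat n)"
      by (rule residue_polynomial[OF m]) (rule that)
    have "residue (h n) z = poly q (of_nat n)" if n: "odd n" for n
    proof -
      have n0: "n > 0" using n by (cases n) auto
      have Pn: "P n = ?P n" using R_N_eq(1)[OF n0] by (simp add: P_def)
      have "poly (P n) z \<noteq> 0" unfolding Pn by (rule nzP[OF n]) (use z in simp)
      from q(3)[OF n0 this] show ?thesis unfolding Pn h_def[abs_def] D_def DD_def .
    qed
    hence "admissible z q" unfolding admissible_def using q(1,2) by (intro conjI impI allI)
    thus ?thesis ..
  qed
  then obtain q where q: "\<And>z. z \<in> ?Z \<Longrightarrow> admissible z (q z)" by metis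
  define Q where "Q = - (\<Sum>z\<in>?Z. q z)"
  show thesis
  proof (rule that[of Q])
    show "degree Q \<le> 3 * m" unfolding Q_def degree_minus
      by (intro degree_sum_le fin) (use q in \<open>auto simp: admissible_def\<close>)
  next
    assume s: "\<And>z. poly DD z = 0 \<Longrightarrow> poly (pderiv T) z \<noteq> 0"
    have "coeff Q (3 * m) = - (\<Sum>z\<in>?Z. coeff (q z) (3 * m))" by (simp add: Q_def coeff_sum)
    also have "(\<Sum>z\<in>?Z. coeff (q z) (3 * m)) =
        (\<Sum>z\<in>?Z. - of_real (zeta_nat (2 * m)) / of_real pi ^ (2 * m) * (poly U z * poly (pderiv T) z / 2) ^ m)"
      by (intro sum.cong refl) (use q s in \<open>auto simp: admissible_def\<close>)
    finally show "coeff Q (3 * m) =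
       of_real (zeta_nat (2 * m)) / of_real pi ^ (2 * m) * (\<Sum>z | poly DD z = 0. (poly U z * poly (pderiv T) z / 2) ^ m)"
      by (simp add: sum_distrib_left sum_negf)
  next
    fix n :: nat assume n: "odd n"
    define N where "N = nat c + n * nat d"
    obtain j where j: "N = Suc j" using c0 by (cases N) (auto simp: N_def)
    have nz: "R N \<noteq> 0" "degree (R N) = N - 1" using R_degree[of j] by (auto simp: j)
    define Om where "Om = 2 * of_nat n * U * pderiv T + KK"
    have Om: "poly Om x = 2 * of_nat n * poly U x * poly (pderiv T) x + poly KK x" for x by (simp add: Om_def of_nat_poly)
    have d2: "nat d > 0" "N \<ge> 3"
    proof -
      show "nat d > 0" using d0 by simp
      have "n > 0" using n by (cases n) auto
      moreover have "nat c \<ge> 2" using c0 even_c by (auto elim!: evenE)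
      moreover have "n * nat d \<ge> 1 * 1" using \<open>n > 0\<close> \<open>nat d > 0\<close> by (intro mult_le_mono) auto
      ultimately show "N \<ge> 3" unfolding N_def by linarith
    qed
    have dOm: "degree Om \<le> 2 * nat d - 2" unfolding Om_def
    proof (rule degree_add_le[OF _ degree_KK])
      have "degree (2 * of_nat n * U * pderiv T) \<le> degree (2 * of_nat n * U) + degree (pderiv T)" by (rule degree_mult_le)
      also have "degree (2 * of_nat n * U) \<le> degree (2 * of_nat n :: complex poly) + degree U" by (rule degree_mult_le)
      also have "degree (2 * of_nat n :: complex poly) = 0"
        using degree_of_nat[of "2 * n"] by (simp only: of_nat_mult of_nat_numeral)
      finally have "degree (2 * of_nat n * U * pderiv T) \<le> 0 + (nat d - 1) + (nat d - 1)"
        unfolding degree_pderiv degrees by simp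
      thus "degree (2 * of_nat n * U * pderiv T) \<le> 2 * nat d - 2" using d2 by linarith
    qed
    have "degree (Om ^ m) \<le> m * (2 * nat d - 2)"
      by (rule order.trans[OF degree_power_le]) (use mult_le_mono1[OF dOm, of m] in \<open>simp only: mult.commute\<close>)
    hence "degree (Om ^ m * pderiv (R N)) \<le> m * (2 * nat d - 2) + (N - 2)"
      using degree_mult_le[of "Om ^ m" "pderiv (R N)"] unfolding degree_pderiv nz(2) by linarith
    moreover have "degree (DD ^ m * R N) = m * (2 * nat d) + (N - 1)"
    proof -
      have "DD ^ m \<noteq> 0" using degrees(10) by (rule power_not_zero)
      thus ?thesis unfolding degree_mult_eq[OF _ nz(1)] degree_power_eq[OF degrees(10)] degrees(5) nz(2)
        by (simp only: degree_mult_eq[OF _ nz(1)] degree_power_eq[OF degrees(10)] degrees(5) nz(2) not_False_eq_True)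
    qed
    moreover have "m * (2 * nat d - 2) + 2 \<le> m * (2 * nat d)"
    proof -
      have "m * 2 \<le> m * (2 * nat d)" by (rule mult_le_mono2) (use d2(1) in linarith)
      hence "m * (2 * nat d - 2) + m * 2 = m * (2 * nat d)" by (simp add: diff_mult_distrib2)
      thus ?thesis using m by simp
    qed
    \<comment> \<open>Each factor \<open>Om / DD\<close> decays with order at least \<open>2\<close>
      and the logarithmic derivative with order \<open>1\<close>, so there is no residue at
      infinity.\<close>
    ultimately have deg: "degree (Om ^ m * pderiv (R N)) + 2 \<le> degree (DD ^ m * R N)" using d2 by linarith
    have nzG: "DD ^ m * R N \<noteq> 0" using degrees(10) nz(1) by (simp only: no_zero_divisors power_not_zero not_False_eq_True)
    have hN: "h n = (\<lambda>x. poly (Om ^ m * pderiv (R N)) x / poly (DD ^ m * R N) x)"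
      by (simp add: fun_eq_iff h_def N_def[symmetric] Om poly_power power_divide)
    have "{z. poly (DD ^ m * R N) z = 0} = ?Z \<union> {z. poly (R N) z = 0}" using m by (auto simp: poly_power)
    moreover have "?Z \<inter> {z. poly (R N) z = 0} = {}" using nzP[OF n] by (auto simp: N_def)
    ultimately have "(\<Sum>z\<in>?Z. residue (h n) z) + (\<Sum>z | poly (R N) z = 0. residue (h n) z) = 0"
      using sum_residues_rational[OF nzG deg] fin poly_roots_finite[OF nz(1)]
      unfolding hN by (simp add: sum.union_disjoint)
    moreover have "(\<Sum>z\<in>?Z. residue (h n) z) = - poly Q (of_nat n)"
      using q n by (simp add: Q_def poly_sum admissible_def)
    moreover have "(\<Sum>z | poly (R N) z = 0. residue (h n) z) =
        of_rat (signature (Suc m) (a + b * int n) (c + d * int n))"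
      unfolding signature_sum[OF n] N_def[symmetric]
    proof (intro sum.cong refl)
      fix z assume z: "z \<in> {z. poly (R N) z = 0}"
      let ?f = "\<lambda>x. ((2 * of_nat n * poly U x * poly (pderiv T) x + poly KK x) / poly DD x) ^ m"
      have "poly DD z \<noteq> 0" using nzP[OF n, of z] z by (auto simp: N_def)
      moreover have "open (- ?Z)" using fin by (intro open_Compl finite_imp_closed)
      moreover have "?f holomorphic_on - ?Z" by (intro holomorphic_intros) auto
      ultimately show "residue (h n) z = of_nat (order z (R N)) * ?f z"
        using residue_log_derivative[OF nz(1), of ?f "- ?Z" z] by (simp add: h_def[abs_def] N_def)
    qed
    ultimately show "of_rat (signature (Suc m) (a + b * int n) (c + d * int n)) = poly Q (of_nat n)"
      by simp
  qed
qed

end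

section \<open>Duality at a parabolic point\<close>

lemma N_mat_nth:
  "N_mat k $ 1 $ 1 = smult (\<i> powi k) [:of_int k + 1, 1:]"
  "N_mat k $ 1 $ 2 = smult (\<i> powi k * inverse \<i>) [:of_int k, 1:]"
  "N_mat k $ 2 $ 1 = smult (\<i> powi k * inverse \<i>) [:of_int k, 1:]"
  "N_mat k $ 2 $ 2 = smult (\<i> powi k) [:1 - of_int k, -1:]"
  by (simp_all add: N_mat_def)

definition step :: "int \<Rightarrow> int \<Rightarrow> nat \<Rightarrow> complex poly ^ 2 ^ 2" where
  "step c d r = (if odd (Suc r) then N_mat (alpha c d (Suc r)) else cnj_mat (N_mat (alpha c d (Suc r))))"

text \<open>The value of the imaginary unit in step \<open>r + 1\<close>, where the factors
  alternate between \<open>N\<close> and its conjugate.\<close>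

definition om :: "nat \<Rightarrow> complex" where "om r = (if even r then \<i> else - \<i>)"

lemma om_square: "om r * om r = -1" "om (Suc r) = - om r" "om r \<noteq> 0"
  by (auto simp: om_def)

lemma step_nth:
  assumes k: "0 \<le> alpha c d (Suc r)"
  defines "w \<equiv> om r ^ nat (alpha c d (Suc r))"
  shows "step c d r $ 1 $ 1 = smult w [:of_int (alpha c d (Suc r)) + 1, 1:]"
    "step c d r $ 1 $ 2 = smult (- om r * w) [:of_int (alpha c d (Suc r)), 1:]"
    "step c d r $ 2 $ 1 = smult (- om r * w) [:of_int (alpha c d (Suc r)), 1:]"
    "step c d r $ 2 $ 2 = smult w [:1 - of_int (alpha c d (Suc r)), -1:]"
proof -
  have p: "\<i> powi alpha c d (Suc r) = \<i> ^ nat (alpha c d (Suc r))"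
    using k by (simp add: power_int_def)
  have m: "map_poly cnj (smult z [:x, y:]) = smult (cnj z) [:cnj x, cnj y:]" for x y z
    by (rule poly_eqI) (simp add: coeff_map_poly coeff_pCons split: nat.split)
  show "step c d r $ 1 $ 1 = smult w [:of_int (alpha c d (Suc r)) + 1, 1:]"
    "step c d r $ 1 $ 2 = smult (- om r * w) [:of_int (alpha c d (Suc r)), 1:]"
    "step c d r $ 2 $ 1 = smult (- om r * w) [:of_int (alpha c d (Suc r)), 1:]"
    "step c d r $ 2 $ 2 = smult w [:1 - of_int (alpha c d (Suc r)), -1:]"
    by (cases "even r"; simp only: step_def even_Suc if_True if_False not_True_eq_False not_False_eq_True
        cnj_mat_def vec_lambda_beta N_mat_nth p m w_def om_def complex_cnj_mult complex_cnj_power complex_cnj_i complex_cnj_add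
        complex_cnj_diff complex_cnj_of_int complex_cnj_one complex_cnj_minus complex_cnj_inverse; simp add: mult.commute)+
qed

lemma N_prod_Suc_nth:
  "N_prod c d (Suc r) $ i $ j = N_prod c d r $ i $ 1 * step c d r $ 1 $ j + N_prod c d r $ i $ 2 * step c d r $ 2 $ j"
  by (simp add: step_def matrix_matrix_mult_def sum_2)

context sl2
begin

lemma alpha_nonneg:
  assumes "0 < r" "int r \<le> d"
  shows "0 \<le> alpha c d r"
proof (cases "int r < d")
  case True
  have "(int r - 1) * c div d \<le> int r * c div d" using c0 d0 by (intro zdiv_mono1) (simp_all add: algebra_simps)
  thus ?thesis using True by (simp add: alpha_def floor_divide_of_int_eq del: of_int_mult)
next
  case False
  have "(d - 1) * c div d < c"
  proof -
    have "(d - 1) * c = - c + c * d" by (simp add: algebra_simps)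
    hence "(d - 1) * c div d = c + (- c) div d" using d0 by (simp only: div_mult_self1)
    moreover have "(- c) div d < 0" using c0 d0 by (intro div_neg_pos_less0) auto
    ultimately show ?thesis by simp
  qed
  thus ?thesis using False by (simp add: alpha_def floor_divide_of_int_eq del: of_int_mult)
qed

text \<open>The representative of \<open>- r c\<close> modulo \<open>d\<close> in
  \<open>{1..d}\<close>, except that at \<open>r = d\<close> it is \<open>0\<close> and not
  \<open>d\<close>. This exception corresponds to the extra \<open>-1\<close> in the last
  \<open>alpha\<close>.\<close>

definition mm :: "nat \<Rightarrow> nat" where
  "mm r = (if int r < d then nat (d - (int r * c) mod d) else 0)"

lemma int_mm: "int r < d \<Longrightarrow> int (mm r) = d - (int r * c) mod d"
  using pos_mod_bound[OF d0, of "int r * c"] by (simp add: mm_def less_imp_le)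

lemma mm_le: "mm r \<le> nat d"
proof (cases "int r < d")
  case True
  thus ?thesis using int_mm[of r] pos_mod_sign[OF d0, of "int r * c"] by linarith
qed (simp add: mm_def)

text \<open>So \<open>alpha\<close> counts the full periods between \<open>mm r\<close> and the
  reflected index \<open>c + mm (Suc r)\<close>.\<close>

lemma mm_step:
  assumes "int (Suc r) \<le> d"
  shows "nat c + mm (Suc r) = mm r + nat (alpha c d (Suc r)) * nat d"
proof -
  note m = int_mm
  have md: "(int s * c) mod d = int s * c - d * (int s * c div d)" for s by (simp add: minus_mult_div_eq_mod)
  have a: "0 \<le> alpha c d (Suc r)" using assms by (intro alpha_nonneg) auto
  have "int (nat c + mm (Suc r)) = int (mm r + nat (alpha c d (Suc r)) * nat d)"
  proof (cases "int (Suc r) < d")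
    case True
    have "alpha c d (Suc r) = int (Suc r) * c div d - int r * c div d"
      using True by (simp add: alpha_def floor_divide_of_int_eq del: of_int_mult)
    hence "alpha c d (Suc r) * d = d * (int (Suc r) * c div d) - d * (int r * c div d)"
      by (simp only: left_diff_distrib right_diff_distrib mult.commute)
    moreover have "int (Suc r) * c = int r * c + c" by (simp add: algebra_simps)
    moreover have "int (mm r) = d - (int r * c - d * (int r * c div d))" using m[of r] True unfolding md by simp
    moreover have "int (mm (Suc r)) = d - (int (Suc r) * c - d * (int (Suc r) * c div d))" using m[of "Suc r"] True unfolding md by simp
    moreover have "int (nat c + mm (Suc r)) = c + int (mm (Suc r))"
      "int (mm r + nat (alpha c d (Suc r)) * nat d) = int (mm r) + alpha c d (Suc r) * d"
      using a c0 d0 by simp_all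
    ultimately show ?thesis by linarith
  next
    case False
    hence d: "d = int r + 1" using assms by simp
    have "alpha c d (Suc r) = c - (d - 1) * c div d - 1"
      using False by (simp add: alpha_def floor_divide_of_int_eq del: of_int_mult)
    moreover have "(d - 1) * c = int r * c" using d by simp
    ultimately have "alpha c d (Suc r) = c - int r * c div d - 1" by simp
    hence "alpha c d (Suc r) * d = (c - int r * c div d - 1) * d" by simp
    also have "\<dots> = c * d - d * (int r * c div d) - d" by (simp add: algebra_simps)
    finally have "alpha c d (Suc r) * d = c * d - d * (int r * c div d) - d" .
    moreover have "int r * c = c * d - c" using d by (simp add: algebra_simps)
    moreover have "int (mm r) = d - (int r * c - d * (int r * c div d))" using m[of r] d unfolding md by simp
    moreover have "int (nat c + mm (Suc r)) = c" using False c0 by (simp add: mm_def)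
    moreover have "int (mm r + nat (alpha c d (Suc r)) * nat d) = int (mm r) + alpha c d (Suc r) * d"
      using a d0 by simp
    ultimately show ?thesis by linarith
  qed
  thus ?thesis by (simp only: of_nat_eq_iff)
qed

lemma mm_bij: "bij_betw mm {..<nat d} {1..nat d}"
proof -
  have inj: "inj_on mm {..<nat d}"
  proof (rule inj_onI)
    fix r s assume rs: "r \<in> {..<nat d}" "s \<in> {..<nat d}" "mm r = mm s"
    have "(int r * c) mod d = (int s * c) mod d"
      using rs int_mm[of r] int_mm[of s] by simp
    hence "d dvd (int r - int s) * c" by (simp add: mod_eq_dvd_iff left_diff_distrib)
    hence "d dvd int r - int s" using coprime_cd by (simp add: coprime_dvd_mult_left_iff coprime_commute)
    moreover have "\<bar>int r - int s\<bar> < d" using rs by auto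
    ultimately have "int r - int s = 0" using dvd_imp_le_int[of "int r - int s" d] d0 by linarith
    thus "r = s" by simp
  qed
  have "mm ` {..<nat d} \<subseteq> {1..nat d}"
  proof (rule image_subsetI)
    fix r assume "r \<in> {..<nat d}"
    hence "int (mm r) = d - (int r * c) mod d" by (intro int_mm) auto
    thus "mm r \<in> {1..nat d}" using pos_mod_bound[OF d0, of "int r * c"] mm_le[of r] by simp
  qed
  moreover have "card (mm ` {..<nat d}) = card {1..nat d}" using inj by (simp add: card_image)
  ultimately have "mm ` {..<nat d} = {1..nat d}" by (intro card_subset_eq) auto
  thus ?thesis using inj by (simp add: bij_betw_def)
qed

text \<open>Because \<open>b c\<close> is \<open>-1\<close> modulo \<open>d\<close>; this is why
  \<open>H3\<close> breaks off after \<open>b\<close> factors, at the index where \<open>f\<close>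
  equals \<open>1\<close>.\<close>

lemma mm_b: "mm (nat b) = 1"
proof -
  have "b * c = (d - 1) + d * (a - 1)" using det by (simp add: algebra_simps)
  hence "(b * c) mod d = (d - 1) mod d" by (simp only: mod_mult_self2)
  also have "\<dots> = d - 1" using d0 by (intro mod_pos_pos_trivial) auto
  finally have "(b * c) mod d = d - 1" .
  thus ?thesis using b0 b_less by (simp add: mm_def)
qed

text \<open>Multiplication by \<open>b\<close> undoes that by \<open>- c\<close> modulo
  \<open>d\<close>, so along \<open>mm\<close> the sign pattern simply alternates, as the matrix
  factors do.\<close>

lemma pat_mm: "r < nat d \<Longrightarrow> pat b d (mm r) = (-1) ^ r"
proof -
  assume r: "r < nat d"
  hence rd: "int r < d" by simp
  have "int (mm r) = d - int r * c + d * (int r * c div d)"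
    using rd pos_mod_bound[OF d0, of "int r * c"] by (simp add: mm_def minus_mult_div_eq_mod[symmetric])
  hence "int (mm r) * b = (d - int r * c + d * (int r * c div d)) * b" by (simp only:)
  also have "\<dots> = d * b - int r * (b * c) + d * (int r * c div d) * b" by (simp add: algebra_simps)
  also have "b * c = a * d - 1" using det by simp
  finally have "int (mm r) * b = int r + (b - int r * a + (int r * c div d) * b) * d" by (simp add: algebra_simps)
  hence "int (mm r) * b div d = (b - int r * a + (int r * c div d) * b) + int r div d" using d0 by (simp only: div_mult_self1)
  also have "int r div d = 0" using rd by (simp add: div_pos_pos_trivial)
  finally show ?thesis using even_b odd_a by (simp add: pat_def)
qed

lemma sign_mm: "r < nat d \<Longrightarrow> (-1) ^ mm r = - ((-1) ^ nat (int r * c div d) :: complex)"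
proof -
  assume r: "r < nat d"
  hence rd: "int r < d" by simp
  have "int (mm r) = d - int r * c + d * (int r * c div d)"
    using rd pos_mod_bound[OF d0, of "int r * c"] by (simp add: mm_def minus_mult_div_eq_mod[symmetric])
  hence "even (int (mm r)) \<longleftrightarrow> odd (int r * c div d)" using odd_d even_c by simp
  moreover have "0 \<le> int r * c div d" using c0 d0 by (simp add: pos_imp_zdiv_nonneg_iff)
  ultimately have "even (mm r) \<longleftrightarrow> odd (nat (int r * c div d))" by (simp add: even_nat_iff)
  thus ?thesis by (cases "even (mm r)") auto
qed

end

section \<open>The eigen-solution at a parabolic point and its reflection in
  \<open>c\<close>\<close>

locale parabolic_dual = sl2 +
  fixes z :: complex
  assumes z: "z * fund (pat b d) z (nat d) = 2 * \<i>"
begin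

text \<open>At \<open>T = 2 \<i>\<close> the shift by \<open>d\<close> has the double eigenvalue
  \<open>\<i>\<close>: \<open>E\<close> is an eigen-solution and \<open>f\<close> a generalized one.
  The number \<open>x\<close> is chosen so that \<open>f + x E\<close> vanishes at \<open>c\<close>;
  it will be the root of \<open>H1\<close>.\<close>

definition "f k = fund (pat b d) z k"
definition "E k = - \<i> * f (k + nat d) - f k"
definition "u = f (nat d)"
definition "x = - f (nat c) / E (nat c)"
definition "\<kappa> = f (Suc (nat c)) + x * E (Suc (nat c))"

lemma zu: "z * u = 2 * \<i>" using z by (simp add: u_def f_def)

lemma u_nz: "u \<noteq> 0" using zu by auto

lemma sol_f: "sol (pat b d) z f" unfolding f_def by (rule sol_fund)

lemma f01: "f 0 = 0" "f (Suc 0) = 1" by (simp_all add: f_def)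

lemma sol_E: "sol (pat b d) z E"
  using sol_lincomb[OF sol_shift[OF sol_f] sol_f, of "- \<i>" "-1"] by (simp add: E_def[abs_def])

lemma f_shift: "f (k + nat d) = \<i> * (f k + E k)"
  by (simp add: E_def algebra_simps)

lemma E_shift: "E (k + nat d) = \<i> * E k"
proof -
  have e: "k + nat d + nat d = k + 2 * nat d" by simp
  have "f (k + nat d + nat d) = 2 * \<i> * f (k + nat d) + f k"
    unfolding e using monodromy[OF sol_f, of k] z by simp
  thus ?thesis unfolding E_def by (simp add: algebra_simps)
qed

lemma E_shifts: "E (k + j * nat d) = \<i> ^ j * E k"
proof (induction j)
  case (Suc j)
  thus ?case using E_shift[of "k + j * nat d"] by (simp add: algebra_simps)
qed simp

lemma f_shifts: "f (k + j * nat d) = \<i> ^ j * (f k + of_nat j * E k)"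
proof (induction j)
  case (Suc j)
  thus ?case using f_shift[of "k + j * nat d"] E_shifts[of k j] by (simp add: algebra_simps)
qed simp

lemma E0: "E 0 = - \<i> * u" "E 0 \<noteq> 0" "z * E 0 = 2"
  using u_nz zu by (simp_all add: E_def f01 u_def algebra_simps)

lemma c_pred: obtains k where "nat c = Suc k" "odd k"
  using c0 even_c by (cases "nat c") (auto simp: even_nat_iff[symmetric])

text \<open>Reflection in \<open>c\<close> and in \<open>c + d\<close> give two expressions for
  \<open>E (nat c)\<close>, and their difference is the pairing of \<open>E\<close> with
  itself.\<close>

lemma isotropic: "E 1 * E (nat c) + E 0 * E (nat c - 1) = 0"
  and E_c: "E (nat c) = E 1 * f (nat c) + E 0 * f (nat c - 1)"
proof -
  obtain k where k: "nat c = Suc k" by (rule c_pred)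
  show 1: "E (nat c) = E 1 * f (nat c) + E 0 * f (nat c - 1)"
    using palin[OF sol_f sol_E, of 0] by (simp add: f01)
  have "E (nat c + nat d) = E 1 * f (nat c + nat d) + E 0 * f (k + nat d)"
    using palin[OF sol_f sol_E, of 1] by (simp add: f01 k)
  hence "\<i> * E (nat c) = \<i> * (E 1 * (f (nat c) + E (nat c)) + E 0 * (f k + E k))"
    unfolding E_shift f_shift by (simp add: algebra_simps)
  hence "E (nat c) = E 1 * (f (nat c) + E (nat c)) + E 0 * (f k + E k)" by simp
  thus "E 1 * E (nat c) + E 0 * E (nat c - 1) = 0" using 1 by (simp add: k algebra_simps)
qed

lemma E_c_nz: "E (nat c) \<noteq> 0"
proof
  assume e: "E (nat c) = 0"
  obtain k where k: "nat c = Suc k" "odd k" by (rule c_pred)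
  have "E k = 0" using isotropic e E0(2) by (simp add: k)
  thus False using sol_wronskian[OF sol_f sol_E, of k] e E0(2) k by (simp add: f01)
qed

lemma Z_c: "f (nat c) + x * E (nat c) = 0"
  using E_c_nz by (simp add: x_def)

text \<open>The Wronskian of \<open>f\<close> and \<open>E\<close> gives one relation between
  \<open>E\<close> at \<open>c\<close> and at \<open>0\<close>, reflection gives the opposite one;
  together they make \<open>\<kappa>\<close> a sign.\<close>

lemma kappa: "\<kappa> * E (nat c) = E 0" "E (nat c) = \<kappa> * E 0" "\<kappa> * \<kappa> = 1" "E (Suc (nat c)) = \<kappa> * (2 - E 1)"
proof -
  obtain k where k: "nat c = Suc k" "odd k" by (rule c_pred)
  have fc: "f (nat c) = - x * E (nat c)" using Z_c by (simp add: add_eq_0_iff2)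
  have "f (Suc (nat c)) * E (nat c) - f (nat c) * E (Suc (nat c)) = E 0"
    using sol_wronskian[OF sol_f sol_E, of "nat c"] k by (simp add: f01)
  thus 1: "\<kappa> * E (nat c) = E 0" unfolding fc by (simp add: \<kappa>_def algebra_simps)
  have r: "g (Suc (nat c)) = z * g (nat c) + g k" if "sol (pat b d) z g" for g
    using solD[OF that, of k] e_c by (simp add: k)
  have "\<kappa> = z * (f (nat c) + x * E (nat c)) + (f k + x * E k)"
    unfolding \<kappa>_def r[OF sol_f] r[OF sol_E] by (simp add: algebra_simps)
  hence kk: "f k = \<kappa> - x * E k" using Z_c by simp
  have "E (nat c) = - x * (E 1 * E (nat c) + E 0 * E (nat c - 1)) + E 0 * \<kappa>"
    using E_c unfolding fc by (simp add: k kk algebra_simps)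
  thus 2: "E (nat c) = \<kappa> * E 0" using isotropic by simp
  show 3: "\<kappa> * \<kappa> = 1" using 1 2 E0(2) by simp
  have "E 0 * (E k + \<kappa> * E 1) = 0" using isotropic 2 by (simp add: k algebra_simps)
  hence "E k = - \<kappa> * E 1" using E0(2) by (simp add: add_eq_0_iff2)
  thus "E (Suc (nat c)) = \<kappa> * (2 - E 1)" unfolding r[OF sol_E] 2 using E0(3) by (simp add: algebra_simps)
qed

text \<open>Beyond \<open>c\<close> the pattern has opposite signs, and so has the recurrence of
  \<open>(-1)^m\<close> times a solution. Hence agreement at \<open>m = 0\<close> and
  \<open>m = 1\<close> propagates through one period.\<close>

lemma reflect:
  "m \<le> nat d \<Longrightarrow> E (nat c + m) = - \<kappa> * (-1) ^ m * (2 * f m - E m) \<and>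
     f (nat c + m) + x * E (nat c + m) = - \<kappa> * (-1) ^ m * f m"
proof (induction m rule: induct_nat_012)
  case 0
  thus ?case using kappa(2) Z_c by (simp add: f01)
next
  case 1
  have "f (Suc (nat c)) + x * E (Suc (nat c)) = \<kappa>" by (simp add: \<kappa>_def)
  thus ?case using kappa(4) by (simp add: f01)
next
  case (ge2 m)
  have e: "pat b d (Suc (nat c + m)) = - pat b d (Suc m)" using e_c_add[of "Suc m"] ge2.prems by simp
  have 1: "g (nat c + Suc (Suc m)) = - (of_int (pat b d (Suc m)) * z * g (nat c + Suc m)) + g (nat c + m)"
    if "sol (pat b d) z g" for g using solD[OF that, of "nat c + m"] e by simp
  note ih = ge2.IH(1)[OF Suc_leD[OF Suc_leD[OF ge2.prems]]] ge2.IH(2)[OF Suc_leD[OF ge2.prems]]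
  show ?case
  proof
    show "E (nat c + Suc (Suc m)) = - \<kappa> * (-1) ^ Suc (Suc m) * (2 * f (Suc (Suc m)) - E (Suc (Suc m)))"
      unfolding 1[OF sol_E] solD[OF sol_E, of m] solD[OF sol_f, of m] conjunct1[OF ih(1)] conjunct1[OF ih(2)] by (simp add: algebra_simps)
    have "f (nat c + Suc (Suc m)) + x * E (nat c + Suc (Suc m)) =
        - (of_int (pat b d (Suc m)) * z * (f (nat c + Suc m) + x * E (nat c + Suc m))) + (f (nat c + m) + x * E (nat c + m))"
      unfolding 1[OF sol_E] 1[OF sol_f] by (simp add: algebra_simps)
    thus "f (nat c + Suc (Suc m)) + x * E (nat c + Suc (Suc m)) = - \<kappa> * (-1) ^ Suc (Suc m) * f (Suc (Suc m))"
      unfolding solD[OF sol_f, of m] conjunct2[OF ih(1)] conjunct2[OF ih(2)] by (simp add: algebra_simps)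
  qed
qed

text \<open>The first row of the matrix product at \<open>x\<close>; in the coordinates
  \<open>ev\<close>, \<open>fv\<close> a factor acts, up to signs, as reflection and shift act on
  \<open>E\<close> and \<open>2 f - E\<close>.\<close>

definition "y1 r = poly (N_prod c d r $ 1 $ 1) x"
definition "y2 r = poly (N_prod c d r $ 1 $ 2) x"
definition "ev r = y1 r - om r * y2 r"
definition "fv r = y1 r + om r * y2 r"

text \<open>The value at \<open>c + mm (Suc r) = mm r + k d\<close> is computed twice, by reflection
  in \<open>c\<close> from \<open>mm (Suc r)\<close> and by \<open>k\<close> shifts from
  \<open>mm r\<close>. The sign \<open>\<kappa> * (-1)^m\<close> is its own inverse, which solves
  for the next pair.\<close>

lemma dual_step:
  assumes r: "int (Suc r) \<le> d"
  defines "k \<equiv> nat (alpha c d (Suc r))"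
  shows "E (mm (Suc r)) = - \<kappa> * (-1) ^ mm (Suc r) * \<i> ^ k * ((2 * f (mm r) - E (mm r)) + 2 * (of_nat k + x) * E (mm r))"
    "2 * f (mm (Suc r)) - E (mm (Suc r)) = - \<kappa> * (-1) ^ mm (Suc r) * \<i> ^ k * E (mm r)"
    "ev (Suc r) = om r ^ k * (fv r + 2 * (of_nat k + x) * ev r)"
    "fv (Suc r) = om r ^ k * ev r"
proof -
  have sg: "(-1) ^ m * (-1) ^ m = (1 :: complex)" for m by (simp flip: power_mult_distrib)
  have kk: "(\<kappa> * (-1) ^ m) * (\<kappa> * (-1) ^ m) = 1" for m
    using kappa(3) sg[of m] by (simp add: mult_ac)
  have a: "0 \<le> alpha c d (Suc r)" using r by (intro alpha_nonneg) auto
  have ak: "of_int (alpha c d (Suc r)) = (of_nat k :: complex)" using a by (simp add: k_def)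
  have idx: "nat c + mm (Suc r) = mm r + k * nat d" using mm_step[OF r] by (simp add: k_def)
  let ?s = "\<kappa> * (-1) ^ mm (Suc r)"
  have 1: "\<i> ^ k * E (mm r) = - ?s * (2 * f (mm (Suc r)) - E (mm (Suc r)))"
    using reflect[OF mm_le[of "Suc r"]] E_shifts[of "mm r" k] by (simp add: idx)
  have 2: "\<i> ^ k * (f (mm r) + (of_nat k + x) * E (mm r)) = - ?s * f (mm (Suc r))"
    using reflect[OF mm_le[of "Suc r"]] E_shifts[of "mm r" k] f_shifts[of "mm r" k] by (simp add: idx algebra_simps)
  have 3: "f (mm (Suc r)) = - ?s * (\<i> ^ k * (f (mm r) + (of_nat k + x) * E (mm r)))"
    unfolding 2 using kk[of "mm (Suc r)"] by (simp add: mult.assoc[symmetric])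
  have 4: "2 * f (mm (Suc r)) - E (mm (Suc r)) = - ?s * (\<i> ^ k * E (mm r))"
    unfolding 1 using kk[of "mm (Suc r)"] by (simp add: mult.assoc[symmetric])
  show "2 * f (mm (Suc r)) - E (mm (Suc r)) = - \<kappa> * (-1) ^ mm (Suc r) * \<i> ^ k * E (mm r)"
    unfolding 4 by (simp add: mult.assoc)
  have "E (mm (Suc r)) = 2 * f (mm (Suc r)) - (2 * f (mm (Suc r)) - E (mm (Suc r)))" by simp
  thus "E (mm (Suc r)) = - \<kappa> * (-1) ^ mm (Suc r) * \<i> ^ k * ((2 * f (mm r) - E (mm r)) + 2 * (of_nat k + x) * E (mm r))"
    unfolding 4 unfolding 3 by (simp add: algebra_simps)
  note st = step_nth[OF a, folded k_def, unfolded ak]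
  define w where "w = om r ^ k"
  have y: "y1 (Suc r) = w * (y1 r * (of_nat k + 1 + x) - om r * y2 r * (of_nat k + x))"
    "y2 (Suc r) = w * (y2 r * (1 - of_nat k - x) - om r * y1 r * (of_nat k + x))"
    unfolding y1_def y2_def N_prod_Suc_nth st w_def by (simp_all add: algebra_simps)
  have oo: "om r * (om r * q) = - q" for q using om_square(1)[of r] by (simp add: mult.assoc[symmetric])
  show "ev (Suc r) = om r ^ k * (fv r + 2 * (of_nat k + x) * ev r)" "fv (Suc r) = om r ^ k * ev r"
    unfolding ev_def fv_def y om_square(2) w_def[symmetric] by (simp_all add: algebra_simps oo)
qed

lemma mm_0: "mm 0 = nat d" using d0 by (simp add: mm_def)

lemma dual:
  "int r \<le> d \<Longrightarrow> \<exists>V. V * V = 1 \<and> E (mm r) = u * V * ev r \<and> 2 * f (mm r) - E (mm r) = u * V * fv r"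
proof (induction r)
  case 0
  have "E (nat d) = u" using E_shift[of 0] E0(1) by simp
  thus ?case
    by (intro exI[of _ 1]) (simp add: mm_0 ev_def fv_def y1_def y2_def mat_def u_def)
next
  case (Suc r)
  then obtain V where V: "V * V = 1" "E (mm r) = u * V * ev r" "2 * f (mm r) - E (mm r) = u * V * fv r" by auto
  note st = dual_step[OF Suc.prems]
  let ?k = "nat (alpha c d (Suc r))" and ?s = "- \<kappa> * (-1) ^ mm (Suc r)"
  \<comment> \<open>The two recursions differ by the sign \<open>?s\<close> and by the power of
    \<open>\<i> / om r\<close>, which is again a sign.\<close>
  define W where "W = V * ?s * (\<i> / om r) ^ ?k"
  have io: "\<i> ^ ?k = (\<i> / om r) ^ ?k * om r ^ ?k" using om_square(3)[of r] by (simp add: power_divide)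
  have "(\<i> / om r) * (\<i> / om r) = 1" by (auto simp: om_def)
  hence "(\<i> / om r) ^ ?k * (\<i> / om r) ^ ?k = 1" by (simp only: power_mult_distrib[symmetric] power_one)
  moreover have "?s * ?s = (\<kappa> * \<kappa>) * ((-1) ^ mm (Suc r) * (-1) ^ mm (Suc r))" by (simp only: mult_ac mult_minus_left mult_minus_right minus_minus)
  hence "?s * ?s = 1" unfolding kappa(3) by (simp flip: power_mult_distrib)
  moreover have "W * W = (V * V) * (?s * ?s) * ((\<i> / om r) ^ ?k * (\<i> / om r) ^ ?k)" unfolding W_def by (simp only: mult_ac)
  ultimately have "W * W = 1" using V(1) by (simp only: mult_1_right)
  moreover have "E (mm (Suc r)) = u * W * ev (Suc r)"
    unfolding st(1,3) unfolding V(3) unfolding V(2) io W_def by (simp add: algebra_simps)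
  moreover have "2 * f (mm (Suc r)) - E (mm (Suc r)) = u * W * fv (Suc r)"
    unfolding st(2,4) V(2) io W_def by (simp add: algebra_simps)
  ultimately show ?case by blast
qed

section \<open>Determinant and derivative of the matrix product at the dual root\<close>

definition "D22 r = y1 r * poly (N_prod c d r $ 2 $ 2) x - y2 r * poly (N_prod c d r $ 2 $ 1) x"
definition "\<delta> r = (-1 :: complex) ^ nat (\<Sum>k = 1..r. alpha c d k)"
definition "w r = poly (pderiv (N_prod c d r $ 1 $ 1)) x * y2 r - poly (pderiv (N_prod c d r $ 1 $ 2)) x * y1 r"

lemma om_power_square: "om r ^ k * om r ^ k = (-1) ^ k"
  by (simp only: power_mult_distrib[symmetric] om_square)

lemma delta_Suc: "int (Suc r) \<le> d \<Longrightarrow> \<delta> (Suc r) = (-1) ^ nat (alpha c d (Suc r)) * \<delta> r"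
proof -
  assume r: "int (Suc r) \<le> d"
  have "0 \<le> (\<Sum>k = 1..r. alpha c d k)" using r by (intro sum_nonneg alpha_nonneg) auto
  moreover have "0 \<le> alpha c d (Suc r)" using r by (intro alpha_nonneg) auto
  ultimately show ?thesis by (simp add: \<delta>_def nat_add_distrib power_add)
qed

lemma determinant: "int r \<le> d \<Longrightarrow> D22 r = \<delta> r"
proof (induction r)
  case 0
  show ?case by (simp add: D22_def y1_def y2_def \<delta>_def mat_def)
next
  case (Suc r)
  define k where "k = nat (alpha c d (Suc r))"
  have a: "0 \<le> alpha c d (Suc r)" using Suc.prems by (intro alpha_nonneg) auto
  have ak: "of_int (alpha c d (Suc r)) = (of_nat k :: complex)" using a by (simp add: k_def)
  note st = step_nth[OF a, folded k_def, unfolded ak]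
  define q where "q = om r ^ k"
  define p1 p2 where "p1 = poly (N_prod c d r $ 2 $ 1) x" and "p2 = poly (N_prod c d r $ 2 $ 2) x"
  have y: "y1 (Suc r) = q * (y1 r * (of_nat k + 1 + x) - om r * y2 r * (of_nat k + x))"
    "y2 (Suc r) = q * (y2 r * (1 - of_nat k - x) - om r * y1 r * (of_nat k + x))"
    "poly (N_prod c d (Suc r) $ 2 $ 1) x = q * (p1 * (of_nat k + 1 + x) - om r * p2 * (of_nat k + x))"
    "poly (N_prod c d (Suc r) $ 2 $ 2) x = q * (p2 * (1 - of_nat k - x) - om r * p1 * (of_nat k + x))"
    unfolding y1_def y2_def N_prod_Suc_nth st q_def p1_def p2_def by (simp_all add: algebra_simps)
  have oo: "om r ^ 2 = -1" using om_square(1) by (simp add: power2_eq_square)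
  have "D22 (Suc r) = q * q * (y1 r * p2 - y2 r * p1)"
    unfolding D22_def y using oo by algebra
  also have "\<dots> = \<delta> (Suc r)"
    using Suc om_power_square[of r k] delta_Suc[OF Suc.prems] by (simp add: q_def D22_def p1_def p2_def k_def)
  finally show ?case .
qed

text \<open>The derivative of a factor has rank one, with the row \<open>(y1, y2)\<close> sent to a
  multiple \<open>ev\<close> of a fixed row, so each factor adds a single square, as in the
  Christoffel-Darboux sum.\<close>

lemma derivative_sum: "int r \<le> d \<Longrightarrow> w r * \<delta> r = \<i> * (\<Sum>s<r. (-1) ^ s * \<delta> s * ev s ^ 2)"
proof (induction r)
  case 0
  show ?case by (simp add: w_def mat_def)
next
  case (Suc r)
  define k where "k = nat (alpha c d (Suc r))"
  have a: "0 \<le> alpha c d (Suc r)" using Suc.prems by (intro alpha_nonneg) auto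
  have ak: "of_int (alpha c d (Suc r)) = (of_nat k :: complex)" using a by (simp add: k_def)
  note st = step_nth[OF a, folded k_def, unfolded ak]
  define q \<kappa>' where "q = om r ^ k" and "\<kappa>' = (of_nat k + x :: complex)"
  define p1 p2 where "p1 = poly (pderiv (N_prod c d r $ 1 $ 1)) x" and "p2 = poly (pderiv (N_prod c d r $ 1 $ 2)) x"
  have ds: "poly (pderiv (step c d r $ 1 $ 1)) x = q" "poly (pderiv (step c d r $ 1 $ 2)) x = - om r * q"
    "poly (pderiv (step c d r $ 2 $ 1)) x = - om r * q" "poly (pderiv (step c d r $ 2 $ 2)) x = - q"
    "poly (step c d r $ 1 $ 1) x = q * (\<kappa>' + 1)" "poly (step c d r $ 1 $ 2) x = - om r * q * \<kappa>'"
    "poly (step c d r $ 2 $ 1) x = - om r * q * \<kappa>'" "poly (step c d r $ 2 $ 2) x = q * (1 - \<kappa>')"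
    unfolding st by (simp_all add: pderiv_smult pderiv_pCons q_def \<kappa>'_def algebra_simps)
  have y: "y1 (Suc r) = q * (y1 r * (\<kappa>' + 1) - om r * y2 r * \<kappa>')"
    "y2 (Suc r) = q * (y2 r * (1 - \<kappa>') - om r * y1 r * \<kappa>')"
    "poly (pderiv (N_prod c d (Suc r) $ 1 $ 1)) x = q * (p1 * (\<kappa>' + 1) - om r * p2 * \<kappa>' + y1 r - om r * y2 r)"
    "poly (pderiv (N_prod c d (Suc r) $ 1 $ 2)) x = q * (p2 * (1 - \<kappa>') - om r * p1 * \<kappa>' - y2 r - om r * y1 r)"
    unfolding y1_def y2_def N_prod_Suc_nth p1_def p2_def pderiv_add pderiv_mult poly_add poly_mult ds
    by (simp_all add: algebra_simps)
  have oo: "om r ^ 2 = -1" using om_square(1) by (simp add: power2_eq_square)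
  have "w (Suc r) = q * q * ((p1 * y2 r - p2 * y1 r) + om r * (y1 r - om r * y2 r) ^ 2)"
    unfolding w_def y using oo by algebra
  also have "q * q = (-1) ^ k" by (simp add: q_def om_power_square)
  also have "om r = \<i> * (-1) ^ r" by (simp add: om_def)
  finally have "w (Suc r) = (-1) ^ k * (w r + \<i> * (-1) ^ r * ev r ^ 2)"
    by (simp add: w_def p1_def p2_def ev_def om_def)
  moreover have "\<delta> (Suc r) = (-1) ^ k * \<delta> r" using delta_Suc[OF Suc.prems] by (simp add: k_def)
  moreover have "(-1) ^ k * (-1) ^ k = (1 :: complex)" by (simp flip: power_mult_distrib)
  ultimately have "w (Suc r) * \<delta> (Suc r) = w r * \<delta> r + \<i> * (-1) ^ r * ev r ^ 2 * \<delta> r"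
    by (simp add: algebra_simps)
  thus ?case using Suc by (simp add: algebra_simps)
qed

text \<open>After \<open>j\<close> periods \<open>f\<close> has become
  \<open>\<i>^j (f + j E)\<close>. The sum of weighted squares over the period number
  \<open>j\<close> is thus, up to a common sign rule, quadratic in \<open>j\<close>, and its second
  difference over three periods is twice the sum for \<open>E\<close>; each partial sum is known
  from \<open>sol_deriv_sum\<close>.\<close>

lemma eigen_square_sum:
  "(\<Sum>k<nat d. (-1) ^ k * of_int (pat b d (Suc k)) * E (Suc k) ^ 2) = u * poly (pderiv ([:0, 1:] * R (nat d))) z"
proof -
  let ?T = "[:0, 1:] * R (nat d)"
  define t' u' v v' where "t' = poly (pderiv ?T) z" and "u' = poly (pderiv (R (nat d))) z"
    and "v = f (Suc (nat d))" and "v' = poly (pderiv (R (Suc (nat d)))) z"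
  define h where "h k = poly (pderiv (R k)) z" for k
  have hrec: "h (Suc (Suc k)) = of_int (pat b d (Suc k)) * (f (Suc k) + z * h (Suc k)) + h k" for k
    unfolding h_def fund_deriv_rec by (simp add: f_def poly_fund)
  define S where "S N = (\<Sum>k<N. (-1) ^ k * of_int (pat b d (Suc k)) * f (Suc k) ^ 2)" for N
  have S: "S N = (-1) ^ N * (h N * f (Suc N) - h (Suc N) * f N)" for N
    unfolding S_def by (rule sol_deriv_sum[OF sol_f hrec]) (simp_all add: h_def)
  let ?d = "nat d"
  have mono: "R (k + 2 * ?d) = ?T * R (k + ?d) + R k" for k by (rule monodromy[OF sol_fund])
  have pT: "poly ?T z = 2 * \<i>" using z by (simp add: poly_fund)
  have hm: "h (k + 2 * ?d) = t' * f (k + ?d) + 2 * \<i> * h (k + ?d) + h k" for k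
    unfolding h_def mono pderiv_add pderiv_mult[of ?T] poly_add poly_mult[of _ "R (k + ?d)"] poly_mult[of ?T] pT
    by (simp add: t'_def f_def poly_fund)
  have fm: "f (k + 2 * ?d) = 2 * \<i> * f (k + ?d) + f k" for k
    using monodromy[OF sol_f, of k] z by simp
  have v0: "f ?d = u" "f (Suc ?d) = v" "h ?d = u'" "h (Suc ?d) = v'" "h 0 = 0" "h (Suc 0) = 0"
    by (simp_all add: u_def v_def h_def u'_def v'_def)
  have f2: "f (2 * ?d) = 2 * \<i> * u" "f (Suc (2 * ?d)) = 2 * \<i> * v + 1"
    "h (2 * ?d) = t' * u + 2 * \<i> * u'" "h (Suc (2 * ?d)) = t' * v + 2 * \<i> * v'"
    using fm[of 0] fm[of 1] hm[of 0] hm[of 1] by (simp_all add: v0 f01)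
  have i3: "?d + 2 * ?d = 3 * ?d" "Suc ?d + 2 * ?d = Suc (3 * ?d)" "?d + ?d = 2 * ?d" "Suc ?d + ?d = Suc (2 * ?d)" by simp_all
  have f3: "f (3 * ?d) = - 3 * u" "f (Suc (3 * ?d)) = - 3 * v + 2 * \<i>"
    "h (3 * ?d) = 4 * \<i> * t' * u - 3 * u'" "h (Suc (3 * ?d)) = 4 * \<i> * t' * v + t' - 3 * v'"
    using fm[of ?d] fm[of "Suc ?d"] hm[of ?d] hm[of "Suc ?d"] unfolding i3 f2 v0 by (simp_all add: algebra_simps)
  have od: "odd ?d" using odd_d d0 by (simp add: even_nat_iff)
  have S1: "S ?d = - (u' * v - v' * u)" unfolding S v0 using od by simp
  have S2: "S (2 * ?d) = (t' * u + 2 * \<i> * u') * (2 * \<i> * v + 1) - (t' * v + 2 * \<i> * v') * (2 * \<i> * u)"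
    unfolding S f2 by simp
  have S3: "S (3 * ?d) = - ((4 * \<i> * t' * u - 3 * u') * (- 3 * v + 2 * \<i>) - (4 * \<i> * t' * v + t' - 3 * v') * (- 3 * u))"
    unfolding S f3 using od by simp
  define s where "s k = (-1 :: complex) ^ k * of_int (pat b d (Suc k))" for k
  have ss: "s (k + ?d) = - s k" for k using periodic[of "Suc k"] od by (simp add: s_def power_add)
  have split: "S (N + ?d) = S N + (\<Sum>k<?d. s (k + N) * f (Suc k + N) ^ 2)" for N
  proof -
    have "S (N + ?d) = (\<Sum>k<N. s k * f (Suc k) ^ 2) + (\<Sum>k\<in>{N..<N + ?d}. s k * f (Suc k) ^ 2)"
      unfolding S_def s_def by (subst sum.union_disjoint[symmetric]) (auto intro: sum.cong)
    also have "(\<Sum>k\<in>{N..<N + ?d}. s k * f (Suc k) ^ 2) = (\<Sum>k<?d. s (k + N) * f (Suc k + N) ^ 2)"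
      by (rule sum.reindex_bij_witness[of _ "\<lambda>k. k + N" "\<lambda>k. k - N"]) auto
    finally show ?thesis by (simp add: S_def s_def)
  qed
  have Q0: "S ?d = (\<Sum>k<?d. s k * f (Suc k) ^ 2)" by (simp add: S_def s_def)
  have Q1: "S (2 * ?d) = S ?d + (\<Sum>k<?d. s k * (f (Suc k) + E (Suc k)) ^ 2)"
  proof -
    have "S (2 * ?d) = S ?d + (\<Sum>k<?d. s (k + ?d) * f (Suc k + ?d) ^ 2)" using split[of ?d] by (simp add: mult_2)
    also have "(\<Sum>k<?d. s (k + ?d) * f (Suc k + ?d) ^ 2) = (\<Sum>k<?d. s k * (f (Suc k) + E (Suc k)) ^ 2)"
      by (intro sum.cong refl) (simp only: ss f_shift power_mult_distrib power2_i mult_minus_left mult_1_left mult_minus_right minus_minus)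
    finally show ?thesis .
  qed
  have Q2: "S (3 * ?d) = S (2 * ?d) + (\<Sum>k<?d. s k * (f (Suc k) + 2 * E (Suc k)) ^ 2)"
  proof -
    have e: "k + 2 * ?d = (k + ?d) + ?d" for k by simp
    have "S (3 * ?d) = S (2 * ?d) + (\<Sum>k<?d. s (k + 2 * ?d) * f (Suc k + 2 * ?d) ^ 2)" using split[of "2 * ?d"] by simp
    also have "(\<Sum>k<?d. s (k + 2 * ?d) * f (Suc k + 2 * ?d) ^ 2) = (\<Sum>k<?d. s k * (f (Suc k) + 2 * E (Suc k)) ^ 2)"
    proof (intro sum.cong refl)
      fix k
      have "f (Suc k + 2 * ?d) = - (f (Suc k) + 2 * E (Suc k))" using f_shifts[of "Suc k" 2] by simp
      moreover have "s (k + 2 * ?d) = s k" unfolding e ss by simp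
      ultimately show "s (k + 2 * ?d) * f (Suc k + 2 * ?d) ^ 2 = s k * (f (Suc k) + 2 * E (Suc k)) ^ 2"
        by (simp only: power2_minus)
    qed
    finally show ?thesis .
  qed
  have "2 * (\<Sum>k<?d. s k * E (Suc k) ^ 2) = (\<Sum>k<?d. s k * (f (Suc k) + 2 * E (Suc k)) ^ 2) -
      2 * (\<Sum>k<?d. s k * (f (Suc k) + E (Suc k)) ^ 2) + (\<Sum>k<?d. s k * f (Suc k) ^ 2)"
    unfolding sum_distrib_left sum_subtractf[symmetric] sum.distrib[symmetric]
    by (intro sum.cong refl) (simp add: algebra_simps power2_eq_square)
  also have "\<dots> = S (3 * ?d) - 3 * S (2 * ?d) + 3 * S ?d" using Q0 Q1 Q2 by (simp add: algebra_simps)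
  also have "\<dots> = 2 * (u * t')" unfolding S1 S2 S3 by (simp add: algebra_simps)
  finally show ?thesis by (simp add: s_def t'_def)
qed

text \<open>The root is \<open>x\<close>. The index \<open>mm d = 0\<close>, where \<open>f\<close>
  vanishes, gives \<open>H1(x) = 0\<close>; the index \<open>mm b = 1\<close>, where
  \<open>f\<close> is \<open>1\<close>, gives \<open>H3(x) = 1/u\<close> up to sign; the determinant
  makes \<open>H2(x)\<close> a sign. The derivative sum for \<open>H1\<close> becomes that for
  \<open>T\<close> under the bijection \<open>mm\<close>.\<close>

theorem parabolic_duality:
  obtains y where "poly (map_poly of_int (H1 c d)) y = 0" "(u * poly (map_poly of_int (H3 b c d)) y) ^ 2 = (1 :: complex)"
    "- poly (pderiv (map_poly of_int (H1 c d))) y * poly (map_poly of_int (H2 c d)) y * u = poly (pderiv ([:0, 1:] * R (nat d))) z"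
    "poly (map_poly of_int (H2 c d)) y \<noteq> 0"
proof -
  have H12: "smult \<i> (map_poly of_int (H1 c d)) = N_prod c d (nat d) $ 1 $ 1" "map_poly of_int (H2 c d) = N_prod c d (nat d) $ 2 $ 1"
    using H1_H2_eq[OF odd_d even_c d0] by (simp_all add: vec_eq_iff forall_2 matrix_vector_mult_def sum_2)
  have H3: "map_poly of_int (H3 b c d) = N_prod c d (nat b) $ 1 $ 1"
    using H3_eq[OF det odd_a b0 b_less] by (simp add: matrix_vector_mult_def sum_2)
  have dd: "int (nat d) \<le> d" "int (nat b) \<le> d" using d0 b0 b_less by auto
  obtain V where V: "V * V = 1" "E (mm (nat d)) = u * V * ev (nat d)" "2 * f (mm (nat d)) - E (mm (nat d)) = u * V * fv (nat d)"
    using dual[OF dd(1)] by blast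
  have V0: "V \<noteq> 0" using V(1) by auto
  have md: "mm (nat d) = 0" using d0 by (simp add: mm_def)
  have "u * V * (ev (nat d) + fv (nat d)) = E (mm (nat d)) + (2 * f (mm (nat d)) - E (mm (nat d)))"
    by (simp only: distrib_left flip: V(2,3))
  hence "u * V * (ev (nat d) + fv (nat d)) = 0" by (simp add: md f01)
  hence "ev (nat d) + fv (nat d) = 0" using V0 u_nz by simp
  hence y1d: "y1 (nat d) = 0" by (simp add: ev_def fv_def)
  have "\<i> * poly (map_poly of_int (H1 c d)) x = y1 (nat d)" unfolding y1_def H12(1)[symmetric] by simp
  hence 1: "poly (map_poly of_int (H1 c d)) x = 0" using y1d by simp
  obtain V' where V': "V' * V' = 1" "E (mm (nat b)) = u * V' * ev (nat b)" "2 * f (mm (nat b)) - E (mm (nat b)) = u * V' * fv (nat b)"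
    using dual[OF dd(2)] by blast
  have "u * V' * (ev (nat b) + fv (nat b)) = 2 * f (mm (nat b))" using V'(2,3) by (simp add: algebra_simps)
  hence "V' * (u * y1 (nat b)) = 1" by (simp add: mm_b f01 ev_def fv_def algebra_simps)
  hence "(V' * V') * (u * y1 (nat b)) ^ 2 = 1" by (metis power2_eq_square power_mult_distrib one_power2)
  hence 2: "(u * poly (map_poly of_int (H3 b c d)) x) ^ 2 = 1" using V'(1) by (simp add: H3 y1_def)
  have od: "odd (nat d)" using odd_d d0 by (simp add: even_nat_iff)
  have "- \<i> * u = u * V * (\<i> * y2 (nat d))" using V(2) od by (simp add: md E0 ev_def y1d om_def)
  hence "\<i> * (u * (V * y2 (nat d))) = \<i> * (u * (-1))" by (simp add: algebra_simps)
  hence "V * y2 (nat d) = -1" using u_nz by (simp only: mult_cancel_left) simp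
  hence y2d: "y2 (nat d) = - V" using V(1) by (metis minus_mult_right mult.left_commute mult.right_neutral mult.assoc)
  have sa: "(\<Sum>k = 1..nat d. alpha c d k) = c - 1" using sum_alpha[OF d0, of "nat d" c] d0 by simp
  have dl: "\<delta> (nat d) = -1"
  proof -
    have "odd (nat (c - 1))" using even_c c0 by (simp add: even_nat_iff)
    thus ?thesis unfolding \<delta>_def sa by simp
  qed
  have "V * poly (N_prod c d (nat d) $ 2 $ 1) x = -1"
    using determinant[OF dd(1)] by (simp add: D22_def y1d y2d dl)
  hence h2: "poly (map_poly of_int (H2 c d)) x = - V" using V(1) unfolding H12(2)
    by (metis minus_mult_right mult.left_commute mult.right_neutral mult.assoc)
  have e2: "ev s ^ 2 * u ^ 2 = E (mm s) ^ 2" if "s < nat d" for s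
  proof -
    have sd: "int s \<le> d" using that by simp
    obtain W where W: "W * W = 1" "E (mm s) = u * W * ev s" using dual[OF sd] by blast
    thus ?thesis by (simp add: power2_eq_square mult_ac)
  qed
  have "w (nat d) * \<delta> (nat d) * u ^ 2 = \<i> * (\<Sum>s<nat d. (-1) ^ s * \<delta> s * (ev s ^ 2 * u ^ 2))"
    unfolding derivative_sum[OF dd(1)] sum_distrib_left sum_distrib_right by (intro sum.cong refl) (simp add: mult_ac)
  also have "(\<Sum>s<nat d. (-1) ^ s * \<delta> s * (ev s ^ 2 * u ^ 2)) =
      (\<Sum>s<nat d. - ((-1) ^ mm s * of_int (pat b d (mm s)) * E (mm s) ^ 2))"
  proof (intro sum.cong refl)
    fix s assume "s \<in> {..<nat d}"
    hence s: "s < nat d" by simp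
    have "(\<Sum>k = 1..s. alpha c d k) = int s * c div d" using sum_alpha[OF d0, of s c] s by simp
    hence "\<delta> s = - ((-1) ^ mm s)" using sign_mm[OF s] by (simp add: \<delta>_def)
    thus "(-1) ^ s * \<delta> s * (ev s ^ 2 * u ^ 2) = - ((-1) ^ mm s * of_int (pat b d (mm s)) * E (mm s) ^ 2)"
      using e2[OF s] pat_mm[OF s] by simp
  qed
  also have "\<dots> = (\<Sum>m\<in>{1..nat d}. - ((-1) ^ m * of_int (pat b d m) * E m ^ 2))"
    by (rule sum.reindex_bij_betw[OF mm_bij])
  also have "\<dots> = (\<Sum>k<nat d. (-1) ^ k * of_int (pat b d (Suc k)) * E (Suc k) ^ 2)"
    by (rule sum.reindex_bij_witness[of _ Suc "\<lambda>k. k - 1"]) (auto simp: Suc_le_eq gr0_conv_Suc)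
  also have "\<dots> = u * poly (pderiv ([:0, 1:] * R (nat d))) z" by (rule eigen_square_sum)
  finally have "- (w (nat d) * u ^ 2) = \<i> * (u * poly (pderiv ([:0, 1:] * R (nat d))) z)" unfolding dl by simp
  moreover have "w (nat d) = \<i> * poly (pderiv (map_poly of_int (H1 c d))) x * (- V)"
    unfolding w_def y1d y2d H12(1)[symmetric] by (simp add: pderiv_smult)
  ultimately have "(\<i> * u) * (- poly (pderiv (map_poly of_int (H1 c d))) x * (- V) * u) = (\<i> * u) * poly (pderiv ([:0, 1:] * R (nat d))) z"
    by (simp add: power2_eq_square mult_ac)
  hence 3: "- poly (pderiv (map_poly of_int (H1 c d))) x * poly (map_poly of_int (H2 c d)) x * u = poly (pderiv ([:0, 1:] * R (nat d))) z"
    using u_nz unfolding h2 by (subst (asm) mult_cancel_left) simp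
  have "poly (map_poly of_int (H2 c d)) x \<noteq> 0" using h2 V0 by simp
  thus thesis by (rule that[OF 1 2 3])
qed

end

section \<open>Rational polynomials\<close>

lemma coprime_of_rat_polyI:
  fixes p q :: "rat poly"
  assumes "\<And>z :: complex. poly (map_poly of_rat p) z = 0 \<Longrightarrow> poly (map_poly of_rat q) z \<noteq> 0"
  shows "coprime p q"
proof (rule coprimeI)
  fix k assume k: "k dvd p" "k dvd q"
  have "k \<noteq> 0" using k assms[of 0] by auto
  moreover have "degree k = 0"
  proof (rule ccontr)
    assume "degree k \<noteq> 0"
    hence "degree (map_poly of_rat k :: complex poly) > 0" by (simp add: map_poly_of_rat_hom)
    then obtain z :: complex where z: "poly (map_poly of_rat k) z = 0" using alg_closed_imp_poly_has_root by blast
    obtain r s where "p = k * r" "q = k * s" using k by (auto elim!: dvdE)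
    hence "poly (map_poly of_rat p) z = 0" "poly (map_poly of_rat q) z = 0" using z by (simp_all add: map_poly_of_rat_hom)
    thus False using assms by blast
  qed
  ultimately show "is_unit k" by (simp add: is_unit_iff_degree)
qed

text \<open>An ideal containing \<open>m\<close> is generated by a divisor \<open>f\<close> of
  \<open>m\<close>. As \<open>m\<close> has no repeated factor, \<open>f\<close> is coprime to its
  cofactor \<open>h\<close>, and by Bezout the ideal of \<open>h\<close> is a complement.\<close>

lemma quot_semisimpleI:
  fixes m :: "rat poly"
  assumes m: "coprime m (pderiv m)" and m0: "m \<noteq> 0"
  shows "quot_semisimple m"
  unfolding quot_semisimple_def
proof (intro allI impI)
  interpret P: module "(*) :: rat poly \<Rightarrow> _" by unfold_locales (simp_all add: algebra_simps)
  fix I :: "rat poly set" assume I: "P.subspace I \<and> m \<in> I"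
  have add: "x \<in> I \<Longrightarrow> y \<in> I \<Longrightarrow> x + y \<in> I" and mult: "x \<in> I \<Longrightarrow> k * x \<in> I" for x y k
    using I by (auto simp: P.subspace_def)
  define f where "f = arg_min degree (\<lambda>x. x \<in> I \<and> x \<noteq> 0)"
  have f: "f \<in> I" "f \<noteq> 0" and min: "\<And>x. x \<in> I \<Longrightarrow> x \<noteq> 0 \<Longrightarrow> degree f \<le> degree x"
    using arg_min_nat_lemma[of "\<lambda>x. x \<in> I \<and> x \<noteq> 0" m degree] I m0 by (auto simp: f_def)
  have dvd: "f dvd x" if x: "x \<in> I" for x
  proof (rule ccontr)
    assume "\<not> f dvd x"
    hence nz: "x mod f \<noteq> 0" by (simp add: dvd_eq_mod_eq_0)
    have "x mod f = x + (- (x div f)) * f" by (simp add: minus_mult_div_eq_mod[symmetric] mult.commute)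
    hence "x mod f \<in> I" using add[OF x mult[OF f(1)]] by metis
    hence "degree f \<le> degree (x mod f)" using min nz by blast
    thus False using degree_mod_less'[OF f(2) nz] by simp
  qed
  obtain h where h: "m = f * h" using dvd I by (auto elim: dvdE)
  have cop: "coprime f h"
  proof (rule coprimeI)
    fix k assume k: "k dvd f" "k dvd h"
    hence "k dvd m" "k dvd pderiv m" by (auto simp: h pderiv_mult)
    thus "is_unit k" using m by (rule coprime_common_divisor[rotated])
  qed
  let ?J = "{x. h dvd x}"
  have "P.subspace ?J" by (auto simp: P.subspace_def)
  moreover have "m \<in> ?J" by (simp add: h)
  moreover have "I \<inter> ?J = {x. m dvd x}"
    using dvd divides_mult[OF _ _ cop] mult I by (auto simp: h) (metis dvdE mult.commute)
  moreover have "\<exists>u\<in>I. \<exists>v\<in>?J. x = u + v" for x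
  proof -
    obtain r s where "r * f + s * h = 1"
      using bezout_coefficients_fst_snd[of f h] cop by (metis coprime_iff_gcd_eq_1)
    hence "x = (x * r) * f + (x * s) * h" by (metis distrib_left mult.assoc mult.right_neutral)
    thus ?thesis using mult[OF f(1), of "x * r"] by (intro bexI[of _ "x * r * f"] bexI[of _ "x * s * h"]) auto
  qed
  ultimately show "\<exists>J. P.subspace J \<and> m \<in> J \<and> I \<inter> J = {f. m dvd f} \<and> (\<forall>f. \<exists>u\<in>I. \<exists>v\<in>J. f = u + v)"
    by blast
qed

lemma quot_dim_eq_degree:
  fixes m :: "'a::field poly"
  assumes "m \<noteq> 0"
  shows "quot_dim m = degree m"
proof -
  interpret V: vector_space "smult :: 'a \<Rightarrow> _" by unfold_locales (simp_all add: smult_add_right smult_add_left)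
  let ?B = "(\<lambda>j. monom 1 j :: 'a poly) ` {..<degree m}"
  have inj: "inj_on (\<lambda>j. monom 1 j :: 'a poly) {..<degree m}" by (auto intro!: inj_onI simp: monom_eq_iff')
  have "V.independent ?B"
  proof (rule V.independent_if_scalars_zero)
    fix f :: "'a poly \<Rightarrow> 'a" and x
    assume s: "(\<Sum>x\<in>?B. smult (f x) x) = 0" and x: "x \<in> ?B"
    then obtain j where j: "x = monom 1 j" "j < degree m" by auto
    have "(\<Sum>i<degree m. monom (f (monom 1 i)) i) = 0"
      using s inj by (simp add: sum.reindex smult_monom)
    hence "coeff (\<Sum>i<degree m. monom (f (monom 1 i)) i) j = 0" by simp
    thus "f x = 0" using j by (simp add: coeff_sum)
  qed simp
  moreover have "range (\<lambda>f. f mod m) \<subseteq> V.span ?B"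
  proof (rule image_subsetI)
    fix f
    have "f mod m = (\<Sum>i<degree m. smult (coeff (f mod m) i) (monom 1 i))"
    proof (rule poly_eqI)
      fix n
      have "coeff (f mod m) n = 0" if "n \<ge> degree m"
        using that degree_mod_less[OF assms, of f] by (auto intro: coeff_eq_0)
      thus "coeff (f mod m) n = coeff (\<Sum>i<degree m. smult (coeff (f mod m) i) (monom 1 i)) n"
        by (cases "n < degree m") (auto simp: coeff_sum smult_monom)
    qed
    also have "\<dots> \<in> V.span ?B" by (intro V.span_sum V.span_scale V.span_base) auto
    finally show "f mod m \<in> V.span ?B" .
  qed
  moreover have "?B \<subseteq> range (\<lambda>f. f mod m)"
  proof (rule image_subsetI)
    fix j assume "j \<in> {..<degree m}"
    hence "monom 1 j = monom 1 j mod m" by (simp add: mod_poly_less degree_monom_eq)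
    thus "monom 1 j \<in> range (\<lambda>f. f mod m)" by (rule range_eqI)
  qed
  ultimately show ?thesis unfolding quot_dim_def using inj by (intro V.dim_unique[of ?B]) (auto simp: card_image)
qed

lemma interpolating_poly:
  fixes x y :: "nat \<Rightarrow> 'a::field"
  assumes "inj x"
  obtains q where "degree q \<le> n" "\<And>i. i \<le> n \<Longrightarrow> poly q (x i) = y i"
proof -
  have "\<exists>q. degree q \<le> n \<and> (\<forall>i\<le>n. poly q (x i) = y i)"
  proof (induction n)
    case 0
    show ?case by (intro exI[of _ "[:y 0:]"]) simp
  next
    case (Suc n)
    then obtain q where q: "degree q \<le> n" "\<forall>i\<le>n. poly q (x i) = y i" by blast
    define w where "w = (\<Prod>i\<le>n. [:- x i, 1:])"
    have w: "poly w (x i) = 0" if "i \<le> n" for i using that by (auto simp: w_def poly_prod)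
    have w': "poly w (x (Suc n)) \<noteq> 0" using injD[OF assms] by (fastforce simp: w_def poly_prod)
    have "degree w \<le> (\<Sum>i\<le>n. degree [:- x i, 1:])" unfolding w_def using degree_prod_sum_le[of "{..n}" "\<lambda>i. [:- x i, 1:]"] by (simp add: o_def)
    hence dw: "degree w \<le> Suc n" by simp
    let ?q = "q + smult ((y (Suc n) - poly q (x (Suc n))) / poly w (x (Suc n))) w"
    have "degree ?q \<le> Suc n" using q(1) dw by (intro degree_add_le) (auto intro: order.trans[OF degree_smult_le])
    moreover have "poly ?q (x i) = y i" if "i \<le> Suc n" for i using that q(2) w w' by (auto simp: le_Suc_eq)
    ultimately show ?case by blast
  qed
  thus thesis using that by blast
qed

text \<open>Interpolation over the rationals at \<open>degree Q + 1\<close> odd numbers already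
  determines \<open>Q\<close>.\<close>

lemma rational_valued_poly:
  fixes Q :: "complex poly" and f :: "nat \<Rightarrow> rat"
  assumes "\<And>n. odd n \<Longrightarrow> of_rat (f n) = poly Q (of_nat n)"
  obtains q where "map_poly of_rat q = Q" "\<And>n. odd n \<Longrightarrow> f n = poly q (of_nat n)"
proof -
  have "inj (\<lambda>i. of_nat (2 * i + 1) :: rat)" by (auto intro!: injI)
  then obtain q where q: "degree q \<le> degree Q" "\<And>i. i \<le> degree Q \<Longrightarrow> poly q (of_nat (2 * i + 1)) = f (2 * i + 1)"
    using interpolating_poly[of "\<lambda>i. of_nat (2 * i + 1) :: rat" "degree Q" "\<lambda>i. f (2 * i + 1)"] by metis
  have ev: "poly (map_poly of_rat p) (of_nat k :: complex) = of_rat (poly p (of_nat k))" for p k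
    by (induction p) (simp_all add: map_poly_pCons of_rat_add of_rat_mult)
  have eq: "map_poly of_rat q = Q"
  proof (rule poly_eqI_degree)
    let ?A = "(\<lambda>i. of_nat (2 * i + 1) :: complex) ` {..degree Q}"
    have "inj_on (\<lambda>i. of_nat (2 * i + 1) :: complex) {..degree Q}"
      by (rule inj_onI) (simp only: of_nat_eq_iff add_right_cancel mult_cancel1, simp)
    hence "card ?A = Suc (degree Q)" by (simp add: card_image del: of_nat_add of_nat_mult)
    thus "degree (map_poly of_rat q :: complex poly) < card ?A" "degree Q < card ?A"
      using q(1) by (simp_all add: map_poly_of_rat_hom)
    fix z assume "z \<in> ?A"
    then obtain i where i: "i \<le> degree Q" "z = of_nat (2 * i + 1)" by blast
    show "poly (map_poly of_rat q) z = poly Q z" unfolding i(2) ev q(2)[OF i(1)] by (rule assms) simp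
  qed
  show thesis
  proof (rule that[OF eq])
    fix n :: nat assume "odd n"
    hence "of_rat (f n) = (of_rat (poly q (of_nat n)) :: complex)" using assms[of n] ev[of q n] eq by simp
    thus "f n = poly q (of_nat n)" by simp
  qed
qed

lemma poly_over_monomial_tendsto:
  fixes q :: "complex poly"
  assumes "degree q \<le> N"
  shows "(\<lambda>n. poly q (of_nat n) / of_nat n ^ N) \<longlonglongrightarrow> coeff q N"
proof -
  have "(\<lambda>n. \<Sum>i\<le>N. coeff q i * (1 / of_nat n) ^ (N - i)) \<longlonglongrightarrow> (\<Sum>i\<le>N. coeff q i * 0 ^ (N - i))"
    by (intro tendsto_intros lim_1_over_n)
  also have "(\<Sum>i\<le>N. coeff q i * 0 ^ (N - i)) = (\<Sum>i\<le>N. if i = N then coeff q i else 0)"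
    by (intro sum.cong) auto
  also have "\<dots> = coeff q N" by simp
  finally have "(\<lambda>n. \<Sum>i\<le>N. coeff q i * (1 / of_nat n) ^ (N - i)) \<longlonglongrightarrow> coeff q N" .
  moreover have "eventually (\<lambda>n. (\<Sum>i\<le>N. coeff q i * (1 / of_nat n) ^ (N - i)) = poly q (of_nat n) / of_nat n ^ N) sequentially"
    using eventually_gt_at_top[of 0]
  proof eventually_elim
    case (elim n)
    have "poly q (of_nat n) = (\<Sum>i\<le>N. coeff q i * of_nat n ^ i)"
      unfolding poly_altdef using assms by (intro sum.mono_neutral_left) (auto simp: coeff_eq_0)
    moreover have "of_nat n ^ i / of_nat n ^ N = (1 / of_nat n :: complex) ^ (N - i)" if "i \<le> N" for i
      using elim that by (simp add: power_diff power_divide field_simps)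
    ultimately show ?case by (simp add: sum_divide_distrib flip: times_divide_eq_right)
  qed
  ultimately show ?thesis by (rule Lim_transform_eventually)
qed

section \<open>The leading coefficient\<close>

context dyadic_place
begin

lemma poly_A: "(\<And>i. coeff p i \<in> A) \<Longrightarrow> x \<in> A \<Longrightarrow> poly p x \<in> A"
  unfolding poly_altdef by (intro A_intros) auto

lemma poly_diff_A:
  assumes "\<And>i. coeff p i \<in> A" "x \<in> A" "y \<in> A"
  obtains q where "q \<in> A" "poly p x - poly p y = (x - y) * q"
proof -
  have "\<exists>q\<in>A. poly p x - poly p y = (x - y) * q" using assms(1)
  proof (induction p)
    case 0
    show ?case by (intro bexI[of _ 0] A_intros) simp
  next
    case (pCons a p)
    have p: "coeff p i \<in> A" for i using pCons.prems[of "Suc i"] by simp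
    obtain q where q: "q \<in> A" "poly p x - poly p y = (x - y) * q" using pCons.IH p by blast
    have "poly (pCons a p) x - poly (pCons a p) y = (x - y) * poly p x + y * (poly p x - poly p y)"
      by (simp add: algebra_simps)
    also have "\<dots> = (x - y) * (poly p x + y * q)" unfolding q(2) by (simp add: algebra_simps)
    finally show ?case using q(1) poly_A[OF p assms(2)] assms(3) by (intro bexI[of _ "poly p x + y * q"] A_intros)
  qed
  thus thesis using that by blast
qed

lemma unit_power_M:
  assumes "x \<in> A" "x - 1 \<in> M"
  shows "x ^ m - 1 \<in> M"
proof (induction m)
  case (Suc m)
  have "x ^ Suc m - 1 = x * (x ^ m - 1) + (x - 1)" by (simp add: algebra_simps)
  thus ?case using M_ideal(1)[OF M_ideal(2)[OF Suc assms(1)] assms(2)] by (simp only:)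
qed (simp add: M_ideal)

text \<open>The product of the negated roots is \<open>p(0)\<close> up to sign, and \<open>M\<close>
  is prime.\<close>

lemma root_in_M:
  assumes A: "\<And>z. poly p z = 0 \<Longrightarrow> z \<in> A" and p: "lead_coeff p = 1 \<or> lead_coeff p = -1" "poly p 0 \<in> M"
  shows "\<exists>z. poly p z = 0 \<and> z \<in> M"
proof (rule ccontr)
  assume *: "\<not> (\<exists>z. poly p z = 0 \<and> z \<in> M)"
  have p0: "p \<noteq> 0" using p(1) by auto
  have "(\<Prod>x\<in>#S. - x) \<in> A - M" if "\<And>x. x \<in># S \<Longrightarrow> x \<in> A - M" for S
    using that
  proof (induction S)
    case empty
    show ?case using A_intros(1) M_ideal(6) by simp
  next
    case (add x S)
    have S: "(\<Prod>x\<in>#S. - x) \<in> A - M" using add by simp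
    have x: "- x \<in> A" "- x \<notin> M" using add.prems[of x] A_intros(4) M_ideal(4)[of "- x"] by auto
    show ?case using S x M_prime[OF x(1), of "\<Prod>x\<in>#S. - x"] A_intros(6)[OF x(1)] by auto
  qed
  moreover have "x \<in> A - M" if "x \<in># proots p" for x using that * A p0 by auto
  ultimately have "(\<Prod>x\<in>#proots p. - x) \<notin> M" by blast
  moreover have "poly p 0 = lead_coeff p * (\<Prod>x\<in>#proots p. - x)"
    by (subst complex_poly_decompose_multiset[symmetric]) (simp add: poly_prod_mset)
  hence "(\<Prod>x\<in>#proots p. - x) = poly p 0 \<or> (\<Prod>x\<in>#proots p. - x) = - poly p 0" using p(1) by auto
  ultimately show False using p(2) M_ideal(4)[of "poly p 0"] by auto
qed

end

context sl2
begin

lemma odd_nat_d: "odd (nat d)" using odd_d d0 by (simp add: even_nat_iff)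

abbreviation "Z \<equiv> {z. poly T z = 2 * \<i>}"

lemma poly_UT: "poly U z = fund (pat b d) z (nat d)" "poly T z = z * poly U z"
  "poly (pderiv T) z = poly U z + z * poly (pderiv U) z"
  by (simp_all add: U_def T_def poly_fund pderiv_mult pderiv_pCons)

lemma T_minus: "degree (T - [:2 * \<i>:]) = nat d" "lead_coeff (T - [:2 * \<i>:]) = 1 \<or> lead_coeff (T - [:2 * \<i>:]) = -1"
  "T - [:2 * \<i>:] \<noteq> 0"
proof -
  have dp: "nat d > 0" using d0 by simp
  obtain k where k: "nat d = Suc k" using dp by (cases "nat d") auto
  have "lead_coeff U = 1 \<or> lead_coeff U = -1" using R_degree[of k] unfolding U_def k by blast
  hence l: "lead_coeff T = 1 \<or> lead_coeff T = -1" unfolding T_def using degrees(6) by simp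
  have "degree (- [:2 * \<i>:]) < degree T" using degrees(2) dp by simp
  hence *: "degree (T + - [:2 * \<i>:]) = degree T" "lead_coeff (T + - [:2 * \<i>:]) = lead_coeff T"
    using degree_add_eq_left[of "- [:2 * \<i>:]" T] lead_coeff_add_le[of "- [:2 * \<i>:]" T] by (simp_all only: add.commute[of T])
  show "degree (T - [:2 * \<i>:]) = nat d" "lead_coeff (T - [:2 * \<i>:]) = 1 \<or> lead_coeff (T - [:2 * \<i>:]) = -1"
    unfolding diff_conv_add_uminus *(2) using *(1) l degrees(2) by (simp_all only:)
  thus "T - [:2 * \<i>:] \<noteq> 0" by auto
qed

lemma finite_Z: "finite Z"
  using poly_roots_finite[OF T_minus(3)] by simp

text \<open>Modulo the maximal ideal of a dyadic place exactly one summand is \<open>1\<close> and all others vanish.\<close>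

lemma trace_nonzero:
  assumes m: "m > 0"
  shows "(\<Sum>z\<in>Z. (poly U z * poly (pderiv T) z) ^ m) \<noteq> 0"
proof -
  obtain A where "dyadic_place A" by (rule dyadic_place_exists)
  then interpret dyadic_place A .
  have iA: "\<i> \<in> A"
  proof (rule root_in_A[of "[:1, 0, 1:]"])
    fix i show "coeff [:1, 0, 1:] i \<in> A" using A_intros(1,2) by (simp add: coeff_pCons split: nat.split)
  qed simp_all
  have iM: "2 * \<i> \<in> M" using M_ideal(2)[OF M_ideal(7) iA] by (simp add: mult.commute)
  have UA: "coeff U i \<in> A" for i unfolding U_def by (rule Ints_A[OF R_int])
  have TA: "coeff T i \<in> A" for i using UA A_intros(2) by (simp add: T_def coeff_pCons split: nat.split)
  have U'A: "coeff (pderiv U) i \<in> A" for i unfolding coeff_pderiv by (intro A_intros UA Ints_A) simp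
  have PA: "coeff (T - [:2 * \<i>:]) i \<in> A" for i
    using TA iA A_intros by (simp add: coeff_pCons split: nat.split)
  have root: "z \<in> A" if "poly (T - [:2 * \<i>:]) z = 0" for z by (rule root_in_A[OF PA T_minus(2) that])
  have "poly (T - [:2 * \<i>:]) 0 \<in> M" using M_ideal(4)[OF iM] by (simp add: poly_UT)
  then obtain z0 where z0: "z0 \<in> Z" "z0 \<in> M" using root_in_M[OF root T_minus(2)] by auto
  have zA: "z \<in> A" if "z \<in> Z" for z using root that by simp
  have uA: "poly U z \<in> A" "poly (pderiv T) z \<in> A" if "z \<in> Z" for z
    using zA[OF that] unfolding poly_UT(3) by (auto intro!: A_intros poly_A UA U'A)
  have u1: "poly U z - 1 \<in> M" if "z \<in> Z" "z \<in> M" for z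
  proof -
    have "fund (pat b d) z (nat d) - fibo z (nat d) \<in> M" by (rule fund_fibo_M[OF zA[OF that(1)]]) (rule unit)
    from M_ideal(1)[OF this fibo_odd_M[OF that(2) odd_nat_d]] show ?thesis by (simp add: poly_UT)
  qed
  \<comment> \<open>For \<open>z\<close> different from \<open>z0\<close>, dividing
    \<open>T(z) = T(z0)\<close> by \<open>z - z0\<close> would put \<open>U(z)\<close> into
    \<open>M\<close>, against \<open>U(z)\<close> being \<open>1\<close> modulo
    \<open>M\<close>.\<close>
  have unique: "z = z0" if z: "z \<in> Z" "z \<in> M" for z
  proof (rule ccontr)
    assume ne: "z \<noteq> z0"
    obtain q where q: "q \<in> A" "poly U z - poly U z0 = (z - z0) * q"
      using poly_diff_A[OF UA zA[OF z(1)] zA[OF z0(1)]] .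
    have "z * poly U z = z0 * poly U z0" using z z0 by (simp add: poly_UT(2))
    hence "(z - z0) * poly U z + z0 * (poly U z - poly U z0) = 0" by (simp add: algebra_simps)
    hence "(z - z0) * (poly U z + q * z0) = 0" unfolding q(2) by (simp add: algebra_simps)
    hence "poly U z = - (q * z0)" using ne by (simp add: eq_neg_iff_add_eq_0)
    hence "poly U z \<in> M" using M_ideal(2)[OF z0(2) q(1)] M_ideal(4) by simp
    hence "1 \<in> M" using M_minus[OF _ u1[OF z]] by fastforce
    thus False using M_ideal(6) by simp
  qed
  have t0: "(poly U z0 * poly (pderiv T) z0) ^ m - 1 \<in> M"
  proof (rule unit_power_M)
    have "z0 * poly U z0 = 2 * \<i>" using z0 by (simp add: poly_UT(2))
    hence "poly U z0 * poly (pderiv T) z0 - 1 = (poly U z0 + 1) * (poly U z0 - 1) + poly (pderiv U) z0 * (2 * \<i>)"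
      unfolding poly_UT(3) by algebra
    moreover have "(poly U z0 + 1) * (poly U z0 - 1) \<in> M"
      using uA[OF z0(1)] by (intro M_ideal(2)[OF u1[OF z0]] A_intros)
    moreover have "poly (pderiv U) z0 * (2 * \<i>) \<in> M" by (intro M_ideal(2)[OF iM] poly_A U'A zA z0)
    ultimately show "poly U z0 * poly (pderiv T) z0 - 1 \<in> M" using M_ideal(1) by simp
  qed (intro A_intros uA z0)
  \<comment> \<open>Here \<open>z\<close> is a unit while \<open>z * U(z) = 2 \<i>\<close> is not,
    so \<open>U(z)\<close> lies in \<open>M\<close>.\<close>
  have t: "(poly U z * poly (pderiv T) z) ^ m \<in> M" if z: "z \<in> Z - {z0}" for z
  proof -
    have zZ: "z \<in> Z" "z \<notin> M" using z unique by auto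
    have "z * poly U z \<in> M" using zZ iM by (simp add: poly_UT(2))
    hence "poly U z \<in> M" using M_prime[OF zA[OF zZ(1)] uA(1)[OF zZ(1)]] zZ by blast
    hence "poly U z * poly (pderiv T) z \<in> M" using M_ideal(2)[OF _ uA(2)[OF zZ(1)]] by (simp add: mult.commute)
    moreover obtain k where "m = Suc k" using m by (cases m) auto
    ultimately show ?thesis using M_ideal(2)[of _ "(poly U z * poly (pderiv T) z) ^ k"] A_intros(6,7) uA[OF zZ(1)]
      by (simp add: mult.commute)
  qed
  have "(\<Sum>z\<in>Z. (poly U z * poly (pderiv T) z) ^ m) - 1 =
      ((poly U z0 * poly (pderiv T) z0) ^ m - 1) + (\<Sum>z\<in>Z - {z0}. (poly U z * poly (pderiv T) z) ^ m)"
    using finite_Z z0(1) by (subst sum.remove[of _ z0]) auto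
  also have "\<dots> \<in> M" by (intro M_ideal(1) t0 M_sum t)
  finally have M1: "(\<Sum>z\<in>Z. (poly U z * poly (pderiv T) z) ^ m) - 1 \<in> M" .
  show ?thesis
  proof
    assume "(\<Sum>z\<in>Z. (poly U z * poly (pderiv T) z) ^ m) = 0"
    hence "- 1 \<in> M" using M1 by simp
    thus False using M_ideal(4)[of "- 1"] M_ideal(6) by simp
  qed
qed

lemma U_even: "poly U (- z) = poly U z"
proof -
  have "fund (pat b d) (- z) k = (-1) ^ Suc k * fund (pat b d) z k" for k
    by (induction k rule: induct_nat_012) (simp_all add: algebra_simps)
  thus ?thesis using odd_nat_d by (simp add: poly_UT)
qed

lemma T'_even: "poly (pderiv T) (- z) = poly (pderiv T) z"
proof -
  have "poly (pcompose T [:0, -1:]) = poly (- T)"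
    by (rule ext) (simp add: poly_pcompose poly_UT(2) U_even)
  hence "pderiv (pcompose T [:0, -1:]) = pderiv (- T)" by (simp only: poly_eq_poly_eq_iff)
  hence "poly (pderiv (pcompose T [:0, -1:])) z = - poly (pderiv T) z" by (simp add: pderiv_minus)
  thus ?thesis by (simp add: pderiv_pcompose poly_pcompose pderiv_pCons)
qed

lemma DD_roots: "{z. poly DD z = 0} = Z \<union> uminus ` Z" "Z \<inter> uminus ` Z = {}"
proof -
  have DD: "poly DD z = (poly T z - 2 * \<i>) * (poly T z + 2 * \<i>)" for z
    by (simp add: DD_def algebra_simps power2_eq_square)
  have Tm: "poly T (- z) = - poly T z" for z by (simp add: poly_UT(2) U_even)
  have im: "z \<in> uminus ` Z \<longleftrightarrow> poly T z = - (2 * \<i>)" for z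
  proof
    assume "poly T z = - (2 * \<i>)"
    hence "- z \<in> Z" by (simp add: Tm)
    thus "z \<in> uminus ` Z" by (metis imageI minus_minus)
  qed (auto simp: Tm)
  show "{z. poly DD z = 0} = Z \<union> uminus ` Z"
    using im by (auto simp: DD eq_neg_iff_add_eq_0)
  show "Z \<inter> uminus ` Z = {}"
  proof (rule equals0I)
    fix z assume "z \<in> Z \<inter> uminus ` Z"
    hence "poly T z = 2 * \<i>" "poly T z = - (2 * \<i>)" using im by auto
    thus False by simp
  qed
qed

text \<open>\<open>T\<close> is odd, so the points with \<open>T = -2 \<i>\<close> are the negatives
  of those with \<open>T = 2 \<i>\<close> and contribute equally. This is the factor
  \<open>2\<close> of the asymptotic formula.\<close>

lemma sum_DD: "(\<Sum>z | poly DD z = 0. (poly U z * poly (pderiv T) z / 2) ^ m) =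
    2 * (\<Sum>z\<in>Z. (poly U z * poly (pderiv T) z) ^ m) / 2 ^ m"
proof -
  let ?f = "\<lambda>z. (poly U z * poly (pderiv T) z / 2) ^ m"
  have "sum ?f (uminus ` Z) = sum ?f Z"
    by (subst sum.reindex) (auto simp: U_even T'_even inj_on_def)
  hence "sum ?f (Z \<union> uminus ` Z) = 2 * sum ?f Z"
    using finite_Z DD_roots(2) by (subst sum.union_disjoint) auto
  thus ?thesis unfolding DD_roots(1) by (simp add: power_divide sum_divide_distrib sum_distrib_left)
qed

end

section \<open>Transfer of the leading coefficient to the algebra of \<open>H1\<close>\<close>

lemma sum_proots_rsquarefree:
  fixes p :: "complex poly"
  assumes "rsquarefree p"
  shows "(\<Sum>z\<in>#proots p. f z) = (\<Sum>z | poly p z = 0. f z :: complex)"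
proof -
  have p: "p \<noteq> 0" using assms by (simp add: rsquarefree_def)
  show ?thesis unfolding sum_proots[OF p]
    using rsquarefree_root_order[OF assms _ p] by (intro sum.cong) auto
qed

lemma card_roots_rsquarefree:
  fixes p :: "complex poly"
  assumes "rsquarefree p"
  shows "card {z. poly p z = 0} = degree p"
proof -
  have size: "of_nat (size S) = (\<Sum>z\<in>#S. 1 :: complex)" for S :: "complex multiset" by (induction S) simp_all
  have "(of_nat (degree p) :: complex) = (\<Sum>z\<in>#proots p. 1)" by (simp only: size flip: size_proots_complex)
  also have "\<dots> = of_nat (card {z. poly p z = 0})" unfolding sum_proots_rsquarefree[OF assms] by simp
  finally show ?thesis by (simp only: of_nat_eq_iff)
qed

lemma map_poly_of_rat_power: "map_poly of_rat (p ^ n) = (map_poly of_rat p ^ n :: complex poly)"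
  by (induction n) (simp_all add: map_poly_of_rat_hom)

context sl2
begin

abbreviation "h1 \<equiv> map_poly of_int (H1 c d) :: complex poly"
abbreviation "h2 \<equiv> map_poly of_int (H2 c d) :: complex poly"
abbreviation "h3 \<equiv> map_poly of_int (H3 b c d) :: complex poly"

text \<open>Only the upper bound is read off the product; equality comes from the count in
  \<open>root_correspondence\<close>.\<close>

lemma degree_h1: "degree h1 \<le> nat d"
proof -
  have "degree (N_prod c d r $ i $ j) \<le> r" if "int r \<le> d" for r i j
    using that
  proof (induction r arbitrary: i j)
    case 0
    show ?case by (simp add: mat_def)
  next
    case (Suc r)
    have "0 \<le> alpha c d (Suc r)" using Suc.prems by (intro alpha_nonneg) auto
    note step_nth[OF this]
    moreover have "degree (smult w [:x, y:]) \<le> 1" for w x y :: complex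
      by (rule order.trans[OF degree_smult_le]) (rule degree_pCons_le[THEN order.trans], simp)
    ultimately have "degree (step c d r $ k $ l) \<le> 1" for k l
      using exhaust_2[of k] exhaust_2[of l] by auto
    moreover have "degree (N_prod c d r $ k $ l) \<le> r" for k l using Suc by simp
    ultimately have "degree (N_prod c d r $ i $ k * step c d r $ k $ j) \<le> r + 1" for k
      by (intro order.trans[OF degree_mult_le] add_mono)
    thus ?case unfolding N_prod_Suc_nth by (simp add: degree_add_le)
  qed
  moreover have "smult \<i> h1 = N_prod c d (nat d) $ 1 $ 1"
    using H1_H2_eq[OF odd_d even_c d0] by (simp add: vec_eq_iff forall_2 matrix_vector_mult_def sum_2)
  hence "degree (N_prod c d (nat d) $ 1 $ 1) = degree h1" by (metis degree_smult_eq complex_i_not_zero)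
  ultimately show ?thesis using d0 by (metis int_nat_eq less_imp_le order_refl)
qed

context
  assumes squarefree: "rsquarefree h1" and no_common: "\<And>y. poly h1 y = 0 \<Longrightarrow> poly h3 y \<noteq> 0"
begin

text \<open>\<open>H3\<close> at the dual root determines \<open>U(z)\<close> up to sign, hence
  \<open>z = 2 \<i> / U(z)\<close> up to sign, and \<open>- z\<close> is excluded because
  \<open>U\<close> is even. So the map is injective. Simple roots of \<open>H1\<close> force simple
  roots of \<open>T - 2 \<i>\<close>, of which there are \<open>d\<close>, and \<open>H1\<close> has
  at most \<open>d\<close> roots.\<close>

lemma root_correspondence:
  obtains Y where "bij_betw Y Z {y. poly h1 y = 0}"
    "\<And>z. z \<in> Z \<Longrightarrow> (poly U z * poly h3 (Y z)) ^ 2 = 1"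
    "\<And>z. z \<in> Z \<Longrightarrow> - poly (pderiv h1) (Y z) * poly h2 (Y z) * poly U z = poly (pderiv T) z"
    "\<And>z. z \<in> Z \<Longrightarrow> poly (pderiv T) z \<noteq> 0" "degree h1 = nat d"
proof -
  have h1': "poly (pderiv h1) y \<noteq> 0" if "poly h1 y = 0" for y
    using squarefree that unfolding rsquarefree_roots by blast
  have U0: "poly U z \<noteq> 0" if "z \<in> Z" for z using that by (auto simp: poly_UT(2))
  have "\<forall>z\<in>Z. \<exists>y. poly h1 y = 0 \<and> (poly U z * poly h3 y) ^ 2 = 1 \<and>
      - poly (pderiv h1) y * poly h2 y * poly U z = poly (pderiv T) z \<and> poly h2 y \<noteq> 0"
  proof
    fix z assume "z \<in> Z"
    hence "z * fund (pat b d) z (nat d) = 2 * \<i>" by (simp add: poly_UT)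
    then interpret parabolic_dual a b c d z by unfold_locales
    have u: "u = poly U z" by (simp add: u_def f_def poly_UT)
    show "\<exists>y. poly h1 y = 0 \<and> (poly U z * poly h3 y) ^ 2 = 1 \<and>
      - poly (pderiv h1) y * poly h2 y * poly U z = poly (pderiv T) z \<and> poly h2 y \<noteq> 0"
      using parabolic_duality unfolding u T_def U_def by blast
  qed
  then obtain Y where "\<forall>z\<in>Z. poly h1 (Y z) = 0 \<and> (poly U z * poly h3 (Y z)) ^ 2 = 1 \<and>
      - poly (pderiv h1) (Y z) * poly h2 (Y z) * poly U z = poly (pderiv T) z \<and> poly h2 (Y z) \<noteq> 0"
    unfolding bchoice_iff by (rule exE)
  hence Y: "\<And>z. z \<in> Z \<Longrightarrow> poly h1 (Y z) = 0" "\<And>z. z \<in> Z \<Longrightarrow> (poly U z * poly h3 (Y z)) ^ 2 = 1"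
      "\<And>z. z \<in> Z \<Longrightarrow> - poly (pderiv h1) (Y z) * poly h2 (Y z) * poly U z = poly (pderiv T) z"
      "\<And>z. z \<in> Z \<Longrightarrow> poly h2 (Y z) \<noteq> 0"
    by blast+
  have T': "poly (pderiv T) z \<noteq> 0" if "z \<in> Z" for z
    unfolding Y(3)[OF that, symmetric] using Y(4)[OF that] h1'[OF Y(1)[OF that]] U0[OF that] by simp
  have inj: "inj_on Y Z"
  proof (rule inj_onI)
    fix z w assume zw: "z \<in> Z" "w \<in> Z" "Y z = Y w"
    have "(poly U z * poly h3 (Y z)) ^ 2 = (poly U w * poly h3 (Y z)) ^ 2"
      using Y(2)[OF zw(1)] Y(2)[OF zw(2)] zw(3) by simp
    hence "poly U z = poly U w \<or> poly U z = - poly U w"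
      using no_common[OF Y(1)[OF zw(1)]] by (simp add: power_mult_distrib power2_eq_iff)
    moreover have e: "z * poly U z = 2 * \<i>" "w * poly U w = 2 * \<i>" using zw by (simp_all add: poly_UT(2))
    moreover have False if n: "poly U z = - poly U w"
    proof -
      have "w * poly U w = - z * poly U w" using e n by simp
      hence "w = - z" using U0[OF zw(2)] by (simp only: mult_cancel_right) blast
      hence "poly U w = poly U z" using U_even by simp
      thus False using n U0[OF zw(2)] by simp
    qed
    ultimately have "poly U z = poly U w" by blast
    thus "z = w" using e U0[OF zw(2)] by (metis mult_cancel_right)
  qed
  have "rsquarefree (T - [:2 * \<i>:])" using T' by (auto simp: rsquarefree_roots pderiv_diff pderiv_pCons)
  from card_roots_rsquarefree[OF this] have "card Z = nat d" using T_minus(1) by simp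
  hence c: "card (Y ` Z) = nat d" using inj by (simp add: card_image)
  have h0: "h1 \<noteq> 0" using squarefree by (simp add: rsquarefree_def)
  have sub: "Y ` Z \<subseteq> {y. poly h1 y = 0}" using Y(1) by auto
  have fin: "finite {y. poly h1 y = 0}" by (rule poly_roots_finite[OF h0])
  have "nat d \<le> card {y. poly h1 y = 0}" using card_mono[OF fin sub] c by simp
  hence card: "card {y. poly h1 y = 0} = nat d" "degree h1 = nat d"
    using degree_h1 card_roots_rsquarefree[OF squarefree] by auto
  have "Y ` Z = {y. poly h1 y = 0}" using card c by (intro card_subset_eq fin sub) simp
  hence "bij_betw Y Z {y. poly h1 y = 0}" using inj by (simp add: bij_betw_def)
  thus thesis by (rule that) (fact Y(2) Y(3) T' card(2))+
qed

lemma Omega_W_root: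
  assumes y: "poly h1 y = 0"
  shows "poly (map_poly of_rat (Omega_W b c d)) y = - poly (pderiv h1) y * poly h2 y / poly h3 y ^ 2"
proof -
  let ?h1 = "map_poly of_int (H1 c d) :: rat poly" and ?h3 = "map_poly of_int (H3 b c d) :: rat poly"
  let ?k = "modular_inverse ?h1 ?h3"
  \<comment> \<open>Coprimality makes \<open>modular_inverse\<close> a genuine inverse instead of
    its default value \<open>0\<close>.\<close>
  have "coprime ?h3 ?h1"
    using no_common by (intro coprime_of_rat_polyI) (auto simp: map_poly_of_rat_of_int)
  hence "[?h3 * ?k = 1] (mod ?h1)" by (rule cong_modular_inverse1)
  hence "?h1 dvd ?h3 * ?k - 1" by (simp add: cong_iff_dvd_diff)
  then obtain r where "?h3 * ?k - 1 = ?h1 * r" by (elim dvdE)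
  hence "?h3 * ?k = 1 + ?h1 * r" by (simp add: algebra_simps)
  hence "map_poly of_rat (?h3 * ?k) = (map_poly of_rat (1 + ?h1 * r) :: complex poly)" by simp
  hence "h3 * map_poly of_rat ?k = 1 + h1 * map_poly of_rat r"
    by (simp add: map_poly_of_rat_hom map_poly_of_rat_of_int)
  hence "poly (h3 * map_poly of_rat ?k) y = poly (1 + h1 * map_poly of_rat r) y" by simp
  hence "poly h3 y * poly (map_poly of_rat ?k) y = 1" using y by simp
  hence k: "poly (map_poly of_rat ?k) y = 1 / poly h3 y" using no_common[OF y] by (simp add: field_simps)
  have p: "map_poly of_int (pderiv (H1 c d)) = pderiv h1"
    by (rule poly_eqI) (simp add: coeff_map_poly coeff_pderiv)
  have m: "map_poly of_rat (- q) = (- map_poly of_rat q :: complex poly)" for q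
    by (rule poly_eqI) (simp add: coeff_map_poly of_rat_minus)
  show ?thesis unfolding Omega_W_def map_poly_of_rat_hom(2) map_poly_of_rat_power m map_poly_of_rat_of_int p
    by (simp add: k power_divide)
qed

lemma trace_Omega_W:
  "of_rat (quot_trace (map_poly of_int (H1 c d)) (Omega_W b c d ^ m)) =
    (\<Sum>z\<in>Z. (poly U z * poly (pderiv T) z) ^ m)"
proof -
  obtain Y where Y: "bij_betw Y Z {y. poly h1 y = 0}"
    "\<And>z. z \<in> Z \<Longrightarrow> (poly U z * poly h3 (Y z)) ^ 2 = 1"
    "\<And>z. z \<in> Z \<Longrightarrow> - poly (pderiv h1) (Y z) * poly h2 (Y z) * poly U z = poly (pderiv T) z"
    using root_correspondence by metis
  have h0: "h1 \<noteq> 0" using squarefree by (simp add: rsquarefree_def)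
  have "of_rat (quot_trace (map_poly of_int (H1 c d)) (Omega_W b c d ^ m)) =
      (\<Sum>y | poly h1 y = 0. poly (map_poly of_rat (Omega_W b c d)) y ^ m)"
    unfolding of_rat_quot_trace map_poly_of_rat_of_int map_poly_of_rat_power quot_trace_eq_sum_roots[OF h0]
      sum_proots_rsquarefree[OF squarefree] poly_power ..
  also have "\<dots> = (\<Sum>z\<in>Z. poly (map_poly of_rat (Omega_W b c d)) (Y z) ^ m)"
    by (rule sum.reindex_bij_betw[OF Y(1), symmetric])
  also have "\<dots> = (\<Sum>z\<in>Z. (poly U z * poly (pderiv T) z) ^ m)"
  proof (rule sum.cong[OF refl])
    fix z assume z: "z \<in> Z"
    have y: "poly h1 (Y z) = 0" using bij_betwE[OF Y(1)] z by blast
    have "poly h3 (Y z) \<noteq> 0" by (rule no_common[OF y])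
    hence "1 / poly h3 (Y z) ^ 2 = poly U z ^ 2" using Y(2)[OF z] by (simp add: field_simps power_mult_distrib)
    hence "poly (map_poly of_rat (Omega_W b c d)) (Y z) = - poly (pderiv h1) (Y z) * poly h2 (Y z) * poly U z ^ 2"
      unfolding Omega_W_root[OF y] by (metis divide_inverse inverse_eq_divide)
    also have "\<dots> = poly U z * poly (pderiv T) z" unfolding Y(3)[OF z, symmetric] by (simp add: power2_eq_square)
    finally show "poly (map_poly of_rat (Omega_W b c d)) (Y z) ^ m = (poly U z * poly (pderiv T) z) ^ m" by simp
  qed
  finally show ?thesis .
qed

lemma quotient_algebra:
  "quot_semisimple (map_poly of_int (H1 c d) :: rat poly)" "int (quot_dim (map_poly of_int (H1 c d) :: rat poly)) = d"
proof -
  let ?h1 = "map_poly of_int (H1 c d) :: rat poly"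
  have h0: "h1 \<noteq> 0" using squarefree by (simp add: rsquarefree_def)
  have r0: "?h1 \<noteq> 0"
  proof
    assume "?h1 = 0"
    hence "map_poly of_rat ?h1 = (0 :: complex poly)" by simp
    thus False using h0 by (simp add: map_poly_of_rat_of_int)
  qed
  have p: "map_poly of_rat (pderiv ?h1) = pderiv h1"
    by (rule poly_eqI) (simp add: coeff_map_poly coeff_pderiv of_rat_mult of_rat_add)
  have "coprime ?h1 (pderiv ?h1)"
  proof (rule coprime_of_rat_polyI)
    fix z :: complex assume "poly (map_poly of_rat ?h1) z = 0"
    hence "poly h1 z = 0" by (simp only: map_poly_of_rat_of_int)
    thus "poly (map_poly of_rat (pderiv ?h1)) z \<noteq> 0" unfolding p using squarefree by (auto simp: rsquarefree_roots)
  qed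
  thus "quot_semisimple ?h1" by (rule quot_semisimpleI[OF _ r0])
  have "degree h1 = nat d" using root_correspondence by metis
  moreover have "degree h1 = degree ?h1" by (metis map_poly_of_rat_of_int map_poly_of_rat_hom(3))
  ultimately show "int (quot_dim ?h1) = d" unfolding quot_dim_eq_degree[OF r0] using d0 by simp
qed

end
end

lemma zeta_nat_pos: "s \<ge> 2 \<Longrightarrow> zeta_nat s > 0"
proof -
  assume "s \<ge> 2"
  hence "summable (\<lambda>n. inverse (real n ^ s))" by (rule inverse_power_summable)
  hence "summable (\<lambda>n. 1 / real (Suc n) ^ s)" by (subst (asm) summable_Suc_iff[symmetric]) (simp add: inverse_eq_divide)
  thus ?thesis unfolding zeta_nat_def by (rule suminf_pos) simp
qed

lemma of_real_of_rat: "of_real (of_rat q) = (of_rat q :: 'a::{real_field,field_char_0})"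
  by (cases q) (simp add: of_rat_rat)

theorem theorem3:
  fixes a b c d :: int and g :: nat
  assumes "a * d - b * c = 1"
    and "odd a" and "odd d" and "even b" and "even c"
    and "0 \<le> b" and "b < d" and "0 < c"
    and "2 \<le> g"
  shows
    "(\<exists>Q :: rat poly. \<forall>n :: nat. odd n \<longrightarrow>
        signature g (a + b * int n) (c + d * int n) = poly Q (of_nat n)) \<and>
     (rsquarefree (map_poly of_int (H1 c d) :: complex poly) \<and>
      \<not> (\<exists>z :: complex. poly (map_poly of_int (H1 c d)) z = 0 \<and> poly (map_poly of_int (H3 b c d)) z = 0) \<longrightarrow>
      quot_semisimple (map_poly of_int (H1 c d) :: rat poly) \<and>
      int (quot_dim (map_poly of_int (H1 c d) :: rat poly)) = d \<and>
      (\<lambda>n. of_rat (signature g (a + b * int n) (c + d * int n)) :: real)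
        \<sim>[inf at_top (principal {n :: nat. odd n})]
      (\<lambda>n. 2 * (real n ^ 3 / (2 * pi ^ 2)) ^ (g - 1) * zeta_nat (2 * g - 2) *
         of_rat (quot_trace (map_poly of_int (H1 c d)) (Omega_W b c d ^ (g - 1)))))"
proof -
  interpret sl2 a b c d using assms by unfold_locales auto
  define m where "m = g - 1"
  have m: "m > 0" "g = Suc m" "2 * g - 2 = 2 * m" using assms(9) by (auto simp: m_def)
  let ?s = "\<lambda>n. signature g (a + b * int n) (c + d * int n)"
  let ?F = "inf at_top (principal {n :: nat. odd n})"
  obtain Q where Q: "degree Q \<le> 3 * m" "\<And>n. odd n \<Longrightarrow> of_rat (?s n) = poly Q (of_nat n)"
    and lead: "(\<And>z. poly DD z = 0 \<Longrightarrow> poly (pderiv T) z \<noteq> 0) \<Longrightarrow> coeff Q (3 * m) =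
       of_real (zeta_nat (2 * m)) / of_real pi ^ (2 * m) * (\<Sum>z | poly DD z = 0. (poly U z * poly (pderiv T) z / 2) ^ m)"
    unfolding m(2) by (rule signature_complex_poly[OF m(1)]) (rule that[unfolded m(2)], assumption, blast+)
  have 1: "\<exists>q :: rat poly. \<forall>n. odd n \<longrightarrow> ?s n = poly q (of_nat n)"
    using rational_valued_poly[OF Q(2)] by metis
  have 2: "quot_semisimple (map_poly of_int (H1 c d) :: rat poly) \<and>
      int (quot_dim (map_poly of_int (H1 c d) :: rat poly)) = d \<and>
      (\<lambda>n. of_rat (?s n) :: real) \<sim>[?F]
      (\<lambda>n. 2 * (real n ^ 3 / (2 * pi ^ 2)) ^ (g - 1) * zeta_nat (2 * g - 2) *
         of_rat (quot_trace (map_poly of_int (H1 c d)) (Omega_W b c d ^ (g - 1))))"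
    if sf: "rsquarefree h1" and nc: "\<not> (\<exists>z. poly h1 z = 0 \<and> poly h3 z = 0)"
  proof (intro conjI)
    have nc': "poly h3 y \<noteq> 0" if "poly h1 y = 0" for y using nc that by blast
    show "quot_semisimple (map_poly of_int (H1 c d) :: rat poly)"
      "int (quot_dim (map_poly of_int (H1 c d) :: rat poly)) = d" by (rule quotient_algebra[OF sf nc']; assumption)+
    define t where "t = quot_trace (map_poly of_int (H1 c d)) (Omega_W b c d ^ m)"
    have t: "of_rat t = (\<Sum>z\<in>Z. (poly U z * poly (pderiv T) z) ^ m)"
      unfolding t_def by (rule trace_Omega_W[OF sf nc'])
    \<comment> \<open>With a zero constant the limit below would give no asymptotic
      equivalence.\<close>
    have t0: "t \<noteq> 0" using trace_nonzero[OF m(1)] unfolding t[symmetric] by auto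
    \<comment> \<open>The leading coefficient \<open>zeta_nat (2 * m) / pi^(2 m)\<close> times
      \<open>2 t / 2^m\<close>, with the powers of \<open>2\<close> and of \<open>pi^2\<close>
      merged.\<close>
    define \<kappa> where "\<kappa> = 2 * zeta_nat (2 * m) * of_rat t / (2 * pi ^ 2) ^ m"
    have \<kappa>: "\<kappa> \<noteq> 0" using t0 zeta_nat_pos[of "2 * m"] m(1) by (auto simp: \<kappa>_def)
    have T': "poly (pderiv T) z \<noteq> 0" if z: "poly DD z = 0" for z
    proof -
      have "\<And>z. z \<in> Z \<Longrightarrow> poly (pderiv T) z \<noteq> 0" using root_correspondence[OF sf nc'] by metis
      moreover have "z \<in> Z \<or> - z \<in> Z" using z DD_roots(1) by force
      ultimately show ?thesis using T'_even[of z] by metis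
    qed
    have "coeff Q (3 * m) = of_real (zeta_nat (2 * m)) / of_real pi ^ (2 * m) * (2 * of_rat t / 2 ^ m)"
      by (subst lead[OF T']) (simp_all only: sum_DD t)
    hence "coeff Q (3 * m) = complex_of_real \<kappa>"
      by (simp add: \<kappa>_def power_mult power_mult_distrib of_real_of_rat) (simp add: mult_ac)
    with poly_over_monomial_tendsto[OF Q(1)]
    have "(\<lambda>n. poly Q (of_nat n) / of_nat n ^ (3 * m)) \<longlonglongrightarrow> complex_of_real \<kappa>" by simp
    hence "((\<lambda>n. poly Q (of_nat n) / of_nat n ^ (3 * m)) \<longlongrightarrow> complex_of_real \<kappa>) ?F"
      by (rule tendsto_mono[rotated]) simp
    moreover have "eventually (\<lambda>n. poly Q (of_nat n) / of_nat n ^ (3 * m) =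
        complex_of_real (of_rat (?s n) / real n ^ (3 * m))) ?F"
      unfolding eventually_inf_principal by (intro always_eventually) (simp add: Q(2)[symmetric] of_real_of_rat)
    ultimately have "((\<lambda>n. complex_of_real (of_rat (?s n) / real n ^ (3 * m))) \<longlongrightarrow> complex_of_real \<kappa>) ?F"
      by (rule Lim_transform_eventually)
    hence "((\<lambda>n. of_rat (?s n) / real n ^ (3 * m)) \<longlongrightarrow> \<kappa>) ?F" by (simp only: tendsto_of_real_iff)
    hence "(\<lambda>n. of_rat (?s n)) \<sim>[?F] (\<lambda>n. \<kappa> * real n ^ (3 * m))" by (rule asymp_equivI'_const[OF _ \<kappa>])
    also have "(\<lambda>n. \<kappa> * real n ^ (3 * m)) = (\<lambda>n. 2 * (real n ^ 3 / (2 * pi ^ 2)) ^ m * zeta_nat (2 * m) * of_rat t)"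
      by (rule ext) (simp add: \<kappa>_def power_divide power_mult)
    finally show "(\<lambda>n. of_rat (?s n) :: real) \<sim>[?F]
      (\<lambda>n. 2 * (real n ^ 3 / (2 * pi ^ 2)) ^ (g - 1) * zeta_nat (2 * g - 2) *
         of_rat (quot_trace (map_poly of_int (H1 c d)) (Omega_W b c d ^ (g - 1))))"
      unfolding m(3) t_def m_def .
  qed
  show ?thesis using 1 2 by blast
qed

end
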